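(* Let $V=(V,Y,\mathbf 1,\omega)$ be a simple VOA and let $D$ be a finite abelian subgroup of $\mathrm{Aut}(V)$. Suppose that $V(d_1)\times V(d_2)=V(d_1d_2)$ for all $d_1,d_2\in\mathrm{Hom}(D,\mathbb C^\times)$. Then the restriction homomorphism $\varphi_V:N_{\mathrm{Aut}(V)}(D)\to H$, $g\mapsto g|_{V(1_D)}$, is surjective and $\mathrm{Ker}\,\varphi_V=D$.
   Context: VOAs are over $\mathbb C$. $\mathrm{Aut}(V)$ is the group of linear automorphisms $g$ of $V$ with $Y(gv,z)g=gY(v,z)$ for all $v\in V$ and $g\omega=\omega$. For $d\in\mathrm{Hom}(D,\mathbb C^\times)$ put $V(d)=\{v\in V\mid b(v)=d(b)v\ \text{for all } b\in D\}$, and let $1_D$ be the identity element of $\mathrm{Hom}(D,\mathbb C^\times)$. Then $V=\bigoplus_d V(d)$, $V(1_D)$ is a (simple) subVOA, and the $V(d)$ are pairwise non-isomorphic irreducible $V(1_D)$-modules. The fusion product is over the VOA $V(1_D)$: for irreducible modules $M^i$ representing all isomorphism classes $W^i$, $W^i\times W^j=\sum_k N_{M^iM^j}^{M^k}W^k$ (formal sum), where $N_{M^iM^j}^{M^k}$ is the dimension of the space of intertwining operators of type $\binom{M^k}{M^i\ M^j}$. Isomorphism classes are denoted by representatives. For a module $(M,Y_M)$ over a VOA $U$ and $h\in\mathrm{Aut}(U)$, $M^h$ is $M$ with vertex operators $Y_M(hv,z)$. $N_{\mathrm{Aut}(V)}(D)$ is the normalizer of $D$ in $\mathrm{Aut}(V)$,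 and $$H=\{h\in\mathrm{Aut}(V(1_D))\mid\{V(d)^h\mid d\in\mathrm{Hom}(D,\mathbb C^\times)\}=\{V(d)\mid d\in\mathrm{Hom}(D,\mathbb C^\times)\}\},$$ the equality being of sets of isomorphism classes of $V(1_D)$-modules. *)

theory Defs
  imports Complex_Main "HOL-Algebra.Bij" "HOL-Algebra.Group_Action"
    "HOL-Library.Function_Algebras" "HOL-Library.Groups_Big_Fun" "HOL-Library.Extended_Nat"
begin

section \<open>Complex vector spaces\<close>

class complex_vector = ab_group_add +
  fixes scaleC :: "complex \<Rightarrow> 'a \<Rightarrow> 'a"  (infixr \<open>*\<^sub>C\<close> 75)
  assumes scaleC_add_right: "a *\<^sub>C (x + y) = a *\<^sub>C x + a *\<^sub>C y"
    and scaleC_add_left: "(a + b) *\<^sub>C x = a *\<^sub>C x + b *\<^sub>C x"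
    and scaleC_scaleC: "a *\<^sub>C (b *\<^sub>C x) = (a * b) *\<^sub>C x"
    and scaleC_one: "1 *\<^sub>C x = x"

global_interpretation cvec: vector_space "scaleC :: complex \<Rightarrow> 'a \<Rightarrow> 'a::complex_vector"
  by unfold_locales (fact scaleC_add_right scaleC_add_left scaleC_scaleC scaleC_one)+

instantiation complex :: complex_vector
begin
definition scaleC_complex :: "complex \<Rightarrow> complex \<Rightarrow> complex"
  where "scaleC_complex a x = a * x"
instance by standard (simp_all add: scaleC_complex_def algebra_simps)
end

instantiation "fun" :: (type, complex_vector) complex_vector
begin
definition scaleC_fun :: "complex \<Rightarrow> ('a \<Rightarrow> 'b) \<Rightarrow> 'a \<Rightarrow> 'b"
  where "scaleC_fun a f = (\<lambda>x. a *\<^sub>C f x)"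
instance
  by standard (simp_all add: scaleC_fun_def fun_eq_iff scaleC_add_right scaleC_add_left
      scaleC_scaleC scaleC_one)
end

definition linear_on :: "'a::complex_vector set \<Rightarrow> 'b::complex_vector set \<Rightarrow> ('a \<Rightarrow> 'b) \<Rightarrow> bool"
  where "linear_on S T f \<longleftrightarrow>
    (\<forall>x\<in>S. f x \<in> T) \<and>
    (\<forall>x\<in>S. \<forall>y\<in>S. f (x + y) = f x + f y) \<and>
    (\<forall>c. \<forall>x\<in>S. f (c *\<^sub>C x) = c *\<^sub>C f x)"

definition bilinear_on ::
  "'a::complex_vector set \<Rightarrow> 'b::complex_vector set \<Rightarrow> 'c::complex_vector set \<Rightarrow> ('a \<Rightarrow> 'b \<Rightarrow> 'c) \<Rightarrow> bool"
  where "bilinear_on S T R f \<longleftrightarrow>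
    (\<forall>x\<in>S. linear_on T R (f x)) \<and> (\<forall>y\<in>T. linear_on S R (\<lambda>x. f x y))"

definition fin_dim :: "'a::complex_vector set \<Rightarrow> bool"
  where "fin_dim S \<longleftrightarrow> (\<exists>B. finite B \<and> S \<subseteq> cvec.span B)"

text \<open>The library's dimension is \<open>0\<close> on infinite-dimensional spaces.\<close>

definition edim :: "'a::complex_vector set \<Rightarrow> enat"
  where "edim S = (if fin_dim S then enat (cvec.dim S) else \<infinity>)"


section \<open>Vertex operator algebras and their modules\<close>

text \<open>
  Spaces are linear subspaces of an ambient complex vector space, so that a subspace of a VOA can
  itself be a VOA.  Vertex operators are given by their modes:
  \<open>vop V v n w\<close> is \<open>v\<^sub>n w\<close>, where \<open>Y(v,z) = (\<Sum>n\<in>\<int>. v\<^sub>n z^(-n-1))\<close>.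
  The values of the operations outside the underlying spaces are irrelevant.
\<close>

record 'a voa =
  vspace :: "'a set"
  vop :: "'a \<Rightarrow> int \<Rightarrow> 'a \<Rightarrow> 'a"
  vac :: 'a
  conf :: 'a

record ('a, 'm) vmod =
  mspace :: "'m set"
  mop :: "'a \<Rightarrow> int \<Rightarrow> 'm \<Rightarrow> 'm"

definition adjoint :: "'a voa \<Rightarrow> ('a, 'a) vmod"
  where "adjoint V = \<lparr>mspace = vspace V, mop = vop V\<rparr>"

text \<open>
  The Jacobi identity
  \<^verbatim>\<open>  z0^-1 delta((z1-z2)/z0) Y3(u,z1) I(w1,z2) w2 - z0^-1 delta((z2-z1)/-z0) I(w1,z2) Y2(u,z1) w2\<close>
  \<^verbatim>\<open>    = z2^-1 delta((z1-z0)/z2) I(Y1(u,z0) w1, z2) w2\<close>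

  \<^noindent> for \<open>I(w1,z) = (\<Sum>r. I w1 r z^(-r-1))\<close>, as the equality of the coefficients of
  \<^verbatim>\<open>z0^(-l-1) z1^(-m-1) z2^(-r-1)\<close>.  The modes of \<open>I\<close> are indexed by the ring \<open>'k\<close>: by the integers
  for the action of a VOA, by the complex numbers for an intertwining operator.  The sums over \<open>i\<close>
  have finite support by the truncation conditions, which always accompany this identity.
\<close>

definition jacobi ::
  "('a \<Rightarrow> int \<Rightarrow> 'b \<Rightarrow> 'b) \<Rightarrow> ('a \<Rightarrow> int \<Rightarrow> 'c \<Rightarrow> 'c) \<Rightarrow> ('a \<Rightarrow> int \<Rightarrow> 'd \<Rightarrow> 'd) \<Rightarrow>
   ('b \<Rightarrow> 'k::ring_1 \<Rightarrow> 'c \<Rightarrow> 'd::complex_vector) \<Rightarrow> 'a \<Rightarrow> 'b \<Rightarrow> 'c \<Rightarrow> bool"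
  where "jacobi Y1 Y2 Y3 I u w1 w2 \<longleftrightarrow>
    (\<forall>l m :: int. \<forall>r :: 'k.
      Sum_any (\<lambda>i::nat. ((- 1) ^ i * (of_int l gchoose i)) *\<^sub>C
          (Y3 u (m + l - int i) (I w1 (r + of_nat i) w2)
           - ((- 1) powi l) *\<^sub>C I w1 (r + of_int l - of_nat i) (Y2 u (m + int i) w2)))
      = Sum_any (\<lambda>i::nat. (of_int m gchoose i) *\<^sub>C
          I (Y1 u (l + int i) w1) (of_int m + r - of_nat i) w2))"

text \<open>Eigenspaces of \<open>L(0) = \<omega>\<^sub>1\<close>.\<close>

definition weight_space :: "'a voa \<Rightarrow> ('a, 'm::complex_vector) vmod \<Rightarrow> complex \<Rightarrow> 'm set"
  where "weight_space V M c = {w \<in> mspace M. mop M (conf V) 1 w = c *\<^sub>C w}"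

abbreviation Vir :: "'a voa \<Rightarrow> int \<Rightarrow> 'a \<Rightarrow> 'a"
  where "Vir V n \<equiv> vop V (conf V) (n + 1)"

locale VOA =
  fixes V :: "'a::complex_vector voa"
  assumes subspace: "cvec.subspace (vspace V)"
    and vac_in: "vac V \<in> vspace V"
    and conf_in: "conf V \<in> vspace V"
    and bilinear: "bilinear_on (vspace V) (vspace V) (vspace V) (\<lambda>u. vop V u n)"
    and truncation: "\<lbrakk>u \<in> vspace V; v \<in> vspace V\<rbrakk> \<Longrightarrow> \<exists>N. \<forall>n\<ge>N. vop V u n v = 0"
    and vacuum: "v \<in> vspace V \<Longrightarrow> vop V (vac V) n v = (if n = - 1 then v else 0)"
    and creation: "v \<in> vspace V \<Longrightarrow> vop V v (- 1) (vac V) = v"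
      "\<lbrakk>v \<in> vspace V; n \<ge> 0\<rbrakk> \<Longrightarrow> vop V v n (vac V) = 0"
    and jacobi: "\<lbrakk>u \<in> vspace V; v \<in> vspace V; w \<in> vspace V\<rbrakk> \<Longrightarrow>
      jacobi (vop V) (vop V) (vop V) (vop V) u v w"
    and virasoro: "\<exists>c. \<forall>m n. \<forall>v\<in>vspace V.
      Vir V m (Vir V n v) - Vir V n (Vir V m v) =
        of_int (m - n) *\<^sub>C Vir V (m + n) v
        + (if m + n = 0 then (of_int (m ^ 3 - m) / 12 * c) *\<^sub>C v else 0)"
    and derivative: "\<lbrakk>u \<in> vspace V; v \<in> vspace V\<rbrakk> \<Longrightarrow>
      vop V (Vir V (- 1) u) n v = - (of_int n *\<^sub>C vop V u (n - 1) v)"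
    and grading: "cvec.span (\<Union>n::int. weight_space V (adjoint V) (of_int n)) = vspace V"
    and grading_fin_dim: "fin_dim (weight_space V (adjoint V) (of_int n))"
    and grading_bounded_below: "\<exists>N. \<forall>n<N. weight_space V (adjoint V) (of_int n) = {0}"

locale VOA_module = VOA V for V :: "'a::complex_vector voa" +
  fixes M :: "('a, 'm::complex_vector) vmod"
  assumes msubspace: "cvec.subspace (mspace M)"
    and mbilinear: "bilinear_on (vspace V) (mspace M) (mspace M) (\<lambda>u. mop M u n)"
    and mtruncation: "\<lbrakk>u \<in> vspace V; w \<in> mspace M\<rbrakk> \<Longrightarrow> \<exists>N. \<forall>n\<ge>N. mop M u n w = 0"
    and mvacuum: "w \<in> mspace M \<Longrightarrow> mop M (vac V) n w = (if n = - 1 then w else 0)"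
    and mjacobi: "\<lbrakk>u \<in> vspace V; v \<in> vspace V; w \<in> mspace M\<rbrakk> \<Longrightarrow>
      jacobi (vop V) (mop M) (mop M) (mop M) u v w"
    and mgrading: "cvec.span (\<Union>c. weight_space V M c) = mspace M"
    and mgrading_fin_dim: "fin_dim (weight_space V M c)"
    and mgrading_bounded_below: "\<exists>N::int. \<forall>n<N. weight_space V M (c + of_int n) = {0}"

definition submodule_of :: "'a voa \<Rightarrow> ('a, 'm::complex_vector) vmod \<Rightarrow> 'm set \<Rightarrow> bool"
  where "submodule_of V M N \<longleftrightarrow>
    cvec.subspace N \<and> N \<subseteq> mspace M \<and> (\<forall>v\<in>vspace V. \<forall>n. \<forall>w\<in>N. mop M v n w \<in> N)"

definition irreducible_module :: "'a::complex_vector voa \<Rightarrow> ('a, 'm::complex_vector) vmod \<Rightarrow> bool"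
  where "irreducible_module V M \<longleftrightarrow>
    VOA_module V M \<and> mspace M \<noteq> {0} \<and>
    (\<forall>N. submodule_of V M N \<longrightarrow> N = {0} \<or> N = mspace M)"

definition simple_VOA :: "'a::complex_vector voa \<Rightarrow> bool"
  where "simple_VOA V \<longleftrightarrow> VOA V \<and> irreducible_module V (adjoint V)"

definition module_isomorphic ::
  "'a voa \<Rightarrow> ('a, 'm::complex_vector) vmod \<Rightarrow> ('a, 'n::complex_vector) vmod \<Rightarrow> bool"
  where "module_isomorphic V M N \<longleftrightarrow>
    (\<exists>f. linear_on (mspace M) (mspace N) f \<and> bij_betw f (mspace M) (mspace N) \<and>
      (\<forall>v\<in>vspace V. \<forall>n. \<forall>w\<in>mspace M. f (mop M v n w) = mop N v n (f w)))"

definition iso_class ::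
  "'a::complex_vector voa \<Rightarrow> ('a, 'm::complex_vector) vmod \<Rightarrow> ('a, 'm) vmod set"
  where "iso_class V M = {N. VOA_module V N \<and> module_isomorphic V M N}"


section \<open>Intertwining operators and the fusion product\<close>

text \<open>
  Intertwining operators of type \<^verbatim>\<open>(M3 over M1 M2)\<close>, again given by modes:
  \<open>I(w1,z) = (\<Sum>r\<in>\<complex>. I w1 r z^(-r-1))\<close>.  They are made zero off \<open>M1\<close> and \<open>M2\<close> so that different
  functions represent different operators, and the dimension is the one of the space of operators.
\<close>

definition intertwining_operators ::
  "'a::complex_vector voa \<Rightarrow> ('a, 'b::complex_vector) vmod \<Rightarrow> ('a, 'c::complex_vector) vmod \<Rightarrow>
   ('a, 'd::complex_vector) vmod \<Rightarrow> ('b \<Rightarrow> complex \<Rightarrow> 'c \<Rightarrow> 'd) set"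
  where "intertwining_operators V M1 M2 M3 = {I.
    (\<forall>w1 r w2. w1 \<notin> mspace M1 \<or> w2 \<notin> mspace M2 \<longrightarrow> I w1 r w2 = 0) \<and>
    (\<forall>r. bilinear_on (mspace M1) (mspace M2) (mspace M3) (\<lambda>w1. I w1 r)) \<and>
    (\<forall>w1\<in>mspace M1. \<forall>w2\<in>mspace M2. \<forall>r. \<exists>N::int. \<forall>n\<ge>N. I w1 (r + of_int n) w2 = 0) \<and>
    (\<forall>u\<in>vspace V. \<forall>w1\<in>mspace M1. \<forall>w2\<in>mspace M2.
      jacobi (mop M1) (mop M2) (mop M3) I u w1 w2) \<and>
    (\<forall>w1\<in>mspace M1. \<forall>w2\<in>mspace M2. \<forall>r.
      I (mop M1 (conf V) 0 w1) r w2 = - (r *\<^sub>C I w1 (r - 1) w2))}"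

definition fusion_rule ::
  "'a::complex_vector voa \<Rightarrow> ('a, 'b::complex_vector) vmod \<Rightarrow> ('a, 'c::complex_vector) vmod \<Rightarrow>
   ('a, 'd::complex_vector) vmod \<Rightarrow> enat"
  where "fusion_rule V M1 M2 M3 = edim (intertwining_operators V M1 M2 M3)"

text \<open>
  A formal sum of isomorphism classes of irreducible modules is the function sending an irreducible
  module to the multiplicity of its class (and every other module to \<open>0\<close>).  The modules are those
  whose space is a subspace of \<open>nat \<Rightarrow> complex\<close>.  This gives all isomorphism classes: the weights
  of an irreducible module lie in one coset of \<open>\<int>\<close> in \<open>\<complex>\<close> and its weight spaces are
  finite-dimensional, so it has countable dimension.
\<close>

type_synonym 'a formal_sum = "('a, nat \<Rightarrow> complex) vmod \<Rightarrow> enat"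

definition single_class ::
  "'a::complex_vector voa \<Rightarrow> ('a, 'm::complex_vector) vmod \<Rightarrow> 'a formal_sum"
  where "single_class V M =
    (\<lambda>W. if irreducible_module V W \<and> module_isomorphic V M W then 1 else 0)"

definition fusion_product ::
  "'a::complex_vector voa \<Rightarrow> ('a, 'b::complex_vector) vmod \<Rightarrow> ('a, 'c::complex_vector) vmod \<Rightarrow>
   'a formal_sum"
  where "fusion_product V M1 M2 =
    (\<lambda>W. if irreducible_module V W then fusion_rule V M1 M2 W else 0)"


section \<open>Automorphisms and eigenspaces\<close>

definition Aut :: "'a::complex_vector voa \<Rightarrow> ('a \<Rightarrow> 'a) monoid"
  where "Aut V = BijGroup (vspace V) \<lparr>carrier := {g \<in> Bij (vspace V).
    linear_on (vspace V) (vspace V) g \<and>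
    (\<forall>v\<in>vspace V. \<forall>n. \<forall>w\<in>vspace V. g (vop V v n w) = vop V (g v) n (g w)) \<and>
    g (conf V) = conf V}\<rparr>"

definition twist :: "('a, 'm) vmod \<Rightarrow> ('a \<Rightarrow> 'a) \<Rightarrow> ('a, 'm) vmod"
  where "twist M h = M\<lparr>mop := \<lambda>v. mop M (h v)\<rparr>"

definition complex_units :: "complex monoid"
  where "complex_units = \<lparr>carrier = UNIV - {0}, mult = (*), one = 1\<rparr>"

text \<open>\<open>Hom(D, \<complex>\<^sup>\<times>)\<close>, for a subset \<open>D\<close> of \<open>G\<close>; extensionality makes characters equal if they
  agree on \<open>D\<close>.\<close>

definition char_group :: "('g, 'x) monoid_scheme \<Rightarrow> 'g set \<Rightarrow> ('g \<Rightarrow> complex) monoid"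
  where "char_group G D =
    \<lparr>carrier = hom (G\<lparr>carrier := D\<rparr>) complex_units \<inter> extensional D,
     mult = \<lambda>d1 d2. \<lambda>b\<in>D. d1 b * d2 b,
     one = \<lambda>b\<in>D. 1\<rparr>"

abbreviation chars :: "'a::complex_vector voa \<Rightarrow> ('a \<Rightarrow> 'a) set \<Rightarrow> (('a \<Rightarrow> 'a) \<Rightarrow> complex) monoid"
  where "chars V D \<equiv> char_group (Aut V) D"

definition eigenspace ::
  "'a::complex_vector voa \<Rightarrow> ('a \<Rightarrow> 'a) set \<Rightarrow> (('a \<Rightarrow> 'a) \<Rightarrow> complex) \<Rightarrow> 'a set"
  where "eigenspace V D d = {v \<in> vspace V. \<forall>b\<in>D. b v = d b *\<^sub>C v}"

definition fixed_VOA :: "'a::complex_vector voa \<Rightarrow> ('a \<Rightarrow> 'a) set \<Rightarrow> 'a voa"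
  where "fixed_VOA V D = V\<lparr>vspace := eigenspace V D \<one>\<^bsub>chars V D\<^esub>\<rparr>"

definition eigenmodule ::
  "'a::complex_vector voa \<Rightarrow> ('a \<Rightarrow> 'a) set \<Rightarrow> (('a \<Rightarrow> 'a) \<Rightarrow> complex) \<Rightarrow> ('a, 'a) vmod"
  where "eigenmodule V D d = \<lparr>mspace = eigenspace V D d, mop = vop V\<rparr>"

definition normalizer_group ::
  "'a::complex_vector voa \<Rightarrow> ('a \<Rightarrow> 'a) set \<Rightarrow> ('a \<Rightarrow> 'a) monoid"
  where "normalizer_group V D = Aut V \<lparr>carrier := normalizer (Aut V) D\<rparr>"

definition H_group :: "'a::complex_vector voa \<Rightarrow> ('a \<Rightarrow> 'a) set \<Rightarrow> ('a \<Rightarrow> 'a) monoid"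
  where "H_group V D = Aut (fixed_VOA V D) \<lparr>carrier := {h \<in> carrier (Aut (fixed_VOA V D)).
    (\<lambda>d. iso_class (fixed_VOA V D) (twist (eigenmodule V D d) h)) ` carrier (chars V D) =
    (\<lambda>d. iso_class (fixed_VOA V D) (eigenmodule V D d)) ` carrier (chars V D)}\<rparr>"

definition restriction_map ::
  "'a::complex_vector voa \<Rightarrow> ('a \<Rightarrow> 'a) set \<Rightarrow> ('a \<Rightarrow> 'a) \<Rightarrow> 'a \<Rightarrow> 'a"
  where "restriction_map V D g = restrict g (vspace (fixed_VOA V D))"

end

theory Submission
  imports Defs "HOL-Computational_Algebra.Fundamental_Theorem_Algebra"
    "HOL-Algebra.Multiplicative_Group" "HOL-Library.Countable_Set"
begin

text \<open>
Write \<open>U = V(1)\<close> for the fixed-point algebra, so that \<open>V\<close> is the sum of the \<open>V(d)\<close>.  Two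
consequences of the Jacobi identity and of simplicity are used throughout: every nonzero vector
\<open>w\<close> generates \<open>V\<close> under single modes (\<open>generated_eq\<close>), and \<open>v\<^sub>n w \<noteq> 0\<close> for some \<open>n\<close> whenever \<open>v\<close>
and \<open>w\<close> are nonzero (\<open>op_nonvanishing\<close>).  Projecting the first statement to the eigenspaces
shows that \<open>V(d)\<close> is an irreducible \<open>U\<close>-module; the second shows that \<open>V(d)\<close> and \<open>V(e)\<close> have
nonzero products in \<open>V(de)\<close>.

The fusion rules enter in the following form.  An operator \<open>(v,w) \<mapsto> F(Y(g v,z) g' w)\<close>, where
\<open>g\<close>, \<open>g'\<close> and \<open>F\<close> are compatible with an automorphism \<open>h\<close> of \<open>U\<close>, is an intertwining operator
among eigenspaces (\<open>twisted_intertwiner\<close>).  If it is nonzero, its target is \<open>V(d\<^sub>1d\<^sub>2)\<close> up to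
isomorphism (\<open>intertwiner_iso\<close>), and then it is a multiple of the vertex operator of \<open>V\<close>
(\<open>intertwiner_proportional\<close>). As the modules in a formal sum consist of sequences of complex
numbers, the eigenspaces have to be copied there first, which is possible because \<open>V\<close> has
countable dimension.

The \<open>V(d)\<close> are pairwise non-isomorphic: an isomorphism \<open>V(d) \<cong> V(e)\<close> gives \<open>V(1) \<cong> V(d\<inverse>e)\<close> by
fusion, and the image of the vacuum is killed by \<open>L(-1)\<close>.  Its mode of index \<open>-1\<close> commutes with
all modes, so it is a scalar by Schur's lemma, the image is a multiple of the vacuum, and
\<open>d = e\<close>.

An element \<open>g\<close> of the normalizer permutes the \<open>V(d)\<close>, which makes the restriction map well
defined. If \<open>g\<close> is the identity on \<open>U\<close>, it maps every \<open>V(d)\<close> to an isomorphic eigenspace, hence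
to itself, and acts there by a scalar \<open>\<lambda>(d)\<close>.  Nonvanishing products make \<open>\<lambda>\<close> a character of the
group of characters of \<open>D\<close>, so by duality \<open>\<lambda>(d) = d(b)\<close> for some \<open>b\<close> in \<open>D\<close>, and \<open>g = b\<close>.

For surjectivity, \<open>h\<close> in \<open>H\<close> provides isomorphisms \<open>G\<^sub>d : V(d) \<rightarrow> V(\<tau> d)\<close> that are semilinear
over \<open>h\<close>. By the fusion rules \<open>\<tau>\<close> is multiplicative and \<open>Y(G v,z) G w = c(d,e) G (Y(v,z) w)\<close> for
nonzero numbers \<open>c(d,e)\<close>.  Commutativity and associativity of vertex operators make \<open>c\<close> a
symmetric 2-cocycle, and on a finite abelian group such a cocycle is a coboundary
(\<open>symmetric_cocycle_is_coboundary\<close>).  So rescaling the \<open>G\<^sub>d\<close> turns them into an automorphism of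
\<open>V\<close>.  It normalizes \<open>D\<close>, again by duality, and restricts to \<open>h\<close>.
\<close>

section \<open>Linear maps on subspaces\<close>

lemma linear_onI:
  assumes "\<And>x. x \<in> S \<Longrightarrow> f x \<in> T"
    and "\<And>x y. x \<in> S \<Longrightarrow> y \<in> S \<Longrightarrow> f (x + y) = f x + f y"
    and "\<And>c x. x \<in> S \<Longrightarrow> f (c *\<^sub>C x) = c *\<^sub>C f x"
  shows "linear_on S T f"
  using assms by (auto simp: linear_on_def)

lemma
  assumes "linear_on S T f"
  shows linear_on_in: "x \<in> S \<Longrightarrow> f x \<in> T"
    and linear_on_add: "x \<in> S \<Longrightarrow> y \<in> S \<Longrightarrow> f (x + y) = f x + f y"
    and linear_on_scale: "x \<in> S \<Longrightarrow> f (c *\<^sub>C x) = c *\<^sub>C f x"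
  using assms by (auto simp: linear_on_def)

lemma linear_on_zero:
  assumes "linear_on S T f" "cvec.subspace S"
  shows "f 0 = 0"
  using linear_on_scale[OF assms(1) cvec.subspace_0[OF assms(2)], of 0] by simp

lemma linear_on_diff:
  assumes "linear_on S T f" "cvec.subspace S" "x \<in> S" "y \<in> S"
  shows "f (x - y) = f x - f y"
  using linear_on_add[OF assms(1) cvec.subspace_diff[OF assms(2-4)] assms(4)] by (simp add:
      algebra_simps)

lemma linear_on_sum:
  assumes "linear_on S T f" "cvec.subspace S" "\<And>i. i \<in> I \<Longrightarrow> x i \<in> S"
  shows "f (\<Sum>i\<in>I. x i) = (\<Sum>i\<in>I. f (x i))"
  using assms(3)
proof (induction I rule: infinite_finite_induct)
  case (insert i I)
  then show ?case
    using linear_on_add[OF assms(1), of "x i" "sum x I"] cvec.subspace_sum[OF assms(2), of I x] by simp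
qed (simp_all add: linear_on_zero[OF assms(1,2)])

lemma linear_on_subset:
  assumes "linear_on S T f" "S' \<subseteq> S" "\<And>x. x \<in> S' \<Longrightarrow> f x \<in> T'"
  shows "linear_on S' T' f"
  using assms by (auto simp: linear_on_def subset_iff)

lemma linear_on_compose:
  assumes "linear_on S T f" "linear_on T R g"
  shows "linear_on S R (\<lambda>x. g (f x))"
  using assms by (auto simp: linear_on_def)

lemma linear_on_inv_into:
  assumes f: "linear_on S T f" and bij: "bij_betw f S T" and S: "cvec.subspace S"
  shows "linear_on T S (inv_into S f)"
proof (rule linear_onI)
  have inj: "inj_on f S" and im: "f ` S = T"
    using bij by (auto simp: bij_betw_def)
  have inS: "inv_into S f y \<in> S" if "y \<in> T" for y
    using that im by (metis inv_into_into)
  have fi: "f (inv_into S f y) = y" if "y \<in> T" for y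
    using that im by (metis f_inv_into_f)
  fix x y c assume x: "x \<in> T"
  show "inv_into S f x \<in> S" by (rule inS[OF x])
  show "inv_into S f (c *\<^sub>C x) = c *\<^sub>C inv_into S f x"
    using inv_into_f_eq[OF inj, of "c *\<^sub>C inv_into S f x" "c *\<^sub>C x"]
      linear_on_scale[OF f inS[OF x]] cvec.subspace_scale[OF S inS[OF x]] fi[OF x] by simp
  assume y: "y \<in> T"
  show "inv_into S f (x + y) = inv_into S f x + inv_into S f y"
    using inv_into_f_eq[OF inj, of "inv_into S f x + inv_into S f y" "x + y"]
      linear_on_add[OF f inS[OF x] inS[OF y]] cvec.subspace_add[OF S inS[OF x] inS[OF y]]
      fi[OF x] fi[OF y] by simp
qed

lemma subspace_linear_image:
  assumes f: "linear_on S T f" and S: "cvec.subspace S"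
  shows "cvec.subspace (f ` S)"
proof (rule cvec.subspaceI)
  show "0 \<in> f ` S"
    using linear_on_zero[OF f S] cvec.subspace_0[OF S] by (metis imageI)
  show "x + y \<in> f ` S" if "x \<in> f ` S" "y \<in> f ` S" for x y
    using that linear_on_add[OF f] cvec.subspace_add[OF S] by (auto simp: image_iff) metis
  show "c *\<^sub>C x \<in> f ` S" if "x \<in> f ` S" for c x
    using that linear_on_scale[OF f] cvec.subspace_scale[OF S] by (auto simp: image_iff) metis
qed

lemma linear_on_span:
  assumes f: "linear_on S T f" and S: "cvec.subspace S" and X: "X \<subseteq> S" and x: "x \<in> cvec.span X"
  shows "f x \<in> cvec.span (f ` X)"
proof -
  have "x \<in> S \<and> f x \<in> cvec.span (f ` X)"
    using x
  proof (induction rule: cvec.span_induct_alt)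
    case base
    then show ?case
      using linear_on_zero[OF f S] cvec.subspace_0[OF S] cvec.span_zero by auto
  next
    case (step c x y)
    then have "x \<in> S" using X by auto
    with step show ?case
      using linear_on_add[OF f, of "c *\<^sub>C x" y] linear_on_scale[OF f, of x c]
      by (simp add: cvec.subspace_add[OF S] cvec.subspace_scale[OF S] cvec.span_add cvec.span_scale
          cvec.span_base)
  qed
  then show ?thesis by blast
qed

lemma fin_dim_subset: "fin_dim S \<Longrightarrow> R \<subseteq> S \<Longrightarrow> fin_dim R"
  unfolding fin_dim_def by blast

lemma fin_dim_linear_image:
  assumes f: "linear_on S T f" and S: "cvec.subspace S" and X: "X \<subseteq> S" and fd: "fin_dim X"
  shows "fin_dim (f ` X)"
proof -
  obtain B0 where B0: "finite B0" "X \<subseteq> cvec.span B0"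
    using fd by (auto simp: fin_dim_def)
  obtain B where B: "B \<subseteq> X" "cvec.independent B" "X \<subseteq> cvec.span B"
    using cvec.maximal_independent_subset by blast
  have "finite B"
    using cvec.independent_span_bound[OF B0(1) B(2)] B(1) B0(2) by blast
  moreover have "f ` X \<subseteq> cvec.span (f ` B)"
    using linear_on_span[OF f S, of B] B X by blast
  ultimately show ?thesis
    unfolding fin_dim_def by blast
qed

lemma edim_eq_0I:
  assumes "S \<subseteq> {0}"
  shows "edim S = 0"
proof -
  have S: "S \<subseteq> cvec.span {}" using assms by simp
  then have "fin_dim S" unfolding fin_dim_def by blast
  moreover have "cvec.dim S \<le> 0" using cvec.dim_le_card[OF S] by simp
  ultimately show ?thesis by (simp add: edim_def zero_enat_def)
qed

lemma edim_eq_0D: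
  assumes "edim S = 0" "x \<in> S"
  shows "x = 0"
proof -
  have fd: "fin_dim S" and d: "cvec.dim S = 0"
    using assms(1) by (auto simp: edim_def zero_enat_def split: if_splits)
  obtain T where T: "finite T" "S \<subseteq> cvec.span T"
    using fd by (auto simp: fin_dim_def)
  obtain B where B: "B \<subseteq> S" "cvec.independent B" "S \<subseteq> cvec.span B" "card B = cvec.dim S"
    using cvec.basis_exists by blast
  have "finite B"
    using cvec.independent_span_bound[OF T(1) B(2)] B(1) T(2) by blast
  then have "B = {}" using B(4) d by simp
  then show ?thesis using B(3) assms(2) by auto
qed

lemma edim_eq_1D:
  assumes "edim S = 1" "x \<in> S" "y \<in> S" "y \<noteq> 0"
  obtains c where "x = c *\<^sub>C y"
proof -
  have d: "cvec.dim S = 1"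
    using assms(1) by (auto simp: edim_def one_enat_def split: if_splits)
  obtain B where B: "B \<subseteq> S" "cvec.independent B" "S \<subseteq> cvec.span B" "card B = cvec.dim S"
    using cvec.basis_exists by blast
  then obtain e where e: "B = {e}"
    using d by (metis card_1_singletonE)
  obtain a b where "x = a *\<^sub>C e" "y = b *\<^sub>C e"
    using B(3) assms(2,3) unfolding e cvec.span_singleton by blast
  then have "x = (a / b) *\<^sub>C y"
    using assms(4) by (auto simp: scaleC_scaleC)
  then show thesis by (rule that)
qed

section \<open>Eigenvectors\<close>

text \<open>
Splitting off a linear factor \<open>X - r\<close> of \<open>p\<close> leaves a quotient \<open>q\<close> of smaller degree.  Either
\<open>q(T) v\<close> is nonzero and hence an eigenvector for \<open>r\<close>, or \<open>q\<close> annihilates \<open>v\<close> as well.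
\<close>

lemma eigenvector_of_annihilating_polynomial:
  fixes v :: "'a::complex_vector"
  assumes W: "cvec.subspace W" and T: "linear_on W W T"
    and v: "v \<in> W" "v \<noteq> 0"
    and p: "p \<noteq> 0" "degree p \<le> n" "(\<Sum>i\<le>n. Polynomial.coeff p i *\<^sub>C (T ^^ i) v) = 0"
  shows "\<exists>w\<in>W. w \<noteq> 0 \<and> (\<exists>c. T w = c *\<^sub>C w)"
  using p
proof (induction n arbitrary: p)
  case 0
  then have "Polynomial.coeff p 0 \<noteq> 0" by (metis le_zero_eq leading_coeff_0_iff)
  with 0 v show ?case by simp
next
  case (Suc n)
  have it: "(T ^^ i) v \<in> W" for i
    by (induction i) (auto simp: v linear_on_in[OF T])
  show ?case
  proof (cases "Polynomial.coeff p (Suc n) = 0")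
    case True
    then have "degree p \<noteq> Suc n" using Suc.prems(1) by (metis leading_coeff_0_iff)
    then have "degree p \<le> n" using Suc.prems(2) by simp
    then show ?thesis using Suc.IH[of p] Suc.prems True by simp
  next
    case False
    then have "\<not> constant (poly p)"
      by (metis Suc.prems(2) coeff_eq_0 constant_degree le_imp_less_Suc le_zero_eq
          less_Suc_eq_0_disj not_less)
    then obtain r where "poly p r = 0"
      using fundamental_theorem_of_algebra by blast
    then obtain q where q: "p = [:- r, 1:] * q"
      by (meson dvdE poly_eq_0_iff_dvd)
    have q0: "q \<noteq> 0" using q Suc.prems(1) by auto
    have dq: "degree q \<le> n"
      using Suc.prems(2) q0 unfolding q by (subst (asm) degree_mult_eq) auto
    let ?x = "\<lambda>i. (T ^^ i) v"
    define u where "u = (\<Sum>i\<le>n. Polynomial.coeff q i *\<^sub>C ?x i)"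
    have c0: "Polynomial.coeff p 0 = - r * Polynomial.coeff q 0" and cS: "Polynomial.coeff p (Suc
        i) = Polynomial.coeff q i - r * Polynomial.coeff q (Suc i)" for i
      unfolding q by (simp_all add: algebra_simps)
    have qn: "Polynomial.coeff q (Suc n) = 0" using dq by (simp add: coeff_eq_0)
    have uW: "u \<in> W" unfolding u_def
      by (intro cvec.subspace_sum[OF W] cvec.subspace_scale[OF W] it)
    have Tu: "T u = (\<Sum>i\<le>n. Polynomial.coeff q i *\<^sub>C ?x (Suc i))"
      unfolding u_def
      by (subst linear_on_sum[OF T W]) (auto simp: linear_on_scale[OF T] it cvec.subspace_scale[OF W])
    have u': "u = Polynomial.coeff q 0 *\<^sub>C ?x 0 + (\<Sum>i\<le>n. Polynomial.coeff q (Suc i) *\<^sub>C ?x (Suc i))"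
    proof -
      have "u = (\<Sum>i\<le>Suc n. Polynomial.coeff q i *\<^sub>C ?x i)" unfolding u_def using qn by simp
      then show ?thesis by (simp only: sum.atMost_Suc_shift)
    qed
    have "0 = (\<Sum>i\<le>Suc n. Polynomial.coeff p i *\<^sub>C ?x i)" using Suc.prems(3) by simp
    also have "\<dots> = Polynomial.coeff p 0 *\<^sub>C ?x 0 + (\<Sum>i\<le>n. Polynomial.coeff p (Suc i) *\<^sub>C ?x (Suc i))"
      by (simp only: sum.atMost_Suc_shift)
    also have "\<dots> = T u - r *\<^sub>C u"
      proof -
      have "r *\<^sub>C u = (r * Polynomial.coeff q 0) *\<^sub>C ?x 0 + (\<Sum>i\<le>n. (r * Polynomial.coeff q (Suc
          i)) *\<^sub>C ?x (Suc i))"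
        by (subst u') (simp only: cvec.scale_right_distrib cvec.scale_sum_right scaleC_scaleC)
      then show ?thesis
        unfolding Tu c0 cS cvec.scale_left_diff_distrib sum_subtractf by simp
    qed
    finally have "T u = r *\<^sub>C u" by simp
    show ?thesis
    proof (cases "u = 0")
      case True
      then show ?thesis using Suc.IH[OF q0 dq] u_def by simp
    next
      case False
      then show ?thesis using uW \<open>T u = r *\<^sub>C u\<close> by blast
    qed
  qed
qed

text \<open>
More iterates \<open>T\<^sup>i v\<close> than the dimension of \<open>W\<close> are linearly dependent or repeat, and either
gives a nonzero polynomial that annihilates \<open>v\<close>.
\<close>

lemma eigenvector_exists:
  assumes W: "cvec.subspace W" and fd: "fin_dim W" and T: "linear_on W W T"
    and v: "v \<in> W" "v \<noteq> 0"
  shows "\<exists>w\<in>W. w \<noteq> 0 \<and> (\<exists>c. T w = c *\<^sub>C w)"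
proof -
  obtain B where B: "finite B" "W \<subseteq> cvec.span B"
    using fd by (auto simp: fin_dim_def)
  let ?x = "\<lambda>i. (T ^^ i) v"
  define N where "N = card B"
  have it: "?x i \<in> W" for i
    by (induction i) (auto simp: v linear_on_in[OF T])
  have "\<exists>c. (\<exists>i\<le>N. c i \<noteq> 0) \<and> (\<Sum>i\<le>N. c i *\<^sub>C ?x i) = 0"
  proof (cases "inj_on ?x {..N}")
    case True
    have "\<not> cvec.independent (?x ` {..N})"
    proof
      assume "cvec.independent (?x ` {..N})"
      then have "card (?x ` {..N}) \<le> card B"
        using cvec.independent_span_bound[OF B(1)] it B(2) by blast
      then show False using card_image[OF True] N_def by simp
    qed
    then obtain u where u: "\<exists>w\<in>?x ` {..N}. u w \<noteq> 0" "(\<Sum>w\<in>?x ` {..N}. u w *\<^sub>C w) = 0"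
      using cvec.dependent_finite[of "?x ` {..N}"] by blast
    then show ?thesis
      by (intro exI[of _ "\<lambda>i. u (?x i)"]) (auto simp: sum.reindex[OF True])
  next
    case False
    then obtain i j where ij: "i \<le> N" "j \<le> N" "i \<noteq> j" "?x i = ?x j"
      by (auto simp: inj_on_def)
    let ?c = "\<lambda>k. (if k = i then 1 else 0) - (if k = j then 1 else 0) :: complex"
    have "(\<Sum>k\<le>N. ?c k *\<^sub>C ?x k) = (\<Sum>k\<le>N. if k = i then ?x k else 0) - (\<Sum>k\<le>N. if k = j then ?x k else 0)"
      unfolding sum_subtractf[symmetric] by (intro sum.cong) (auto simp: cvec.scale_left_diff_distrib)
    also have "\<dots> = 0" using ij by (simp add: sum.delta)
    finally show ?thesis using ij(1,3) by (intro exI[of _ ?c]) auto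
  qed
  then obtain c where c: "\<exists>i\<le>N. c i \<noteq> 0" "(\<Sum>i\<le>N. c i *\<^sub>C ?x i) = 0" by blast
  define p where "p = (\<Sum>i\<le>N. Polynomial.monom (c i) i)"
  have cp: "Polynomial.coeff p j = (if j \<le> N then c j else 0)" for j
  proof -
    have "Polynomial.coeff p j = (\<Sum>i\<le>N. if i = j then c i else 0)"
      unfolding p_def coeff_sum by (intro sum.cong) auto
    then show ?thesis by (simp add: sum.delta)
  qed
  have "p \<noteq> 0" using c(1) cp by (metis coeff_0)
  moreover have "degree p \<le> N"
    by (rule degree_le) (simp add: cp)
  moreover have "(\<Sum>i\<le>N. Polynomial.coeff p i *\<^sub>C ?x i) = 0" using c(2) by (simp add: cp)
  ultimately show ?thesis
    by (rule eigenvector_of_annihilating_polynomial[OF W T v])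
qed

lemma sum_powers_root_of_unity:
  assumes "(z::complex) ^ n = 1" "z \<noteq> 1"
  shows "(\<Sum>k<n. z ^ k) = 0"
  using geometric_sum[OF assms(2), of n] assms by simp

text \<open>
A discrete Fourier transform over the orbit of \<open>v\<close>: the sums \<open>\<Sum>\<^sub>j z\<^sup>k\<^sup>j T\<^sup>j v\<close>, for a primitive
\<open>n\<close>-th root of unity \<open>z\<close>, are eigenvectors, and their sum over \<open>k\<close> is \<open>n v\<close>.
\<close>

lemma finite_order_eigen_decomposition:
  assumes W: "cvec.subspace W" and T: "linear_on W W T" and v: "v \<in> W"
    and n: "n > 0" "(T ^^ n) v = v"
  shows "v \<in> cvec.span {w \<in> W. \<exists>c. T w = c *\<^sub>C w}"
proof -
  let ?x = "\<lambda>i. (T ^^ i) v"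
  have it: "?x i \<in> W" for i
    by (induction i) (auto simp: v linear_on_in[OF T])
  \<comment> \<open>A primitive \<open>n\<close>-th root of unity.\<close>
  define z where "z = cis (2 * pi / of_nat n)"
  have zn: "z ^ n = 1" using n(1) by (simp add: z_def DeMoivre)
  have zj: "z ^ j \<noteq> 1" if "0 < j" "j < n" for j
  proof
    assume "z ^ j = 1"
    then have "cis (2 * pi * real j / real n) = 1" by (simp add: z_def DeMoivre mult.commute)
    then have "cos (2 * pi * real j / real n) = 1" by (metis cis.sel(1) one_complex.sel(1))
    then obtain k :: int where "2 * pi * real j / real n = real_of_int k * 2 * pi"
      using cos_one_2pi_int by auto
    then have "real j = real_of_int k * real n" using n(1) by (simp add: field_simps)
    then have "int j = k * int n" by (metis of_int_eq_iff of_int_mult of_int_of_nat_eq)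
    then have "int n dvd int j" by simp
    then show False using that by (auto dest: dvd_imp_le)
  qed
  define y where "y k = (\<Sum>j<n. z ^ (k * j) *\<^sub>C ?x j)" for k
  have yW: "y k \<in> W" for k unfolding y_def
    by (intro cvec.subspace_sum[OF W] cvec.subspace_scale[OF W] it)
  have z0: "z \<noteq> 0" by (simp add: z_def)
  have Ty: "T (y k) = inverse (z ^ k) *\<^sub>C y k" for k
  proof -
    have "z ^ k *\<^sub>C T (y k) = (\<Sum>j<n. z ^ (k * Suc j) *\<^sub>C ?x (Suc j))"
      unfolding y_def
      by (subst linear_on_sum[OF T W])
        (auto simp: linear_on_scale[OF T] it cvec.subspace_scale[OF W] cvec.scale_sum_right power_add)
    also have "\<dots> = (\<Sum>j<Suc n. z ^ (k * j) *\<^sub>C ?x j) - z ^ (k * 0) *\<^sub>C ?x 0"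
      by (simp only: sum.lessThan_Suc_shift) simp
    also have "\<dots> = y k + (z ^ (k * n) *\<^sub>C ?x n - ?x 0)"
      unfolding y_def by simp
    also have "\<dots> = y k"
      using n(2) zn by (simp add: power_mult mult.commute[of k])
    finally have "inverse (z ^ k) *\<^sub>C (z ^ k *\<^sub>C T (y k)) = inverse (z ^ k) *\<^sub>C y k" by simp
    then show ?thesis using z0 by (simp add: scaleC_scaleC)
  qed
  have "(\<Sum>k<n. y k) = (\<Sum>j<n. (\<Sum>k<n. (z ^ j) ^ k) *\<^sub>C ?x j)"
    unfolding y_def cvec.scale_sum_left
    by (subst sum.swap) (simp add: power_mult[symmetric] mult.commute)
  also have "\<dots> = (\<Sum>j<n. if j = 0 then of_nat n *\<^sub>C ?x j else 0)"
  proof (intro sum.cong refl)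
    fix j assume j: "j \<in> {..<n}"
    have "(z ^ j) ^ n = 1" using zn by (metis mult.commute power_mult power_one)
    then show "(\<Sum>k<n. (z ^ j) ^ k) *\<^sub>C ?x j = (if j = 0 then of_nat n *\<^sub>C ?x j else 0)"
      using sum_powers_root_of_unity[of "z ^ j" n] zj[of j] j by auto
  qed
  also have "\<dots> = of_nat n *\<^sub>C v" using n(1) by (simp add: sum.delta)
  finally have "v = (\<Sum>k<n. inverse (of_nat n) *\<^sub>C y k)"
    unfolding cvec.scale_sum_right[symmetric] using n(1) by (simp add: scaleC_scaleC scaleC_one)
  also have "\<dots> \<in> cvec.span {w \<in> W. \<exists>c. T w = c *\<^sub>C w}"
    by (intro cvec.span_sum cvec.span_scale cvec.span_base) (use yW Ty in blast)
  finally show ?thesis .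
qed

section \<open>Characters of finite abelian groups\<close>

lemma (in group) sum_nontrivial_character:
  fixes f :: "'a \<Rightarrow> complex"
  assumes mult: "\<And>x y. x \<in> carrier G \<Longrightarrow> y \<in> carrier G \<Longrightarrow> f (x \<otimes> y) = f x * f y"
    and y: "y \<in> carrier G" "f y \<noteq> 1"
  shows "(\<Sum>x\<in>carrier G. f x) = 0"
proof -
  have "(\<Sum>x\<in>carrier G. f x) = (\<Sum>x\<in>carrier G. f (y \<otimes> x))"
    by (rule sum.reindex_bij_witness[of _ "\<lambda>x. y \<otimes> x" "\<lambda>x. inv y \<otimes> x"])
      (auto simp: y m_assoc[symmetric])
  also have "\<dots> = f y * (\<Sum>x\<in>carrier G. f x)"
    by (simp add: mult y sum_distrib_left)
  finally show ?thesis using y(2) by simp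
qed

lemma char_group_carrier:
  "d \<in> carrier (char_group G D) \<longleftrightarrow>
    (\<forall>b\<in>D. d b \<noteq> 0) \<and> (\<forall>a\<in>D. \<forall>b\<in>D. d (a \<otimes>\<^bsub>G\<^esub> b) = d a * d b) \<and> d \<in> extensional D"
  by (auto simp: char_group_def hom_def complex_units_def)

lemma char_group_mult: "d \<otimes>\<^bsub>char_group G D\<^esub> e = (\<lambda>b\<in>D. d b * e b)"
  by (simp add: char_group_def)

lemma char_group_one: "\<one>\<^bsub>char_group G D\<^esub> = (\<lambda>b\<in>D. 1)"
  by (simp add: char_group_def)

lemma comm_group_char_group:
  assumes "group (G\<lparr>carrier := D\<rparr>)"
  shows "comm_group (char_group G D)"
proof -
  interpret K: group "G\<lparr>carrier := D\<rparr>" by fact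
  have cl: "a \<otimes>\<^bsub>G\<^esub> b \<in> D" if "a \<in> D" "b \<in> D" for a b
    using K.m_closed that by simp
  show ?thesis
  proof (rule comm_groupI)
    fix d assume d: "d \<in> carrier (char_group G D)"
    have "(\<lambda>b\<in>D. inverse (d b)) \<in> carrier (char_group G D)"
      using d by (auto simp: char_group_carrier cl)
    moreover have "(\<lambda>b\<in>D. inverse (d b)) \<otimes>\<^bsub>char_group G D\<^esub> d = \<one>\<^bsub>char_group G D\<^esub>"
      using d by (auto simp: char_group_mult char_group_one char_group_carrier fun_eq_iff)
    ultimately show "\<exists>e\<in>carrier (char_group G D). e \<otimes>\<^bsub>char_group G D\<^esub> d = \<one>\<^bsub>char_group G D\<^esub>"
      by blast
    show "\<one>\<^bsub>char_group G D\<^esub> \<otimes>\<^bsub>char_group G D\<^esub> d = d"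
      using d by (auto simp: char_group_mult char_group_one char_group_carrier fun_eq_iff
          extensional_def)
  qed (auto simp: char_group_mult char_group_one char_group_carrier fun_eq_iff cl)
qed

lemma char_power:
  assumes G: "group (G\<lparr>carrier := D\<rparr>)" and d: "d \<in> carrier (char_group G D)" and b: "b \<in> D"
  shows "d (b [^]\<^bsub>G\<lparr>carrier := D\<rparr>\<^esub> (n::nat)) = d b ^ n" and "d \<one>\<^bsub>G\<^esub> = 1"
proof -
  interpret K: group "G\<lparr>carrier := D\<rparr>" by fact
  have one: "\<one>\<^bsub>G\<^esub> \<in> D" and oo: "\<one>\<^bsub>G\<^esub> \<otimes>\<^bsub>G\<^esub> \<one>\<^bsub>G\<^esub> = \<one>\<^bsub>G\<^esub>"
    using K.one_closed K.l_one[of "\<one>\<^bsub>G\<^esub>"] by simp_all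
  have "d \<one>\<^bsub>G\<^esub> * d \<one>\<^bsub>G\<^esub> = d \<one>\<^bsub>G\<^esub>" "d \<one>\<^bsub>G\<^esub> \<noteq> 0"
    using d one oo unfolding char_group_carrier by metis+
  then show d1: "d \<one>\<^bsub>G\<^esub> = 1" by simp
  show "d (b [^]\<^bsub>G\<lparr>carrier := D\<rparr>\<^esub> n) = d b ^ n"
  proof (induction n)
    case (Suc n)
    have "b [^]\<^bsub>G\<lparr>carrier := D\<rparr>\<^esub> n \<in> D" using K.nat_pow_closed b by simp
    with Suc show ?case using d b by (simp add: char_group_carrier)
  qed (simp add: d1)
qed

lemma finite_char_group:
  assumes G: "group (G\<lparr>carrier := D\<rparr>)" and fin: "finite D"
  shows "finite (carrier (char_group G D))"
proof -
  interpret K: group "G\<lparr>carrier := D\<rparr>" by fact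
  have D0: "0 < card D" using K.one_closed fin by (auto simp: card_gt_0_iff)
  have "d b ^ card D = 1" if "d \<in> carrier (char_group G D)" "b \<in> D" for d b
    using K.pow_order_eq_1[of b] char_power(1)[OF G that, of "card D"] char_power(2)[OF G that] that(2)
    by (simp add: Coset.order_def)
  then have "carrier (char_group G D) \<subseteq> (\<Pi>\<^sub>E b\<in>D. {z. z ^ card D = 1})"
    by (auto simp: PiE_def char_group_carrier)
  moreover have "finite (\<Pi>\<^sub>E b\<in>D. {z::complex. z ^ card D = 1})"
    using finite_roots_unity[of "card D"] D0 by (intro finite_PiE fin) (auto simp: Suc_le_eq)
  ultimately show ?thesis by (rule finite_subset)
qed

text \<open>
Pontryagin duality for finite abelian groups, by orthogonality alone.  If \<open>l\<close> differs from every
evaluation, then \<open>l\<close> is orthogonal to all evaluations on the dual group.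
\<close>

lemma double_dual_evaluation:
  assumes G: "group (G\<lparr>carrier := D\<rparr>)" and fin: "finite D"
    and nz: "l \<one>\<^bsub>char_group G D\<^esub> \<noteq> (0::complex)"
    and mult: "\<And>d e. d \<in> carrier (char_group G D) \<Longrightarrow> e \<in> carrier (char_group G D) \<Longrightarrow>
      l (d \<otimes>\<^bsub>char_group G D\<^esub> e) = l d * l e"
  shows "\<exists>b\<in>D. \<forall>d\<in>carrier (char_group G D). l d = d b"
proof (rule ccontr)
  assume neg: "\<not> ?thesis"
  let ?C = "char_group G D"
  interpret K: group "G\<lparr>carrier := D\<rparr>" by fact
  interpret C: comm_group ?C by (rule comm_group_char_group[OF G])
  have one: "\<one>\<^bsub>G\<^esub> \<in> D" using K.one_closed by simp
  have finC: "finite (carrier ?C)" by (rule finite_char_group[OF G fin])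
  have C: "d b \<noteq> 0" "d \<in> extensional D" if "d \<in> carrier ?C" "b \<in> D" for d b
    using that by (auto simp: char_group_carrier)
  have dual0: "(\<Sum>d\<in>carrier ?C. l d * inverse (d b)) = 0" if b: "b \<in> D" for b
  proof -
    obtain e where e: "e \<in> carrier ?C" "l e \<noteq> e b" using neg b by blast
    show ?thesis
    proof (rule C.sum_nontrivial_character)
      show "e \<in> carrier ?C" by fact
      show "l e * inverse (e b) \<noteq> 1"
        using e C(1)[OF e(1) b] by (simp add: divide_inverse[symmetric])
      show "l (d \<otimes>\<^bsub>?C\<^esub> d') * inverse ((d \<otimes>\<^bsub>?C\<^esub> d') b) = l d * inverse (d b) * (l d' * inverse (d' b))"
        if "d \<in> carrier ?C" "d' \<in> carrier ?C" for d d'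
        using mult[OF that] b by (simp add: char_group_mult)
    qed
  qed
  \<comment> \<open>Summing these relations over \<open>b\<close> leaves only the term of the trivial character.\<close>
  have "0 = (\<Sum>b\<in>D. \<Sum>d\<in>carrier ?C. l d * inverse (d b))"
    by (simp add: dual0)
  also have "\<dots> = (\<Sum>d\<in>carrier ?C. l d * (\<Sum>b\<in>D. inverse (d b)))"
    by (subst sum.swap) (simp add: sum_distrib_left)
  also have "\<dots> = (\<Sum>d\<in>carrier ?C. if d = \<one>\<^bsub>?C\<^esub> then l d * of_nat (card D) else 0)"
  proof (intro sum.cong refl)
    fix d assume d: "d \<in> carrier ?C"
    show "l d * (\<Sum>b\<in>D. inverse (d b)) = (if d = \<one>\<^bsub>?C\<^esub> then l d * of_nat (card D) else 0)"
    proof (cases "\<forall>b\<in>D. d b = 1")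
      case True
      then have "d = \<one>\<^bsub>?C\<^esub>"
        using C(2)[OF d one] by (auto simp: char_group_one fun_eq_iff extensional_def)
      then show ?thesis using True by simp
    next
      case False
      then obtain b where b: "b \<in> D" "d b \<noteq> 1" by blast
      have "(\<Sum>b\<in>D. inverse (d b)) = 0"
        using K.sum_nontrivial_character[of "\<lambda>b. inverse (d b)" b] b d
        by (simp add: char_group_carrier inverse_eq_1_iff)
      moreover have "d \<noteq> \<one>\<^bsub>?C\<^esub>" using b by (auto simp: char_group_one)
      ultimately show ?thesis by simp
    qed
  qed
  also have "\<dots> = l \<one>\<^bsub>?C\<^esub> * of_nat (card D)"
    using finC by (simp add: sum.delta)
  finally show False using nz fin one by auto
qed

section \<open>Symmetric cocycles\<close>

lemma sum_fun_apply: "(\<Sum>i\<in>I. F i) y = (\<Sum>i\<in>I. F i y)"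
  by (induction I rule: infinite_finite_induct) auto

text \<open>
The operators \<open>(T\<^sub>a f)(x) = c(a,x) f(a x)\<close> on functions on the group satisfy
\<open>T\<^sub>a T\<^sub>b = c(a,b) T\<^sub>a\<^sub>b\<close> by the cocycle identity, and they commute because \<open>c\<close> is symmetric.
Their eigenvalues on a simultaneous eigenvector form the required function \<open>t\<close>.
\<close>

lemma (in comm_group) symmetric_cocycle_is_coboundary:
  fixes c :: "'a \<Rightarrow> 'a \<Rightarrow> complex"
  assumes fin: "finite (carrier G)"
    and nz: "\<And>x y. x \<in> carrier G \<Longrightarrow> y \<in> carrier G \<Longrightarrow> c x y \<noteq> 0"
    and sym: "\<And>x y. x \<in> carrier G \<Longrightarrow> y \<in> carrier G \<Longrightarrow> c x y = c y x"
    and cocycle: "\<And>x y z. x \<in> carrier G \<Longrightarrow> y \<in> carrier G \<Longrightarrow> z \<in> carrier G \<Longrightarrow>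
      c x y * c (x \<otimes> y) z = c y z * c x (y \<otimes> z)"
  shows "\<exists>t. \<forall>x\<in>carrier G. t x \<noteq> 0 \<and> (\<forall>y\<in>carrier G. t x * t y = c x y * t (x \<otimes> y))"
proof -
  \<comment> \<open>Functions with support in the group, so that \<open>F\<close> is finite-dimensional.\<close>
  define F where "F = {f :: 'a \<Rightarrow> complex. \<forall>x. x \<notin> carrier G \<longrightarrow> f x = 0}"
  define T where "T a f = (\<lambda>x. if x \<in> carrier G then c a x * f (a \<otimes> x) else 0)"
    for a and f :: "'a \<Rightarrow> complex"
  have TF: "T a f \<in> F" for a f by (simp add: T_def F_def)
  have T_add: "T a (f + g) = T a f + T a g" for a f g
    by (auto simp: T_def fun_eq_iff algebra_simps)
  have T_scale: "T a (r *\<^sub>C f) = r *\<^sub>C T a f" for a r f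
    by (auto simp: T_def fun_eq_iff scaleC_fun_def scaleC_complex_def)
  have T_0: "T a 0 = 0" for a by (auto simp: T_def fun_eq_iff)
  have TT: "T a (T b f) = c a b *\<^sub>C T (a \<otimes> b) f" if a: "a \<in> carrier G" and b: "b \<in> carrier G" for a b f
  proof
    fix x
    show "T a (T b f) x = (c a b *\<^sub>C T (a \<otimes> b) f) x"
    proof (cases "x \<in> carrier G")
      case True
      have "T a (T b f) x = c a x * c b (a \<otimes> x) * f (b \<otimes> (a \<otimes> x))"
        using a True by (simp add: T_def)
      also have "c a x * c b (a \<otimes> x) = c a b * c (a \<otimes> b) x"
        using cocycle[OF b a True] sym[OF a b] m_comm[OF a b] by simp
      also have "b \<otimes> (a \<otimes> x) = (a \<otimes> b) \<otimes> x"
        using a b True by (simp add: m_comm[OF a b] m_assoc)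
      finally show ?thesis using True by (simp add: T_def scaleC_fun_def scaleC_complex_def)
    qed (simp add: T_def scaleC_fun_def)
  qed
  have TT_comm: "T a (T b f) = T b (T a f)" if "a \<in> carrier G" "b \<in> carrier G" for a b f
    using TT that sym m_comm by simp
  have Ffd: "fin_dim F"
  proof -
    define e where "e x = (\<lambda>y. if y = x then 1 else 0 :: complex)" for x :: 'a
    have "f \<in> cvec.span (e ` carrier G)" if "f \<in> F" for f
    proof -
      have "f = (\<Sum>x\<in>carrier G. f x *\<^sub>C e x)"
      proof
        fix y
        have "(\<Sum>x\<in>carrier G. f x *\<^sub>C e x) y = (\<Sum>x\<in>carrier G. (f x *\<^sub>C e x) y)"
          by (rule sum_fun_apply)
        also have "\<dots> = (\<Sum>x\<in>carrier G. if y = x then f x else 0)"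
          by (intro sum.cong) (auto simp: e_def scaleC_fun_def scaleC_complex_def)
        also have "\<dots> = f y" using fin that by (auto simp: F_def sum.delta)
        finally show "f y = (\<Sum>x\<in>carrier G. f x *\<^sub>C e x) y" by simp
      qed
      also have "\<dots> \<in> cvec.span (e ` carrier G)"
        by (intro cvec.span_sum cvec.span_scale cvec.span_base) auto
      finally show ?thesis .
    qed
    then show ?thesis using fin unfolding fin_dim_def by (intro exI[of _ "e ` carrier G"]) auto
  qed
  have "\<exists>f\<in>F. f \<noteq> 0 \<and> (\<exists>t. \<forall>a\<in>S. T a f = t a *\<^sub>C f)" if "finite S" "S \<subseteq> carrier G" for S
    using that
  proof (induction S)
    case empty
    have "(\<lambda>x. if x = \<one> then 1 else 0) \<in> F" by (auto simp: F_def)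
    moreover have "(\<lambda>x. if x = \<one> then 1 else 0) \<noteq> (0 :: 'a \<Rightarrow> complex)"
      by (auto simp: fun_eq_iff)
    ultimately show ?case by blast
  next
    case (insert a S)
    then obtain f t where f: "f \<in> F" "f \<noteq> 0" "\<forall>b\<in>S. T b f = t b *\<^sub>C f" by blast
    define W where "W = {g \<in> F. \<forall>b\<in>S. T b g = t b *\<^sub>C g}"
    have F: "cvec.subspace F"
      by (rule cvec.subspaceI) (auto simp: F_def scaleC_fun_def)
    have W: "cvec.subspace W"
      by (rule cvec.subspaceI)
        (auto simp: W_def cvec.subspace_0[OF F] cvec.subspace_add[OF F] cvec.subspace_scale[OF F]
          T_0 T_add T_scale cvec.scale_right_distrib scaleC_scaleC mult.commute)
    have "linear_on W W (T a)"
      using insert.prems by (auto intro!: linear_onI simp: W_def TF T_add T_scale TT_comm[of _ a])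
    moreover have "fin_dim W" by (rule fin_dim_subset[OF Ffd]) (auto simp: W_def)
    ultimately obtain g r where g: "g \<in> W" "g \<noteq> 0" "T a g = r *\<^sub>C g"
      using eigenvector_exists[OF W, of "T a" f] f by (auto simp: W_def)
    show ?case
      using g insert.hyps by (intro bexI[of _ g] conjI exI[of _ "t(a := r)"]) (auto simp: W_def)
  qed
  from this[OF fin order.refl] obtain f t where fF: "f \<in> F" and f: "f \<noteq> 0" "\<And>a. a \<in> carrier G \<Longrightarrow> T
      a f = t a *\<^sub>C f"
    by blast
  have t: "t a * t b = c a b * t (a \<otimes> b)" if "a \<in> carrier G" "b \<in> carrier G" for a b
  proof -
    have "(t a * t b) *\<^sub>C f = T a (T b f)"
      using that by (simp add: f T_scale scaleC_scaleC mult.commute)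
    also have "\<dots> = (c a b * t (a \<otimes> b)) *\<^sub>C f"
      by (simp only: TT[OF that] f(2)[OF m_closed[OF that]] scaleC_scaleC)
    finally show ?thesis using f(1) by simp
  qed
  \<comment> \<open>A zero of \<open>t\<close> forces \<open>t \<one> = 0\<close> and hence \<open>T \<one> f = 0\<close>, but \<open>T \<one>\<close> multiplies \<open>f\<close> pointwise
    by the nonzero numbers \<open>c \<one> x\<close>.\<close>
  have nz_t: "t a \<noteq> 0" if a: "a \<in> carrier G" for a
  proof
    assume "t a = 0"
    then have "c a (inv a) * t \<one> = 0" using t[OF a inv_closed[OF a]] a by simp
    then have t1: "t \<one> = 0" using nz[OF a inv_closed[OF a]] by simp
    have "t x = 0" if "x \<in> carrier G" for x
      using t[OF one_closed that] t1 nz[OF one_closed that] that by simp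
    then have Tx: "T x f = 0" if "x \<in> carrier G" for x using f(2)[OF that] that by simp
    have "f x = 0" if x: "x \<in> carrier G" for x
      using fun_cong[OF Tx[OF one_closed], of x] nz[OF one_closed x] x by (simp add: T_def)
    then have "f = 0" using fF by (auto simp: F_def fun_eq_iff)
    then show False using f(1) by simp
  qed
  show ?thesis using t nz_t by blast
qed

section \<open>Consequences of the Jacobi identity\<close>

lemma int_downward_induct:
  fixes m N :: int
  assumes base: "\<And>m. m \<ge> N \<Longrightarrow> P m" and step: "\<And>m. (\<And>k. k > m \<Longrightarrow> P k) \<Longrightarrow> P m"
  shows "P m"
proof (induction "nat (N - m)" arbitrary: m rule: less_induct)
  case less
  show ?case
  proof (cases "m \<ge> N")
    case False
    show ?thesis
    proof (rule step)
      show "P k" if "k > m" for k by (rule less) (use that False in auto)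
    qed
  qed (rule base)
qed

lemma Sum_any_only_0:
  fixes f :: "nat \<Rightarrow> 'v::comm_monoid_add"
  assumes "\<And>i. i > 0 \<Longrightarrow> f i = 0"
  shows "Sum_any f = f 0"
proof -
  have "Sum_any f = sum f {0}"
    using assms by (intro Sum_any.expand_superset) (auto intro: ccontr)
  then show ?thesis by simp
qed

lemma Sum_any_in_subspace:
  assumes "cvec.subspace W" "\<And>i. f i \<in> W"
  shows "Sum_any f \<in> W"
  unfolding Sum_any.expand_set by (intro cvec.subspace_sum assms)

lemma finite_support_nat:
  assumes "\<And>i. i \<ge> N \<Longrightarrow> f i = (0::'v::zero)"
  shows "finite {i::nat. f i \<noteq> 0}"
  by (rule finite_subset[of _ "{..<N}"]) (use assms not_less in auto)

lemma first_term_in_subspace: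
  assumes W: "cvec.subspace W" and fin: "finite {i::nat. f i \<noteq> 0}"
    and f: "\<And>i. i > 0 \<Longrightarrow> f i \<in> W" and s: "Sum_any f \<in> W"
  shows "f 0 \<in> W"
proof -
  have "Sum_any f = sum f (insert 0 {i. f i \<noteq> 0})"
    using fin by (intro Sum_any.expand_superset) auto
  also have "\<dots> = f 0 + sum f ({i. f i \<noteq> 0} - {0})"
    using fin by (rule sum.insert_remove)
  finally have "f 0 = Sum_any f - sum f ({i. f i \<noteq> 0} - {0})" by simp
  also have "\<dots> \<in> W"
    by (intro cvec.subspace_diff[OF W s] cvec.subspace_sum[OF W] f) auto
  finally show ?thesis .
qed

context VOA
begin

lemma
  assumes "u \<in> vspace V" "v \<in> vspace V"
  shows op_in: "vop V u n v \<in> vspace V"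
    and op_add_right: "w \<in> vspace V \<Longrightarrow> vop V u n (v + w) = vop V u n v + vop V u n w"
    and op_scale_right: "vop V u n (c *\<^sub>C v) = c *\<^sub>C vop V u n v"
    and op_add_left: "w \<in> vspace V \<Longrightarrow> vop V (u + w) n v = vop V u n v + vop V w n v"
    and op_scale_left: "vop V (c *\<^sub>C u) n v = c *\<^sub>C vop V u n v"
  using bilinear[of n] assms unfolding bilinear_on_def linear_on_def by blast+

lemma linear_op_right: "u \<in> vspace V \<Longrightarrow> linear_on (vspace V) (vspace V) (vop V u n)"
  using bilinear[of n] unfolding bilinear_on_def by blast

lemma linear_op_left: "v \<in> vspace V \<Longrightarrow> linear_on (vspace V) (vspace V) (\<lambda>u. vop V u n v)"
  using bilinear[of n] unfolding bilinear_on_def by blast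

lemma op_zero_right: "u \<in> vspace V \<Longrightarrow> vop V u n 0 = 0"
  by (rule linear_on_zero[OF linear_op_right subspace])

lemma op_zero_left: "v \<in> vspace V \<Longrightarrow> vop V 0 n v = 0"
  by (rule linear_on_zero[OF linear_op_left subspace])

lemma truncation_nat:
  assumes "u \<in> vspace V" "v \<in> vspace V"
  obtains N where "\<And>i. i \<ge> N \<Longrightarrow> vop V u (m + int i) v = 0"
proof -
  obtain N where N: "\<forall>n\<ge>N. vop V u n v = 0" using truncation[OF assms] by blast
  show thesis by (rule that[of "nat (N - m)"]) (use N in auto)
qed

text \<open>
Locality: for large \<open>l\<close> the right-hand side of the Jacobi identity vanishes, so \<open>v\<^sub>n u\<^sub>m w\<close> is a
combination of terms \<open>v\<^sub>k u\<^sub>m\<^sub>+\<^sub>i w\<close> with \<open>i > 0\<close>.  Truncation starts the induction on \<open>m\<close> from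
above.
\<close>

lemma annihilator_closed:
  assumes u: "u \<in> vspace V" and v: "v \<in> vspace V" and w: "w \<in> vspace V"
    and zero: "\<And>n. vop V v n w = 0"
  shows "vop V v n (vop V u m w) = 0"
proof -
  obtain L where L: "\<forall>n\<ge>L. vop V u n v = 0" using truncation[OF u v] by blast
  obtain N where N: "\<forall>n\<ge>N. vop V u n w = 0" using truncation[OF u w] by blast
  have "\<forall>n. vop V v n (vop V u m w) = 0"
  proof (rule int_downward_induct[of N])
    fix m assume "m \<ge> N"
    then show "\<forall>n. vop V v n (vop V u m w) = 0" using N v by (simp add: op_zero_right)
  next
    fix m assume IH: "\<And>k. k > m \<Longrightarrow> \<forall>n. vop V v n (vop V u k w) = 0"
    show "\<forall>n. vop V v n (vop V u m w) = 0"
    proof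
      fix n
      let ?f = "\<lambda>i::nat. ((- 1) ^ i * (of_int L gchoose i)) *\<^sub>C
          (vop V u (m + L - int i) (vop V v (n - L + of_nat i) w)
           - ((- 1) powi L) *\<^sub>C vop V v (n - L + of_int L - of_nat i) (vop V u (m + int i) w))"
      have "Sum_any ?f = Sum_any (\<lambda>i::nat. (of_int m gchoose i) *\<^sub>C
          vop V (vop V u (L + int i) v) (of_int m + (n - L) - of_nat i) w)"
        by (rule jacobi[OF u v w, unfolded jacobi_def, rule_format])
      also have "\<dots> = Sum_any (\<lambda>i::nat. 0)"
        using L w by (intro Sum_any.cong) (simp add: op_zero_left)
      finally have "Sum_any ?f = 0" by simp
      moreover have "Sum_any ?f = ?f 0"
      proof (rule Sum_any_only_0)
        fix i :: nat assume "i > 0"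
        then have "vop V v k (vop V u (m + int i) w) = 0" for k using IH[of "m + int i"] by simp
        then show "?f i = 0" using op_zero_right[OF u] by (simp only: zero) simp
      qed
      ultimately have "?f 0 = 0" by (rule trans[OF sym, rotated])
      then show "vop V v n (vop V u m w) = 0"
        using op_zero_right[OF u] by (simp add: zero)
    qed
  qed
  then show ?thesis by blast
qed

text \<open>
The submodule generated by \<open>w\<close>: iterated modes give nothing new by \<open>op_op_in_generated\<close>.
\<close>

definition generated :: "'a \<Rightarrow> 'a set" where
  "generated w = cvec.span {vop V u n w |u n. u \<in> vspace V}"

text \<open>
Associativity: when \<open>m\<close> is so large that \<open>u\<^sub>m\<^sub>+\<^sub>i w = 0\<close>, the Jacobi identity expresses
\<open>u\<^sub>p v\<^sub>q w\<close>, up to terms \<open>u\<^sub>k v\<^sub>q\<^sub>+\<^sub>i w\<close> with \<open>i > 0\<close>, by single modes applied to \<open>w\<close>.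
Truncation starts the induction on \<open>q\<close> from above.
\<close>

lemma op_op_in_generated:
  assumes u: "u \<in> vspace V" and v: "v \<in> vspace V" and w: "w \<in> vspace V"
  shows "vop V u p (vop V v q w) \<in> generated w"
proof -
  have W: "cvec.subspace (generated w)" by (simp add: generated_def)
  have gen: "vop V x n w \<in> generated w" if "x \<in> vspace V" for x n
    unfolding generated_def by (rule cvec.span_base) (use that in blast)
  obtain M where M: "\<forall>n\<ge>M. vop V u n w = 0" using truncation[OF u w] by blast
  obtain N where N: "\<forall>n\<ge>N. vop V v n w = 0" using truncation[OF v w] by blast
  have "\<forall>p. vop V u p (vop V v q w) \<in> generated w"
  proof (rule int_downward_induct[of N])
    fix q assume "q \<ge> N"
    then show "\<forall>p. vop V u p (vop V v q w) \<in> generated w"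
      using N u by (simp add: op_zero_right cvec.subspace_0[OF W])
  next
    fix q assume IH: "\<And>k. k > q \<Longrightarrow> \<forall>p. vop V u p (vop V v k w) \<in> generated w"
    show "\<forall>p. vop V u p (vop V v q w) \<in> generated w"
    proof
      fix p
      \<comment> \<open>With this \<open>l\<close>, the term at \<open>i = 0\<close> of the left-hand side is \<open>u\<^sub>p v\<^sub>q w\<close>.\<close>
      define l where "l = p - M"
      let ?f = "\<lambda>i::nat. ((- 1) ^ i * (of_int l gchoose i)) *\<^sub>C
          (vop V u (M + l - int i) (vop V v (q + of_nat i) w)
           - ((- 1) powi l) *\<^sub>C vop V v (q + of_int l - of_nat i) (vop V u (M + int i) w))"
      have f: "?f i = ((- 1) ^ i * (of_int l gchoose i)) *\<^sub>C (vop V u (M + l - int i) (vop V v (q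
          + int i) w))" for i
        using M v by (simp add: op_zero_right)
      have "Sum_any ?f = Sum_any (\<lambda>i::nat. (of_int M gchoose i) *\<^sub>C
          vop V (vop V u (l + int i) v) (of_int M + q - of_nat i) w)"
        by (rule jacobi[OF u v w, unfolded jacobi_def, rule_format])
      also have "\<dots> \<in> generated w"
        by (intro Sum_any_in_subspace[OF W] cvec.subspace_scale[OF W] gen op_in u v)
      finally have "Sum_any ?f \<in> generated w" .
      then have "?f 0 \<in> generated w"
      proof (rule first_term_in_subspace[OF W, rotated 2])
        obtain N' where "\<And>i. i \<ge> N' \<Longrightarrow> vop V v (q + int i) w = 0"
          using truncation_nat[OF v w] by blast
        then show "finite {i. ?f i \<noteq> 0}"
          unfolding f by (intro finite_support_nat[of N']) (simp add: op_zero_right u)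
        show "?f i \<in> generated w" if "i > 0" for i
          unfolding f using IH[of "q + int i"] that by (intro cvec.subspace_scale[OF W]) auto
      qed
      then show "vop V u p (vop V v q w) \<in> generated w" unfolding f by (simp add: l_def)
    qed
  qed
  then show ?thesis by blast
qed

lemma submodule_generated:
  assumes w: "w \<in> vspace V"
  shows "submodule_of V (adjoint V) (generated w)"
proof -
  have sub: "generated w \<subseteq> vspace V"
    unfolding generated_def using op_in[OF _ w] by (intro cvec.span_minimal subspace) blast
  moreover have "vop V v n x \<in> generated w" if v: "v \<in> vspace V" and x: "x \<in> generated w" for v n x
  proof -
    have "vop V v n x \<in> cvec.span (vop V v n ` {vop V u n w |u n. u \<in> vspace V})"
      using x unfolding generated_def
      using op_in[OF _ w] by (intro linear_on_span[OF linear_op_right[OF v] subspace]) blast+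
    also have "\<dots> \<subseteq> generated w"
    proof (rule cvec.span_minimal)
      show "vop V v n ` {vop V u n w |u n. u \<in> vspace V} \<subseteq> generated w"
        using op_op_in_generated[OF v _ w] by blast
    qed (simp add: generated_def)
    finally show ?thesis .
  qed
  moreover have "cvec.subspace (generated w)" by (simp add: generated_def)
  ultimately show ?thesis
    unfolding submodule_of_def adjoint_def by simp
qed

lemma submodule_annihilator:
  assumes v: "v \<in> vspace V"
  shows "submodule_of V (adjoint V) {w \<in> vspace V. \<forall>n. vop V v n w = 0}"
proof -
  have "cvec.subspace {w \<in> vspace V. \<forall>n. vop V v n w = 0}"
    by (rule cvec.subspaceI)
      (simp_all add: cvec.subspace_0[OF subspace] cvec.subspace_add[OF subspace]
        cvec.subspace_scale[OF subspace] op_zero_right op_add_right op_scale_right v)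
  moreover have "vop V u n w \<in> {w \<in> vspace V. \<forall>n. vop V v n w = 0}"
    if "u \<in> vspace V" "w \<in> {w \<in> vspace V. \<forall>n. vop V v n w = 0}" for u n w
    using that op_in[OF that(1), of w n] annihilator_closed[OF that(1) v, of w] by simp
  ultimately show ?thesis
    unfolding submodule_of_def adjoint_def by simp
qed

end

locale simple_vertex_algebra = VOA +
  assumes simple: "simple_VOA V"
begin

lemma adjoint_module: "VOA_module V (adjoint V)"
  using simple by (simp add: simple_VOA_def irreducible_module_def)

lemma submodule_trivial:
  "submodule_of V (adjoint V) N \<Longrightarrow> N = {0} \<or> N = vspace V"
  using simple by (auto simp: simple_VOA_def irreducible_module_def adjoint_def)

lemma nontrivial: "vspace V \<noteq> {0}"
  using simple by (auto simp: simple_VOA_def irreducible_module_def adjoint_def)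

lemma vac_nonzero: "vac V \<noteq> 0"
proof
  assume "vac V = 0"
  have "vspace V \<subseteq> {0}"
  proof
    fix v assume v: "v \<in> vspace V"
    have "v = vop V v (- 1) (vac V)" by (rule creation(1)[OF v, symmetric])
    also have "\<dots> = 0" unfolding \<open>vac V = 0\<close> by (rule op_zero_right[OF v])
    finally show "v \<in> {0}" by simp
  qed
  then have "vspace V = {0}"
    by (rule subset_antisym) (simp add: cvec.subspace_0[OF subspace])
  then show False using nontrivial by contradiction
qed

lemma generated_eq:
  assumes "w \<in> vspace V" "w \<noteq> 0"
  shows "generated w = vspace V"
proof -
  have "vop V (vac V) (- 1) w \<in> generated w"
    unfolding generated_def by (rule cvec.span_base) (use vac_in in blast)
  then have "w \<in> generated w" using vacuum[OF assms(1)] by simp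
  then show ?thesis using submodule_trivial[OF submodule_generated[OF assms(1)]] assms(2) by blast
qed

text \<open>
The annihilator of \<open>v\<close> is a submodule that misses the vacuum, because \<open>v\<^sub>-\<^sub>1 1 = v\<close>.
\<close>

lemma op_nonvanishing:
  assumes v: "v \<in> vspace V" "v \<noteq> 0" and w: "w \<in> vspace V" "w \<noteq> 0"
  shows "\<exists>n. vop V v n w \<noteq> 0"
proof (rule ccontr)
  assume "\<not> ?thesis"
  then have "w \<in> {w \<in> vspace V. \<forall>n. vop V v n w = 0}" using w(1) by simp
  then have "{w \<in> vspace V. \<forall>n. vop V v n w = 0} = vspace V"
    using submodule_trivial[OF submodule_annihilator[OF v(1)]] w(2) by blast
  then have "vac V \<in> {w \<in> vspace V. \<forall>n. vop V v n w = 0}" using vac_in by simp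
  then show False using creation(1)[OF v(1)] v(2) by simp
qed

end

section \<open>The automorphism group\<close>

lemma Aut_carrier:
  "g \<in> carrier (Aut V) \<longleftrightarrow> g \<in> extensional (vspace V) \<and> bij_betw g (vspace V) (vspace V) \<and>
    linear_on (vspace V) (vspace V) g \<and>
    (\<forall>v\<in>vspace V. \<forall>n. \<forall>w\<in>vspace V. g (vop V v n w) = vop V (g v) n (g w)) \<and>
    g (conf V) = conf V"
  by (auto simp: Aut_def Bij_def)

lemma Aut_mult:
  assumes "g \<in> carrier (Aut V)" "h \<in> carrier (Aut V)"
  shows "g \<otimes>\<^bsub>Aut V\<^esub> h = compose (vspace V) g h"
  using assms by (simp add: Aut_def BijGroup_def)

lemma Aut_one: "\<one>\<^bsub>Aut V\<^esub> = (\<lambda>x\<in>vspace V. x)"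
  by (simp add: Aut_def BijGroup_def)

lemma
  assumes "g \<in> carrier (Aut V)"
  shows Aut_linear: "linear_on (vspace V) (vspace V) g"
    and Aut_bij: "bij_betw g (vspace V) (vspace V)"
    and Aut_in: "v \<in> vspace V \<Longrightarrow> g v \<in> vspace V"
    and Aut_op: "v \<in> vspace V \<Longrightarrow> w \<in> vspace V \<Longrightarrow> g (vop V v n w) = vop V (g v) n (g w)"
    and Aut_conf: "g (conf V) = conf V"
    and Aut_ext: "g \<in> extensional (vspace V)"
  using assms unfolding Aut_carrier by (blast dest: linear_on_in)+

context VOA
begin

lemma group_Aut: "group (Aut V)"
proof (rule groupI)
  fix g h k assume g: "g \<in> carrier (Aut V)"
  let ?i = "\<lambda>x\<in>vspace V. inv_into (vspace V) g x"
  have inj: "inj_on g (vspace V)" and im: "g ` vspace V = vspace V"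
    using Aut_bij[OF g] by (auto simp: bij_betw_def)
  have iin: "inv_into (vspace V) g x \<in> vspace V" and gi: "g (inv_into (vspace V) g x) = x"
    if "x \<in> vspace V" for x
    using that im by (metis inv_into_into, metis f_inv_into_f)
  have i: "?i \<in> carrier (Aut V)"
    unfolding Aut_carrier
  proof (intro conjI ballI allI)
    show "bij_betw ?i (vspace V) (vspace V)"
      using bij_betw_inv_into[OF Aut_bij[OF g]] by (simp cong: bij_betw_cong)
    show "linear_on (vspace V) (vspace V) ?i"
      using linear_on_inv_into[OF Aut_linear[OF g] Aut_bij[OF g] subspace]
      by (auto simp: linear_on_def cvec.subspace_add[OF subspace] cvec.subspace_scale[OF subspace])
    show "?i (vop V v n w) = vop V (?i v) n (?i w)" if "v \<in> vspace V" "w \<in> vspace V" for v n w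
      using that Aut_op[OF g iin[OF that(1)] iin[OF that(2)], of n]
      by (simp add: gi op_in inv_into_f_eq[OF inj] iin)
    show "?i (conf V) = conf V"
      using inv_into_f_eq[OF inj conf_in Aut_conf[OF g]] by (simp add: conf_in)
  qed simp
  then show "\<exists>h\<in>carrier (Aut V). h \<otimes>\<^bsub>Aut V\<^esub> g = \<one>\<^bsub>Aut V\<^esub>"
    using g by (intro bexI[OF _ i]) (auto simp: Aut_mult Aut_one compose_def fun_eq_iff Aut_in inj)
  show "\<one>\<^bsub>Aut V\<^esub> \<otimes>\<^bsub>Aut V\<^esub> g = g"
  proof -
    have "g \<in> Bij (vspace V)" using g by (simp add: Aut_def)
    then show ?thesis
      by (simp add: Aut_def BijGroup_def id_Bij Bij_imp_funcset Bij_imp_extensional)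
  qed
  assume h: "h \<in> carrier (Aut V)"
  show gh: "g \<otimes>\<^bsub>Aut V\<^esub> h \<in> carrier (Aut V)"
    unfolding Aut_mult[OF g h] unfolding Aut_carrier
  proof (intro conjI ballI allI)
    show "bij_betw (compose (vspace V) g h) (vspace V) (vspace V)"
      using bij_betw_compose[OF Aut_bij[OF h] Aut_bij[OF g]] .
    show "linear_on (vspace V) (vspace V) (compose (vspace V) g h)"
      using linear_on_compose[OF Aut_linear[OF h] Aut_linear[OF g]]
      by (auto simp: linear_on_def compose_def cvec.subspace_add[OF subspace]
          cvec.subspace_scale[OF subspace])
  qed (auto simp: compose_def op_in Aut_op[OF g] Aut_op[OF h] Aut_in[OF g] Aut_in[OF h] conf_in
      Aut_conf[OF g] Aut_conf[OF h])
  assume k: "k \<in> carrier (Aut V)"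
  show "g \<otimes>\<^bsub>Aut V\<^esub> h \<otimes>\<^bsub>Aut V\<^esub> k = g \<otimes>\<^bsub>Aut V\<^esub> (h \<otimes>\<^bsub>Aut V\<^esub> k)"
  proof -
    have "g \<in> Bij (vspace V)" "h \<in> Bij (vspace V)" "k \<in> Bij (vspace V)"
      using g h k by (auto simp: Aut_def)
    then show ?thesis
      by (simp add: Aut_def BijGroup_def compose_Bij compose_assoc[symmetric] Bij_imp_funcset)
  qed
next
  show "\<one>\<^bsub>Aut V\<^esub> \<in> carrier (Aut V)"
    unfolding Aut_carrier Aut_one
    by (auto simp: linear_on_def cvec.subspace_add[OF subspace] cvec.subspace_scale[OF subspace]
        op_in conf_in bij_betw_def inj_on_def)
qed

text \<open>
The vacuum is the only vector whose mode of index \<open>-1\<close> is the identity.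
\<close>

lemma Aut_vac:
  assumes g: "g \<in> carrier (Aut V)"
  shows "g (vac V) = vac V"
proof -
  obtain w where w: "w \<in> vspace V" "g w = vac V"
    using Aut_bij[OF g] vac_in by (metis bij_betw_imp_surj_on imageE)
  have "g (vac V) = vop V (g (vac V)) (- 1) (vac V)"
    using creation(1)[OF Aut_in[OF g vac_in]] by simp
  also have "\<dots> = g (vop V (vac V) (- 1) w)"
    using Aut_op[OF g vac_in w(1)] w(2) by simp
  also have "\<dots> = vac V" using vacuum[OF w(1)] w(2) by simp
  finally show ?thesis .
qed

end

section \<open>Eigenspaces of a finite abelian group of automorphisms\<close>

locale orbifold = simple_vertex_algebra V for V :: "'a::complex_vector voa" +
  fixes D :: "('a \<Rightarrow> 'a) set"
  assumes D_subgroup: "subgroup D (Aut V)"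
    and D_comm: "comm_group (Aut V\<lparr>carrier := D\<rparr>)"
    and D_finite: "finite D"
begin

abbreviation "S \<equiv> vspace V"
abbreviation "E \<equiv> eigenspace V D"
abbreviation "U \<equiv> fixed_VOA V D"
abbreviation "Md \<equiv> eigenmodule V D"
abbreviation "Ch \<equiv> carrier (chars V D)"
abbreviation char_one ("\<one>\<^sub>D") where "\<one>\<^sub>D \<equiv> \<one>\<^bsub>chars V D\<^esub>"
abbreviation char_mult (infixl "\<cdot>" 70) where "d \<cdot> e \<equiv> d \<otimes>\<^bsub>chars V D\<^esub> e"

lemma D_group: "group (Aut V\<lparr>carrier := D\<rparr>)"
  using D_comm by (simp add: comm_group.axioms)

sublocale Ch: comm_group "chars V D"
  by (rule comm_group_char_group[OF D_group])

lemma finite_Ch: "finite Ch"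
  by (rule finite_char_group[OF D_group D_finite])

lemma D_Aut: "b \<in> D \<Longrightarrow> b \<in> carrier (Aut V)"
  using subgroup.subset[OF D_subgroup] by blast

lemma D_nonempty: "D \<noteq> {}"
  using subgroup.one_closed[OF D_subgroup] by blast

lemma D_mult_apply:
  assumes "a \<in> D" "b \<in> D" "v \<in> S"
  shows "(a \<otimes>\<^bsub>Aut V\<^esub> b) v = a (b v)"
  using assms by (simp add: Aut_mult D_Aut compose_eq)

lemma D_mult_closed: "a \<in> D \<Longrightarrow> b \<in> D \<Longrightarrow> a \<otimes>\<^bsub>Aut V\<^esub> b \<in> D"
  by (rule subgroup.m_closed[OF D_subgroup])

lemma D_commute:
  assumes "a \<in> D" "b \<in> D" "v \<in> S"
  shows "a (b v) = b (a v)"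
proof -
  interpret K: comm_group "Aut V\<lparr>carrier := D\<rparr>" by (rule D_comm)
  have "a \<otimes>\<^bsub>Aut V\<^esub> b = b \<otimes>\<^bsub>Aut V\<^esub> a" using K.m_comm[of a b] assms by simp
  then show ?thesis using D_mult_apply assms by metis
qed

lemma D_in: "b \<in> D \<Longrightarrow> v \<in> S \<Longrightarrow> b v \<in> S"
  using Aut_in D_Aut by blast

lemma D_finite_order:
  assumes b: "b \<in> D" and v: "v \<in> S"
  shows "(b ^^ card D) v = v"
proof -
  interpret K: group "Aut V\<lparr>carrier := D\<rparr>" by (rule D_group)
  have pow: "(b [^]\<^bsub>Aut V\<lparr>carrier := D\<rparr>\<^esub> n) v = (b ^^ n) v \<and> b [^]\<^bsub>Aut V\<lparr>carrier := D\<rparr>\<^esub> n \<in> D" for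
      n :: nat
  proof (induction n)
    case 0
    have "\<one>\<^bsub>Aut V\<^esub> v = v" using v by (simp add: Aut_one)
    then show ?case using subgroup.one_closed[OF D_subgroup] by simp
  next
    case (Suc n)
    have "b [^]\<^bsub>Aut V\<lparr>carrier := D\<rparr>\<^esub> Suc n = b \<otimes>\<^bsub>Aut V\<^esub> b [^]\<^bsub>Aut V\<lparr>carrier := D\<rparr>\<^esub> n"
      using K.nat_pow_Suc2[of b n] b by simp
    then show ?case
      using Suc b v D_mult_apply[of b "b [^]\<^bsub>Aut V\<lparr>carrier := D\<rparr>\<^esub> n" v]
        D_mult_closed[of b "b [^]\<^bsub>Aut V\<lparr>carrier := D\<rparr>\<^esub> n"] by simp
  qed
  have "b [^]\<^bsub>Aut V\<lparr>carrier := D\<rparr>\<^esub> card D = \<one>\<^bsub>Aut V\<^esub>"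
    using K.pow_order_eq_1[of b] b by (simp add: Coset.order_def)
  then show ?thesis using pow[of "card D"] v by (simp add: Aut_one)
qed

lemma E_iff: "v \<in> E d \<longleftrightarrow> v \<in> S \<and> (\<forall>b\<in>D. b v = d b *\<^sub>C v)"
  by (simp add: eigenspace_def)

lemma E_S: "v \<in> E d \<Longrightarrow> v \<in> S"
  by (simp add: E_iff)

lemma E_sub: "E d \<subseteq> S"
  by (auto simp: E_iff)

lemma E_eigen: "v \<in> E d \<Longrightarrow> b \<in> D \<Longrightarrow> b v = d b *\<^sub>C v"
  by (simp add: E_iff)

lemma subspace_joint_eigenspace:
  assumes "A \<subseteq> D"
  shows "cvec.subspace {w \<in> S. \<forall>b\<in>A. b w = c b *\<^sub>C w}"
proof -
  have lin: "linear_on S S b" if "b \<in> A" for b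
    using Aut_linear[OF D_Aut] assms that by blast
  show ?thesis
    by (rule cvec.subspaceI)
      (auto simp: cvec.subspace_0[OF subspace] cvec.subspace_add[OF subspace]
        cvec.subspace_scale[OF subspace] linear_on_zero[OF lin subspace]
        linear_on_add[OF lin] linear_on_scale[OF lin]
        cvec.scale_right_distrib scaleC_scaleC mult.commute)
qed

lemma subspace_E: "cvec.subspace (E d)"
  unfolding eigenspace_def by (rule subspace_joint_eigenspace) simp

lemma E_add: "v \<in> E d \<Longrightarrow> w \<in> E d \<Longrightarrow> v + w \<in> E d"
  by (rule cvec.subspace_add[OF subspace_E])

lemma E_scale: "v \<in> E d \<Longrightarrow> c *\<^sub>C v \<in> E d"
  by (rule cvec.subspace_scale[OF subspace_E])

lemma E_zero: "0 \<in> E d"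
  by (rule cvec.subspace_0[OF subspace_E])

lemma E_op:
  assumes v: "v \<in> E d" and w: "w \<in> E e"
  shows "vop V v n w \<in> E (d \<cdot> e)"
proof -
  have "b (vop V v n w) = (d \<cdot> e) b *\<^sub>C vop V v n w" if b: "b \<in> D" for b
    using Aut_op[OF D_Aut[OF b] E_S[OF v] E_S[OF w], of n] E_eigen[OF v b] E_eigen[OF w b] b
    by (simp add: char_group_mult op_scale_left op_scale_right scaleC_scaleC
        E_S[OF v] E_S[OF w] cvec.subspace_scale[OF subspace])
  then show ?thesis using v w by (simp add: E_iff op_in)
qed

lemma E_one_op: "d \<in> Ch \<Longrightarrow> u \<in> E \<one>\<^sub>D \<Longrightarrow> w \<in> E d \<Longrightarrow> vop V u n w \<in> E d"
  using E_op[of u "\<one>\<^sub>D" w d n] by simp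

lemma conf_E: "conf V \<in> E \<one>\<^sub>D" and vac_E: "vac V \<in> E \<one>\<^sub>D"
  by (auto simp: E_iff conf_in vac_in char_group_one Aut_conf[OF D_Aut] Aut_vac[OF D_Aut])

text \<open>
The elements of \<open>A\<close> are diagonalized one after the other; as the group is commutative, the next
one preserves the joint eigenspaces of the previous ones.
\<close>

lemma span_simultaneous_eigenvectors:
  assumes "finite A" "A \<subseteq> D" "v \<in> S"
  shows "v \<in> cvec.span {w \<in> S. \<forall>b\<in>A. \<exists>c. b w = c *\<^sub>C w}"
  using assms
proof (induction A)
  case empty
  then show ?case by (simp add: cvec.span_base)
next
  case (insert a A)
  then have a: "a \<in> D" by simp
  let ?X = "\<lambda>B. {w \<in> S. \<forall>b\<in>B. \<exists>c. b w = c *\<^sub>C w}"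
  have "w \<in> cvec.span (?X (insert a A))" if w: "w \<in> ?X A" for w
  proof -
    obtain c where c: "\<And>b. b \<in> A \<Longrightarrow> b w = c b *\<^sub>C w" using w by simp metis
    \<comment> \<open>The joint eigenspace of \<open>A\<close> that contains \<open>w\<close>.\<close>
    let ?W = "{x \<in> S. \<forall>b\<in>A. b x = c b *\<^sub>C x}"
    have lin: "linear_on S S b" if "b \<in> insert a A" for b
      using Aut_linear D_Aut insert.prems that by blast
    have W: "cvec.subspace ?W"
      using insert.prems by (intro subspace_joint_eigenspace) simp
    have "a x \<in> ?W" if "x \<in> ?W" for x
    proof -
      have "b (a x) = c b *\<^sub>C a x" if b: "b \<in> A" for b
        using D_commute[of b a x] b a \<open>x \<in> ?W\<close> insert.prems linear_on_scale[OF lin[of a]]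
        by (auto simp: subset_iff)
      then show ?thesis using that D_in[OF a] by simp
    qed
    then have aW: "linear_on ?W ?W a"
      by (intro linear_on_subset[OF lin[of a]]) auto
    have "w \<in> ?W" using w c by simp
    then have "w \<in> cvec.span {x \<in> ?W. \<exists>r. a x = r *\<^sub>C x}"
      using finite_order_eigen_decomposition[OF W aW, of w "card D"] D_finite_order[OF a] w
        D_nonempty D_finite by (simp add: card_gt_0_iff)
    then show ?thesis
      by (rule set_mp[OF cvec.span_mono, rotated]) auto
  qed
  then have "cvec.span (?X A) \<subseteq> cvec.span (?X (insert a A))"
    by (intro cvec.span_minimal) auto
  then show ?case using insert by auto
qed

lemma simultaneous_eigenvector_character:
  assumes v: "v \<in> S" "v \<noteq> 0" and eig: "\<forall>b\<in>D. \<exists>c. b v = c *\<^sub>C v"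
  shows "\<exists>d\<in>Ch. v \<in> E d"
proof -
  obtain c where c: "\<And>b. b \<in> D \<Longrightarrow> b v = c b *\<^sub>C v" using eig by metis
  let ?d = "restrict c D"
  have "c b \<noteq> 0" if b: "b \<in> D" for b
  proof
    assume "c b = 0"
    then have "b v = b 0"
      using c[OF b] linear_on_zero[OF Aut_linear[OF D_Aut[OF b]] subspace] by simp
    then show False
      using Aut_bij[OF D_Aut[OF b]] v cvec.subspace_0[OF subspace]
      by (auto simp: bij_betw_def dest: inj_onD)
  qed
  moreover have "c (a \<otimes>\<^bsub>Aut V\<^esub> b) = c a * c b" if ab: "a \<in> D" "b \<in> D" for a b
  proof -
    have "c (a \<otimes>\<^bsub>Aut V\<^esub> b) *\<^sub>C v = a (b v)"
      using c[OF D_mult_closed[OF ab]] D_mult_apply[OF ab v(1)] by simp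
    also have "\<dots> = (c a * c b) *\<^sub>C v"
      unfolding c[OF ab(2)] linear_on_scale[OF Aut_linear[OF D_Aut[OF ab(1)]] v(1)] c[OF ab(1)]
      by (simp add: scaleC_scaleC mult.commute)
    finally show ?thesis using v(2) by simp
  qed
  ultimately have "?d \<in> Ch" by (auto simp: char_group_carrier D_mult_closed)
  moreover have "v \<in> E ?d" using v c by (simp add: E_iff)
  ultimately show ?thesis by blast
qed

text \<open>
A simultaneous eigenvector determines a character of \<open>D\<close>, so no eigenspaces other than those of
characters occur.
\<close>

lemma span_E: "cvec.span (\<Union>d\<in>Ch. E d) = S"
proof
  show "cvec.span (\<Union>d\<in>Ch. E d) \<subseteq> S"
    by (rule cvec.span_minimal) (auto simp: E_iff subspace)
  have "{w \<in> S. \<forall>b\<in>D. \<exists>c. b w = c *\<^sub>C w} \<subseteq> insert 0 (\<Union>d\<in>Ch. E d)"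
    using simultaneous_eigenvector_character by blast
  then have "cvec.span {w \<in> S. \<forall>b\<in>D. \<exists>c. b w = c *\<^sub>C w} \<subseteq> cvec.span (insert 0 (\<Union>d\<in>Ch. E d))"
    by (rule cvec.span_mono)
  then show "S \<subseteq> cvec.span (\<Union>d\<in>Ch. E d)"
    using span_simultaneous_eigenvectors[OF D_finite order.refl] cvec.span_insert_0 by blast
qed

text \<open>
The isotypic projection of the representation of \<open>D\<close> on \<open>V\<close>.
\<close>

definition proj :: "(('a \<Rightarrow> 'a) \<Rightarrow> complex) \<Rightarrow> 'a \<Rightarrow> 'a" where
  "proj d v = inverse (of_nat (card D)) *\<^sub>C (\<Sum>b\<in>D. inverse (d b) *\<^sub>C b v)"

lemma proj_S: "v \<in> S \<Longrightarrow> proj d v \<in> S"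
  unfolding proj_def
  by (rule cvec.subspace_scale[OF subspace], rule cvec.subspace_sum[OF subspace],
      rule cvec.subspace_scale[OF subspace], rule D_in)

lemma proj_linear_S: "linear_on S S (proj d)"
proof (rule linear_onI)
  show "proj d (x + y) = proj d x + proj d y" if "x \<in> S" "y \<in> S" for x y
  proof -
    have "(\<Sum>b\<in>D. inverse (d b) *\<^sub>C b (x + y)) =
        (\<Sum>b\<in>D. inverse (d b) *\<^sub>C b x + inverse (d b) *\<^sub>C b y)"
      by (intro sum.cong refl)
        (simp only: linear_on_add[OF Aut_linear[OF D_Aut] that] cvec.scale_right_distrib)
    then show ?thesis by (simp add: proj_def cvec.scale_right_distrib sum.distrib)
  qed
  show "proj d (c *\<^sub>C x) = c *\<^sub>C proj d x" if "x \<in> S" for c x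
  proof -
    have "(\<Sum>b\<in>D. inverse (d b) *\<^sub>C b (c *\<^sub>C x)) = (\<Sum>b\<in>D. c *\<^sub>C (inverse (d b) *\<^sub>C b x))"
      by (intro sum.cong refl)
        (simp only: linear_on_scale[OF Aut_linear[OF D_Aut] that] scaleC_scaleC mult.commute)
    also have "\<dots> = c *\<^sub>C (\<Sum>b\<in>D. inverse (d b) *\<^sub>C b x)"
      by (rule cvec.scale_sum_right[symmetric])
    finally have *: "(\<Sum>b\<in>D. inverse (d b) *\<^sub>C b (c *\<^sub>C x)) = c *\<^sub>C (\<Sum>b\<in>D. inverse (d b) *\<^sub>C b x)" .
    show ?thesis
      unfolding proj_def * by (rule cvec.scale_left_commute)
  qed
qed (rule proj_S)

lemma proj_E:
  assumes d: "d \<in> Ch" and e: "e \<in> Ch" and v: "v \<in> E e"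
  shows "proj d v = (if d = e then v else 0)"
proof -
  have "proj d v = (inverse (of_nat (card D)) * (\<Sum>b\<in>D. inverse (d b) * e b)) *\<^sub>C v"
  proof -
    have "(\<Sum>b\<in>D. inverse (d b) *\<^sub>C b v) = (\<Sum>b\<in>D. (inverse (d b) * e b) *\<^sub>C v)"
      by (intro sum.cong refl) (simp only: E_eigen[OF v] scaleC_scaleC)
    then show ?thesis
      by (simp only: proj_def cvec.scale_sum_left[symmetric] scaleC_scaleC)
  qed
  moreover have "(\<Sum>b\<in>D. inverse (d b) * e b) = (if d = e then of_nat (card D) else 0)"
  proof (cases "d = e")
    case True
    then have "inverse (d b) * e b = 1" if "b \<in> D" for b
      using d that by (auto simp: char_group_carrier)
    then show ?thesis using True by simp
  next
    case False
    interpret K: group "Aut V\<lparr>carrier := D\<rparr>" by (rule D_group)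
    obtain b where "b \<in> D" "d b \<noteq> e b"
      using False d e by (auto simp: char_group_carrier fun_eq_iff extensional_def) metis
    moreover have "inverse (d b) * e b \<noteq> 1"
      using calculation d by (auto simp: char_group_carrier field_simps)
    ultimately show ?thesis
      using K.sum_nontrivial_character[of "\<lambda>b. inverse (d b) * e b" b] d e False
      by (simp add: char_group_carrier)
  qed
  ultimately show ?thesis using D_nonempty D_finite by (simp add: scaleC_one)
qed

lemma E_disjoint:
  assumes "d \<in> Ch" "e \<in> Ch" "d \<noteq> e" "v \<in> E d" "v \<in> E e"
  shows "v = 0"
  using proj_E[of d d v] proj_E[of d e v] assms by simp

lemma proj_in_E: 
  assumes d: "d \<in> Ch" and v: "v \<in> S"
  shows "proj d v \<in> E d"
proof -
  have "proj d v \<in> cvec.span (proj d ` (\<Union>d\<in>Ch. E d))"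
    using v span_E E_sub by (intro linear_on_span[OF proj_linear_S subspace]) auto
  also have "\<dots> \<subseteq> E d"
    by (rule cvec.span_minimal) (auto simp: proj_E d subspace_E E_zero)
  finally show ?thesis .
qed

lemma proj_linear: "d \<in> Ch \<Longrightarrow> linear_on S (E d) (proj d)"
  using proj_linear_S proj_in_E by (auto simp: linear_on_def)

lemma sum_proj:
  assumes v: "v \<in> S"
  shows "(\<Sum>d\<in>Ch. proj d v) = v"
proof -
  have "v \<in> cvec.span (\<Union>d\<in>Ch. E d)" using v span_E by simp
  then have "v \<in> S \<and> (\<Sum>d\<in>Ch. proj d v) = v"
  proof (induction rule: cvec.span_induct_alt)
    case base
    then show ?case
      using linear_on_zero[OF proj_linear_S subspace] cvec.subspace_0[OF subspace] by simp
  next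
    case (step c x y)
    then obtain e where e: "e \<in> Ch" "x \<in> E e" by blast
    then have x: "x \<in> S" by (simp add: E_iff)
    have "(\<Sum>d\<in>Ch. proj d x) = x"
      using e finite_Ch by (simp add: proj_E sum.delta' cong: sum.cong)
    then show ?case
      using step x linear_on_add[OF proj_linear_S] linear_on_scale[OF proj_linear_S]
      by (simp add: cvec.subspace_add[OF subspace] cvec.subspace_scale[OF subspace] sum.distrib
          cvec.scale_sum_right[symmetric])
  qed
  then show ?thesis by blast
qed

text \<open>
Only the component of \<open>u\<close> in \<open>V(1)\<close> keeps \<open>v\<close> inside \<open>V(d)\<close>.
\<close>

lemma proj_op:
  assumes d: "d \<in> Ch" and v: "v \<in> E d" and u: "u \<in> S"
  shows "proj d (vop V u n v) = vop V (proj \<one>\<^sub>D u) n v"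
proof -
  have vS: "v \<in> S" using v by (rule E_S)
  have "u \<in> cvec.span (\<Union>d\<in>Ch. E d)" using u span_E by simp
  then have "u \<in> S \<and> proj d (vop V u n v) = vop V (proj \<one>\<^sub>D u) n v"
  proof (induction rule: cvec.span_induct_alt)
    case base
    then show ?case
      using linear_on_zero[OF proj_linear_S subspace] vS
      by (simp add: cvec.subspace_0[OF subspace] op_zero_left)
  next
    case (step c x y)
    then obtain e where e: "e \<in> Ch" "x \<in> E e" by blast
    then have x: "x \<in> S" by (simp add: E_iff)
    have "d = e \<cdot> d \<longleftrightarrow> \<one>\<^sub>D = e"
      using Ch.r_cancel_one'[OF d e(1)] by auto
    then have "proj d (vop V x n v) = vop V (proj \<one>\<^sub>D x) n v"
      using proj_E[OF d Ch.m_closed[OF e(1) d] E_op[OF e(2) v, of n]] proj_E[OF Ch.one_closed e]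
      by (simp add: op_zero_left vS)
    then show ?case
      using step x vS linear_on_add[OF proj_linear_S] linear_on_scale[OF proj_linear_S]
      by (simp add: cvec.subspace_add[OF subspace] cvec.subspace_scale[OF subspace]
          op_add_left op_scale_left op_in proj_S)
  qed
  then show ?thesis by blast
qed

section \<open>The fixed-point algebra and its modules\<close>

lemma fixed_simps [simp]: "vspace U = E \<one>\<^sub>D" "vop U = vop V" "vac U = vac V" "conf U = conf V"
  by (simp_all add: fixed_VOA_def)

lemma Md_simps [simp]: "mspace (Md d) = E d" "mop (Md d) = vop V"
  by (simp_all add: eigenmodule_def)

lemma adjoint_U: "adjoint U = Md \<one>\<^sub>D"
  by (simp add: adjoint_def eigenmodule_def)

text \<open>
The conformal vector is fixed by \<open>D\<close>, so the grading of the eigenspaces is the one inherited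
from \<open>V\<close>. The conditions on the dimensions and on the lower bound are thereby inherited too.
\<close>

lemma weight_space_Md: "weight_space U (Md d) c = weight_space V (adjoint V) c \<inter> E d"
  by (auto simp: weight_space_def adjoint_def E_iff)

lemma proj_weight_space:
  assumes d: "d \<in> Ch" and v: "v \<in> weight_space V (adjoint V) c"
  shows "proj d v \<in> weight_space U (Md d) c"
proof -
  have vS: "v \<in> S" and Lv: "vop V (conf V) 1 v = c *\<^sub>C v"
    using v by (auto simp: weight_space_def adjoint_def)
  have "vop V (conf V) 1 (b v) = c *\<^sub>C b v" if b: "b \<in> D" for b
    using Aut_op[OF D_Aut[OF b] conf_in vS, of 1] Aut_conf[OF D_Aut[OF b]] Lv
      linear_on_scale[OF Aut_linear[OF D_Aut[OF b]] vS] by simp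
  then have *: "vop V (conf V) 1 (inverse (d b) *\<^sub>C b v) = c *\<^sub>C (inverse (d b) *\<^sub>C b v)"
    if "b \<in> D" for b
    using that op_scale_right[OF conf_in D_in[OF that vS]] by (simp add: scaleC_scaleC mult.commute)
  have bS: "inverse (d b) *\<^sub>C b v \<in> S" if "b \<in> D" for b
    using cvec.subspace_scale[OF subspace D_in[OF that vS]] .
  have "vop V (conf V) 1 (\<Sum>b\<in>D. inverse (d b) *\<^sub>C b v) = (\<Sum>b\<in>D. c *\<^sub>C (inverse (d b) *\<^sub>C b v))"
    by (subst linear_on_sum[OF linear_op_right[OF conf_in] subspace bS])
      (simp_all only: * cong: sum.cong)
  also have "\<dots> = c *\<^sub>C (\<Sum>b\<in>D. inverse (d b) *\<^sub>C b v)"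
    by (rule cvec.scale_sum_right[symmetric])
  finally have sum: "vop V (conf V) 1 (\<Sum>b\<in>D. inverse (d b) *\<^sub>C b v) = c *\<^sub>C (\<Sum>b\<in>D. inverse (d b)
      *\<^sub>C b v)" .
  have "vop V (conf V) 1 (proj d v) = c *\<^sub>C proj d v"
    unfolding proj_def using sum
    by (subst op_scale_right[OF conf_in cvec.subspace_sum[OF subspace bS]])
      (simp_all add: cvec.scale_left_commute)
  then show ?thesis
    using proj_in_E[OF d vS] by (simp add: weight_space_def)
qed

lemma span_weight_spaces_Md:
  assumes d: "d \<in> Ch" and span: "cvec.span (\<Union>i\<in>I. weight_space V (adjoint V) (f i)) = S"
  shows "cvec.span (\<Union>i\<in>I. weight_space U (Md d) (f i)) = E d"
proof
  show "cvec.span (\<Union>i\<in>I. weight_space U (Md d) (f i)) \<subseteq> E d"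
    by (rule cvec.span_minimal) (auto simp: weight_space_def subspace_E)
  show "E d \<subseteq> cvec.span (\<Union>i\<in>I. weight_space U (Md d) (f i))"
  proof
    fix v assume v: "v \<in> E d"
    let ?X = "\<Union>i\<in>I. weight_space V (adjoint V) (f i)"
    have "v = proj d v" using proj_E[OF d d v] by simp
    also have "proj d v \<in> cvec.span (proj d ` ?X)"
      using span v by (intro linear_on_span[OF proj_linear_S subspace])
        (auto simp: weight_space_def adjoint_def E_iff)
    also have "\<dots> \<subseteq> cvec.span (\<Union>i\<in>I. weight_space U (Md d) (f i))"
      using proj_weight_space[OF d] by (intro cvec.span_mono) blast
    finally show "v \<in> cvec.span (\<Union>i\<in>I. weight_space U (Md d) (f i))" .
  qed
qed

lemma bilinear_E: "d \<in> Ch \<Longrightarrow> e \<in> Ch \<Longrightarrow> bilinear_on (E d) (E e) (E (d \<cdot> e)) (\<lambda>u. vop V u n)"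
  unfolding bilinear_on_def linear_on_def
  by (auto simp: E_op op_add_right op_add_left op_scale_left op_scale_right E_S)

lemma VOA_U: "VOA U"
proof
  obtain c where c: "\<forall>m n. \<forall>v\<in>S.
      Vir V m (Vir V n v) - Vir V n (Vir V m v) =
        of_int (m - n) *\<^sub>C Vir V (m + n) v
        + (if m + n = 0 then (of_int (m ^ 3 - m) / 12 * c) *\<^sub>C v else 0)"
    using virasoro by blast
  show "\<exists>c. \<forall>m n. \<forall>v\<in>vspace U.
      Vir U m (Vir U n v) - Vir U n (Vir U m v) =
        of_int (m - n) *\<^sub>C Vir U (m + n) v
        + (if m + n = 0 then (of_int (m ^ 3 - m) / 12 * c) *\<^sub>C v else 0)"
  proof (intro exI[of _ c] allI ballI)
    fix m n v assume "v \<in> vspace U"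
    then have "v \<in> S" by (simp add: E_S)
    then show "Vir U m (Vir U n v) - Vir U n (Vir U m v) =
        of_int (m - n) *\<^sub>C Vir U (m + n) v
        + (if m + n = 0 then (of_int (m ^ 3 - m) / 12 * c) *\<^sub>C v else 0)"
      unfolding fixed_simps by (rule c[rule_format])
  qed
  show "cvec.span (\<Union>n::int. weight_space U (adjoint U) (of_int n)) = vspace U"
    using span_weight_spaces_Md[OF Ch.one_closed grading] by (simp add: adjoint_U)
  show "fin_dim (weight_space U (adjoint U) (of_int n))" for n
    unfolding adjoint_U weight_space_Md by (rule fin_dim_subset[OF grading_fin_dim]) auto
  obtain N where N: "\<forall>n<N. weight_space V (adjoint V) (of_int n) = {0}"
    using grading_bounded_below by blast
  then show "\<exists>N. \<forall>n<N. weight_space U (adjoint U) (of_int n) = {0}"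
    unfolding adjoint_U weight_space_Md by (intro exI[of _ N]) (auto simp: E_zero)
  show "jacobi (vop U) (vop U) (vop U) (vop U) u v w" if "u \<in> vspace U" "v \<in> vspace U" "w \<in> vspace
      U" for u v w
    using that unfolding fixed_simps by (intro jacobi) (simp_all add: E_S)
  show "bilinear_on (vspace U) (vspace U) (vspace U) (\<lambda>u. vop U u n)" for n
    using bilinear_E[OF Ch.one_closed Ch.one_closed] by simp
  show "\<exists>N. \<forall>n\<ge>N. vop U u n v = 0" if "u \<in> vspace U" "v \<in> vspace U" for u v
    using truncation that by (simp add: E_S)
  show "vop U (Vir U (- 1) u) n v = - (of_int n *\<^sub>C vop U u (n - 1) v)"
    if "u \<in> vspace U" "v \<in> vspace U" for u v n
    using derivative[of u v n] that by (simp add: E_S)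
qed (simp_all add: subspace_E vac_E conf_E vacuum creation E_S)

lemma VOA_module_Md:
  assumes d: "d \<in> Ch"
  shows "VOA_module U (Md d)"
proof (rule VOA_module.intro[OF VOA_U], unfold_locales)
  interpret A: VOA_module V "adjoint V" by (rule adjoint_module)
  show "cvec.span (\<Union>c. weight_space U (Md d) c) = mspace (Md d)"
    using span_weight_spaces_Md[OF d, where I = UNIV and f = "\<lambda>c. c"] A.mgrading by (simp add:
        adjoint_def)
  show "fin_dim (weight_space U (Md d) c)" for c
    unfolding weight_space_Md by (rule fin_dim_subset[OF A.mgrading_fin_dim]) auto
  show "\<exists>N::int. \<forall>n<N. weight_space U (Md d) (c + of_int n) = {0}" for c
  proof -
    obtain N :: int where "\<forall>n<N. weight_space V (adjoint V) (c + of_int n) = {0}"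
      using A.mgrading_bounded_below by blast
    then show ?thesis
      unfolding weight_space_Md by (intro exI[of _ N]) (auto simp: E_zero)
  qed
  show "jacobi (vop U) (mop (Md d)) (mop (Md d)) (mop (Md d)) u v w"
    if "u \<in> vspace U" "v \<in> vspace U" "w \<in> mspace (Md d)" for u v w
    using that unfolding fixed_simps Md_simps by (intro jacobi) (simp_all add: E_S)
  show "bilinear_on (vspace U) (mspace (Md d)) (mspace (Md d)) (\<lambda>u. mop (Md d) u n)" for n
    using bilinear_E[OF Ch.one_closed d] d by simp
  show "\<exists>N. \<forall>n\<ge>N. mop (Md d) u n v = 0" if "u \<in> vspace U" "v \<in> mspace (Md d)" for u v
    using truncation that by (simp add: E_S)
qed (simp_all add: subspace_E vacuum E_S)

text \<open>
The projection to \<open>V(d)\<close> of the fact that \<open>v\<close> generates \<open>V\<close> under single modes.  It makes \<open>V(d)\<close>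
irreducible.
\<close>

lemma E_generated_by_any_vector:
  assumes d: "d \<in> Ch" and v: "v \<in> E d" "v \<noteq> 0"
  shows "E d \<subseteq> cvec.span {vop V u n v |u n. u \<in> E \<one>\<^sub>D}"
proof
  fix x assume x: "x \<in> E d"
  have vS: "v \<in> S" using v(1) by (rule E_S)
  have "x \<in> cvec.span {vop V u n v |u n. u \<in> S}"
    using generated_eq[OF vS v(2)] E_S[OF x] by (simp add: generated_def)
  then have "proj d x \<in> cvec.span (proj d ` {vop V u n v |u n. u \<in> S})"
    using op_in[OF _ vS] by (intro linear_on_span[OF proj_linear_S subspace]) blast+
  also have "\<dots> \<subseteq> cvec.span {vop V u n v |u n. u \<in> E \<one>\<^sub>D}"
    using proj_op[OF d v(1)] proj_in_E[OF Ch.one_closed] by (intro cvec.span_mono) blast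
  finally show "x \<in> cvec.span {vop V u n v |u n. u \<in> E \<one>\<^sub>D}"
    using proj_E[OF d d x] by simp
qed

lemma Md_submodule_trivial:
  assumes d: "d \<in> Ch" and N: "cvec.subspace N" "N \<subseteq> E d"
    "\<And>u n w. u \<in> E \<one>\<^sub>D \<Longrightarrow> w \<in> N \<Longrightarrow> vop V u n w \<in> N"
  shows "N = {0} \<or> N = E d"
proof (cases "N = {0}")
  case False
  then obtain w where w: "w \<in> N" "w \<noteq> 0" using cvec.subspace_0[OF N(1)] by blast
  then have "E d \<subseteq> cvec.span {vop V u n w |u n. u \<in> E \<one>\<^sub>D}"
    using N(2) by (intro E_generated_by_any_vector[OF d]) auto
  also have "\<dots> \<subseteq> N"
    using N(3) w(1) by (intro cvec.span_minimal[OF _ N(1)]) blast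
  finally show ?thesis using N(2) by blast
qed simp

end

section \<open>Transport of the Jacobi identity\<close>

lemma Sum_any_linear:
  assumes F: "linear_on R T F" and R: "cvec.subspace R"
    and t: "\<And>i. t i \<in> R" and fin: "finite {i. t i \<noteq> 0}"
  shows "Sum_any (\<lambda>i. F (t i)) = F (Sum_any t)"
proof -
  have "Sum_any (\<lambda>i. F (t i)) = (\<Sum>i | t i \<noteq> 0. F (t i))"
    using fin linear_on_zero[OF F R] by (intro Sum_any.expand_superset) auto
  also have "\<dots> = F (\<Sum>i | t i \<noteq> 0. t i)"
    by (rule linear_on_sum[OF F R t, symmetric])
  finally show ?thesis by (simp add: Sum_any.expand_set)
qed

text \<open>
The Jacobi identity only involves the three actions and the operator, so it survives every
change of modules that is compatible with them.  The index ring of the new operator may be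
larger than the integers as long as only integral modes are nonzero.  This covers copies of
modules, the passage from integral to complex modes, and operators twisted by an automorphism.
\<close>

lemma jacobi_transport:
  fixes K :: "'x::zero \<Rightarrow> int \<Rightarrow> 'y::zero \<Rightarrow> 'z::complex_vector"
    and I :: "'b \<Rightarrow> 'k::ring_1 \<Rightarrow> 'c \<Rightarrow> 'd::complex_vector"
  assumes jac: "jacobi X1 X2 X3 K u (g1 w1) (g2 w2)"
    and F: "linear_on R T F" and R: "cvec.subspace R"
    and w: "w1 \<in> A" "w2 \<in> B"
    and g1: "\<And>n. Y1 x n w1 \<in> A" "\<And>n. g1 (Y1 x n w1) = X1 u n (g1 w1)"
    and g2: "\<And>n. Y2 x n w2 \<in> B" "\<And>n. g2 (Y2 x n w2) = X2 u n (g2 w2)"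
    and KR: "\<And>a b k. a \<in> A \<Longrightarrow> b \<in> B \<Longrightarrow> K (g1 a) k (g2 b) \<in> R"
    and I_int: "\<And>a b k. a \<in> A \<Longrightarrow> b \<in> B \<Longrightarrow> I a (of_int k) b = F (K (g1 a) k (g2 b))"
    and I_non: "\<And>a b r. a \<in> A \<Longrightarrow> b \<in> B \<Longrightarrow> r \<notin> range of_int \<Longrightarrow> I a r b = 0"
    and X3: "\<And>y n. y \<in> R \<Longrightarrow> X3 u n y \<in> R" "\<And>y n. y \<in> R \<Longrightarrow> Y3 x n (F y) = F (X3 u n y)"
    and trunc: "\<exists>N. \<forall>n\<ge>N. K (g1 w1) n (g2 w2) = 0" "\<exists>N. \<forall>n\<ge>N. X1 u n (g1 w1) = 0"
      "\<exists>N. \<forall>n\<ge>N. X2 u n (g2 w2) = 0"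
    and zero: "\<And>n. X3 u n 0 = 0" "\<And>n. K (g1 w1) n 0 = 0" "\<And>n. K 0 n (g2 w2) = 0"
  shows "jacobi Y1 Y2 Y3 I x w1 w2"
  unfolding jacobi_def
proof (intro allI)
  fix l m :: int and r :: 'k
  have F0: "F 0 = 0" by (rule linear_on_zero[OF F R])
  let ?L = "\<lambda>i::nat. ((- 1) ^ i * (of_int l gchoose i)) *\<^sub>C
          (Y3 x (m + l - int i) (I w1 (r + of_nat i) w2)
           - ((- 1) powi l) *\<^sub>C I w1 (r + of_int l - of_nat i) (Y2 x (m + int i) w2))"
  let ?R = "\<lambda>i::nat. (of_int m gchoose i) *\<^sub>C
          I (Y1 x (l + int i) w1) (of_int m + r - of_nat i) w2"
  show "Sum_any ?L = Sum_any ?R"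
  proof (cases "r \<in> range of_int")
    case False
    have "r + of_nat i \<notin> range of_int" for i
    proof
      assume "r + of_nat i \<in> range of_int"
      then obtain k where "r + of_nat i = of_int k" by blast
      then have "r = of_int (k - int i)" by (simp add: algebra_simps)
      with False show False by blast
    qed
    moreover have "r + of_int l - of_nat i \<notin> range of_int" for i
    proof
      assume "r + of_int l - of_nat i \<in> range of_int"
      then obtain k where "r + of_int l - of_nat i = of_int k" by blast
      then have "r = of_int (k + int i - l)" by (simp add: algebra_simps)
      with False show False by blast
    qed
    moreover have "of_int m + r - of_nat i \<notin> range of_int" for i
    proof
      assume "of_int m + r - of_nat i \<in> range of_int"
      then obtain k where "of_int m + r - of_nat i = of_int k" by blast
      then have "r = of_int (k + int i - m)" by (simp add: algebra_simps)
      with False show False by blast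
    qed
    moreover have "Y3 x n 0 = 0" for n
      using X3(2)[OF cvec.subspace_0[OF R], of n] by (simp add: F0 zero)
    ultimately have L0: "?L i = 0" and R0: "?R i = 0" for i
      using I_non[OF w] I_non[OF w(1) g2(1)] I_non[OF g1(1) w(2)] by simp_all
    show ?thesis by (simp only: L0 R0)
  next
    case True
    then obtain k where r: "r = of_int k" by blast
    have idx: "r + of_nat i = of_int (k + int i)" "r + of_int l - of_nat i = of_int (k + l - int i)"
      "of_int m + r - of_nat i = of_int (m + k - int i)" for i
      by (simp_all add: r)
    let ?l = "\<lambda>i::nat. ((- 1) ^ i * (of_int l gchoose i)) *\<^sub>C
          (X3 u (m + l - int i) (K (g1 w1) (k + of_nat i) (g2 w2))
           - ((- 1) powi l) *\<^sub>C K (g1 w1) (k + of_int l - of_nat i) (X2 u (m + int i) (g2 w2)))"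
    let ?r = "\<lambda>i::nat. (of_int m gchoose i) *\<^sub>C
          K (X1 u (l + int i) (g1 w1)) (of_int m + k - of_nat i) (g2 w2)"
    have K2: "K (g1 w1) n (X2 u n' (g2 w2)) \<in> R" for n n'
      using KR[OF w(1) g2(1)[of n'], of n] by (simp add: g2(2))
    have K1: "K (X1 u n' (g1 w1)) n (g2 w2) \<in> R" for n n'
      using KR[OF g1(1)[of n'] w(2), of n] by (simp add: g1(2))
    have lR: "?l i \<in> R" and rR: "?r i \<in> R" for i
      by (intro cvec.subspace_scale[OF R] cvec.subspace_diff[OF R] X3(1) KR w K1 K2)+
    have Ll: "?L i = F (?l i)" for i
    proof -
      have "Y3 x (m + l - int i) (I w1 (r + of_nat i) w2) =
          F (X3 u (m + l - int i) (K (g1 w1) (k + of_nat i) (g2 w2)))"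
        unfolding idx I_int[OF w] using X3(2)[OF KR[OF w]] by simp
      moreover have "I w1 (r + of_int l - of_nat i) (Y2 x (m + int i) w2) =
          F (K (g1 w1) (k + of_int l - of_nat i) (X2 u (m + int i) (g2 w2)))"
        unfolding idx I_int[OF w(1) g2(1)] by (simp add: g2(2))
      ultimately show ?thesis
        using X3(1)[OF KR[OF w]] K2
        by (simp add: linear_on_scale[OF F] linear_on_diff[OF F R] cvec.subspace_scale[OF R]
            cvec.subspace_diff[OF R])
    qed
    have Rr: "?R i = F (?r i)" for i
      unfolding idx I_int[OF g1(1) w(2)] using K1
      by (simp add: g1(2) linear_on_scale[OF F])
    obtain N1 where N1: "\<forall>n\<ge>N1. K (g1 w1) n (g2 w2) = 0" using trunc(1) by blast
    obtain N2 where N2: "\<forall>n\<ge>N2. X1 u n (g1 w1) = 0" using trunc(2) by blast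
    obtain N3 where N3: "\<forall>n\<ge>N3. X2 u n (g2 w2) = 0" using trunc(3) by blast
    have fl: "finite {i. ?l i \<noteq> 0}"
    proof (rule finite_support_nat)
      fix i assume "i \<ge> nat (max (N1 - k) (N3 - m))"
      then have "k + of_nat i \<ge> N1" "m + int i \<ge> N3" by auto
      then show "?l i = 0" using N1 N3 by (simp add: zero)
    qed
    have fr: "finite {i. ?r i \<noteq> 0}"
    proof (rule finite_support_nat)
      fix i assume "i \<ge> nat (N2 - l)"
      then have "l + int i \<ge> N2" by auto
      then show "?r i = 0" using N2 by (simp add: zero)
    qed
    have "Sum_any ?L = F (Sum_any ?l)"
      unfolding Ll by (rule Sum_any_linear[OF F R, of ?l, OF lR fl])
    also have "Sum_any ?l = Sum_any ?r"
      by (rule jac[unfolded jacobi_def, rule_format])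
    also have "F (Sum_any ?r) = Sum_any ?R"
      unfolding Rr by (rule Sum_any_linear[OF F R, of ?r, OF rR fr, symmetric])
    finally show ?thesis .
  qed
qed

section \<open>Isomorphism of modules\<close>

lemma module_isomorphic_sym:
  assumes M: "VOA_module V M" and iso: "module_isomorphic V M N"
  shows "module_isomorphic V N M"
proof -
  interpret VOA_module V M by fact
  obtain f where f: "linear_on (mspace M) (mspace N) f" "bij_betw f (mspace M) (mspace N)"
    "\<And>v n w. v \<in> vspace V \<Longrightarrow> w \<in> mspace M \<Longrightarrow> f (mop M v n w) = mop N v n (f w)"
    using iso unfolding module_isomorphic_def by blast
  let ?g = "inv_into (mspace M) f"
  have inj: "inj_on f (mspace M)" and im: "f ` mspace M = mspace N"
    using f(2) by (auto simp: bij_betw_def)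
  have "?g (mop N v n w) = mop M v n (?g w)" if v: "v \<in> vspace V" and w: "w \<in> mspace N" for v n w
  proof -
    obtain x where x: "x \<in> mspace M" "w = f x" using w im by blast
    have "mop M v n x \<in> mspace M"
      using mbilinear[of n] v x(1) unfolding bilinear_on_def linear_on_def by blast
    then show ?thesis
      unfolding x(2) f(3)[OF v x(1), symmetric] using inj x(1) by (simp add: inv_into_f_f)
  qed
  then show ?thesis
    unfolding module_isomorphic_def
    using linear_on_inv_into[OF f(1,2) msubspace] bij_betw_inv_into[OF f(2)]
    by (intro exI[of _ ?g] conjI ballI allI)
qed

lemma module_isomorphic_trans:
  assumes "module_isomorphic V M N" "module_isomorphic V N P"
  shows "module_isomorphic V M P"
proof -
  obtain f where f: "linear_on (mspace M) (mspace N) f" "bij_betw f (mspace M) (mspace N)"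
    "\<And>v n w. v \<in> vspace V \<Longrightarrow> w \<in> mspace M \<Longrightarrow> f (mop M v n w) = mop N v n (f w)"
    using assms(1) unfolding module_isomorphic_def by blast
  obtain g where g: "linear_on (mspace N) (mspace P) g" "bij_betw g (mspace N) (mspace P)"
    "\<And>v n w. v \<in> vspace V \<Longrightarrow> w \<in> mspace N \<Longrightarrow> g (mop N v n w) = mop P v n (g w)"
    using assms(2) unfolding module_isomorphic_def by blast
  show ?thesis
    unfolding module_isomorphic_def
  proof (intro exI[of _ "\<lambda>x. g (f x)"] conjI ballI allI)
    show "linear_on (mspace M) (mspace P) (\<lambda>x. g (f x))"
      by (rule linear_on_compose[OF f(1) g(1)])
    show "bij_betw (\<lambda>x. g (f x)) (mspace M) (mspace P)"
      using bij_betw_trans[OF f(2) g(2)] by (simp add: comp_def)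
    show "g (f (mop M v n w)) = mop P v n (g (f w))" if "v \<in> vspace V" "w \<in> mspace M" for v n w
      using f(3)[OF that] g(3)[OF that(1) linear_on_in[OF f(1) that(2)]] by simp
  qed
qed

lemma module_isomorphic_refl: "module_isomorphic V M M"
  unfolding module_isomorphic_def linear_on_def by (intro exI[of _ "\<lambda>x. x"]) (auto simp: bij_betw_def)

section \<open>Realization of the eigenspaces by complex sequences\<close>

text \<open>
Coordinates with respect to a basis contained in the countable spanning set \<open>C\<close>.
\<close>

lemma countable_span_embedding:
  assumes C: "countable C" "S \<subseteq> cvec.span C"
  shows "\<exists>f :: 'a::complex_vector \<Rightarrow> nat \<Rightarrow> complex. linear_on S UNIV f \<and> inj_on f S"
proof -
  obtain B where B: "B \<subseteq> C" "cvec.independent B" "C \<subseteq> cvec.span B"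
    using cvec.maximal_independent_subset by blast
  have cB: "countable B" using B(1) C(1) by (rule countable_subset)
  have SB: "v \<in> cvec.span B" if "v \<in> S" for v
    using that C(2) cvec.span_minimal[OF B(3)] by auto
  let ?f = "\<lambda>v n. cvec.representation B v (from_nat_into B n)"
  have "linear_on S UNIV ?f"
  proof (rule linear_onI)
    show "?f (x + y) = ?f x + ?f y" if "x \<in> S" "y \<in> S" for x y
      unfolding cvec.representation_add[OF B(2) SB[OF that(2)] SB[OF that(1)]] by (rule ext) simp
    show "?f (c *\<^sub>C x) = c *\<^sub>C ?f x" if "x \<in> S" for c x
      unfolding cvec.representation_scale[OF B(2) SB[OF that]] scaleC_fun_def scaleC_complex_def ..
  qed simp
  moreover have "inj_on ?f S"
  proof (rule inj_onI)
    fix v w assume vw: "v \<in> S" "w \<in> S" and eq: "?f v = ?f w"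
    have "cvec.representation B v b = cvec.representation B w b" for b
    proof (cases "b \<in> B")
      case True
      then show ?thesis
        using fun_cong[OF eq, of "to_nat_on B b"] by (simp add: from_nat_into_to_nat_on[OF cB])
    next
      case False
      then have "cvec.representation B x b = 0" for x
        using cvec.representation_ne_zero[of B x b] by blast
      then show ?thesis by simp
    qed
    then have "cvec.representation B v = cvec.representation B w" by (rule ext)
    note eq_rep = this
    have "v = (\<Sum>b | cvec.representation B v b \<noteq> 0. cvec.representation B v b *\<^sub>C b)"
      by (rule cvec.sum_nonzero_representation_eq[OF B(2) SB[OF vw(1)], symmetric])
    also have "\<dots> = w"
      unfolding eq_rep by (rule cvec.sum_nonzero_representation_eq[OF B(2) SB[OF vw(2)]])
    finally show "v = w" .
  qed
  ultimately show ?thesis by blast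
qed

context VOA
begin

lemma exists_embedding:
  "\<exists>f :: 'a \<Rightarrow> nat \<Rightarrow> complex. linear_on (vspace V) UNIV f \<and> inj_on f (vspace V)"
proof -
  have "\<forall>n. \<exists>B. finite B \<and> weight_space V (adjoint V) (of_int n) \<subseteq> cvec.span B"
    using grading_fin_dim unfolding fin_dim_def by blast
  then obtain B where B: "\<And>n. finite (B n)" "\<And>n. weight_space V (adjoint V) (of_int n) \<subseteq> cvec.span
      (B n)"
    by metis
  have "countable (\<Union>n. B n)" using B(1) by (simp add: countable_finite)
  moreover have "vspace V \<subseteq> cvec.span (\<Union>n. B n)"
    unfolding grading[symmetric]
  proof (rule cvec.span_minimal[OF _ cvec.subspace_span])
    show "(\<Union>n. weight_space V (adjoint V) (of_int n)) \<subseteq> cvec.span (\<Union>n. B n)"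
    proof
      fix v assume "v \<in> (\<Union>n. weight_space V (adjoint V) (of_int n))"
      then obtain n where "v \<in> cvec.span (B n)" using B(2) by blast
      moreover have "B n \<subseteq> (\<Union>n. B n)" by blast
      ultimately show "v \<in> cvec.span (\<Union>n. B n)" by (rule set_mp[OF cvec.span_mono, rotated])
    qed
  qed
  ultimately show ?thesis by (rule countable_span_embedding)
qed

definition emb :: "'a \<Rightarrow> nat \<Rightarrow> complex" where
  "emb = (SOME f. linear_on (vspace V) UNIV f \<and> inj_on f (vspace V))"

lemma emb_linear: "linear_on (vspace V) UNIV emb" and emb_inj: "inj_on emb (vspace V)"
  using someI_ex[OF exists_embedding] unfolding emb_def by blast+

definition unemb :: "(nat \<Rightarrow> complex) \<Rightarrow> 'a" where
  "unemb = inv_into (vspace V) emb"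

lemma unemb_emb: "v \<in> vspace V \<Longrightarrow> unemb (emb v) = v"
  unfolding unemb_def by (rule inv_into_f_f[OF emb_inj])

lemma emb_zero: "emb 0 = 0"
  by (rule linear_on_zero[OF emb_linear subspace])

lemma emb_eq_0D: "v \<in> vspace V \<Longrightarrow> emb v = 0 \<Longrightarrow> v = 0"
  using inj_onD[OF emb_inj, of v 0] emb_zero cvec.subspace_0[OF subspace] by simp

end

context orbifold
begin

text \<open>
The eigenmodule \<open>V(d)\<close> with its space moved into \<open>nat \<Rightarrow> complex\<close>, where the fusion product can
see it.
\<close>

definition seq_copy :: "(('a \<Rightarrow> 'a) \<Rightarrow> complex) \<Rightarrow> ('a, nat \<Rightarrow> complex) vmod" where
  "seq_copy d = \<lparr>mspace = emb ` E d, mop = \<lambda>u n x. emb (vop V u n (unemb x))\<rparr>"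

lemma seq_copy_space [simp]: "mspace (seq_copy d) = emb ` E d"
  by (simp add: seq_copy_def)

lemma seq_copy_op [simp]: "v \<in> S \<Longrightarrow> mop (seq_copy d) u n (emb v) = emb (vop V u n v)"
  by (simp add: seq_copy_def unemb_emb)

lemma emb_linear_E: "linear_on (E d) (emb ` E d) emb"
  by (rule linear_on_subset[OF emb_linear E_sub]) simp

lemma emb_add: "v \<in> S \<Longrightarrow> w \<in> S \<Longrightarrow> emb (v + w) = emb v + emb w"
  and emb_scale: "v \<in> S \<Longrightarrow> emb (c *\<^sub>C v) = c *\<^sub>C emb v"
  using emb_linear by (auto simp: linear_on_def)

lemma iso_seq_copy: "module_isomorphic U (Md d) (seq_copy d)"
  unfolding module_isomorphic_def
proof (intro exI[of _ emb] conjI ballI allI)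
  show "linear_on (mspace (Md d)) (mspace (seq_copy d)) emb"
    using emb_linear_E by simp
  show "bij_betw emb (mspace (Md d)) (mspace (seq_copy d))"
    using inj_on_subset[OF emb_inj E_sub] by (simp add: bij_betw_def)
qed (simp add: E_S)

lemma weight_space_seq_copy: "weight_space U (seq_copy d) c = emb ` weight_space U (Md d) c"
proof
  show "weight_space U (seq_copy d) c \<subseteq> emb ` weight_space U (Md d) c"
  proof
    fix x assume "x \<in> weight_space U (seq_copy d) c"
    then obtain v where v: "x = emb v" "v \<in> E d" "emb (vop V (conf V) 1 v) = c *\<^sub>C emb v"
      by (auto simp: weight_space_def E_S)
    then have "emb (vop V (conf V) 1 v) = emb (c *\<^sub>C v)" by (simp add: emb_scale E_S)
    then have "vop V (conf V) 1 v = c *\<^sub>C v"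
      using inj_onD[OF emb_inj] v(2) E_S op_in[OF conf_in] cvec.subspace_scale[OF subspace] by simp
    then show "x \<in> emb ` weight_space U (Md d) c"
      using v by (auto simp: weight_space_def)
  qed
  show "emb ` weight_space U (Md d) c \<subseteq> weight_space U (seq_copy d) c"
    by (auto simp: weight_space_def E_S emb_scale)
qed

lemma VOA_module_seq_copy:
  assumes d: "d \<in> Ch"
  shows "VOA_module U (seq_copy d)"
proof (rule VOA_module.intro[OF VOA_U], unfold_locales)
  interpret M: VOA_module U "Md d" by (rule VOA_module_Md[OF d])
  show "cvec.subspace (mspace (seq_copy d))"
    using subspace_linear_image[OF emb_linear_E subspace_E] by simp
  show "bilinear_on (vspace U) (mspace (seq_copy d)) (mspace (seq_copy d)) (\<lambda>u. mop (seq_copy d) u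
      n)" for n
    unfolding bilinear_on_def
  proof (intro conjI ballI)
    fix u assume "u \<in> vspace U"
    then have u: "u \<in> E \<one>\<^sub>D" by simp
    show "linear_on (mspace (seq_copy d)) (mspace (seq_copy d)) (mop (seq_copy d) u n)"
    proof (rule linear_onI)
      fix x assume "x \<in> mspace (seq_copy d)"
      then obtain v where v: "v \<in> E d" "x = emb v" by auto
      show "mop (seq_copy d) u n x \<in> mspace (seq_copy d)"
        using v E_one_op[OF d u] by (simp add: E_S)
      show "mop (seq_copy d) u n (c *\<^sub>C x) = c *\<^sub>C mop (seq_copy d) u n x" for c
        using v u cvec.subspace_scale[OF subspace E_S[OF v(1)], of c]
        by (simp add: emb_scale[symmetric] E_S op_scale_right op_in)
      fix y assume "y \<in> mspace (seq_copy d)"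
      then obtain w where w: "w \<in> E d" "y = emb w" by auto
      show "mop (seq_copy d) u n (x + y) = mop (seq_copy d) u n x + mop (seq_copy d) u n y"
        using v w u cvec.subspace_add[OF subspace E_S[OF v(1)] E_S[OF w(1)]]
        by (simp add: emb_add[symmetric] E_S op_add_right op_in)
    qed
  next
    fix x assume "x \<in> mspace (seq_copy d)"
    then obtain v where v: "v \<in> E d" "x = emb v" by auto
    show "linear_on (vspace U) (mspace (seq_copy d)) (\<lambda>u. mop (seq_copy d) u n x)"
      by (rule linear_onI)
        (use v E_one_op[OF d] in \<open>auto simp: E_S op_add_left op_scale_left emb_add emb_scale op_in\<close>)
  qed
  show "\<exists>N. \<forall>n\<ge>N. mop (seq_copy d) u n x = 0" if ux: "u \<in> vspace U" "x \<in> mspace (seq_copy d)" for u x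
  proof -
    obtain v where v: "v \<in> E d" "x = emb v" using ux by auto
    have uS: "u \<in> S" using ux(1) by (simp add: E_S)
    obtain N where "\<forall>n\<ge>N. vop V u n v = 0" using truncation[OF uS E_S[OF v(1)]] by blast
    then show ?thesis using v by (intro exI[of _ N]) (simp add: E_S emb_zero)
  qed
  show "mop (seq_copy d) (vac U) n x = (if n = - 1 then x else 0)" if "x \<in> mspace (seq_copy d)" for n x
    using that by (auto simp: E_S vacuum emb_zero)
  show "jacobi (vop U) (mop (seq_copy d)) (mop (seq_copy d)) (mop (seq_copy d)) u v x"
    if "u \<in> vspace U" "v \<in> vspace U" "x \<in> mspace (seq_copy d)" for u v x
  proof -
    from that have u: "u \<in> E \<one>\<^sub>D" and v: "v \<in> E \<one>\<^sub>D" and x: "x \<in> emb ` E d" by auto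
    then obtain w where w: "w \<in> E d" "x = emb w" by auto
    have un: "unemb (emb y) = y" if "y \<in> E e" for y e using unemb_emb E_S that by blast
    show ?thesis
    proof (rule jacobi_transport[where K = "vop V" and ?X1.0 = "vop V" and ?X2.0 = "vop V"
          and ?X3.0 = "vop V" and u = u and ?g1.0 = "\<lambda>v. v" and ?g2.0 = unemb and A = "E \<one>\<^sub>D"
          and B = "emb ` E d" and F = emb and R = "E d"])
      show "jacobi (vop V) (vop V) (vop V) (vop V) u v (unemb x)"
        using u v w un by (intro jacobi) (auto simp: E_S)
      show "linear_on (E d) (emb ` E d) emb" by (rule emb_linear_E)
      show "cvec.subspace (E d)" by (rule subspace_E)
      show "\<exists>N. \<forall>n\<ge>N. vop V v n (unemb x) = 0" "\<exists>N. \<forall>n\<ge>N. vop V u n v = 0"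
        "\<exists>N. \<forall>n\<ge>N. vop V u n (unemb x) = 0"
        using u v w by (auto simp: un E_S intro!: truncation)
      show "a \<in> E \<one>\<^sub>D \<Longrightarrow> b \<in> emb ` E d \<Longrightarrow> r \<notin> range of_int \<Longrightarrow> mop (seq_copy d) a r b = 0" for a b r
        using rangeI[of of_int r] by simp
    qed (use u v w in \<open>auto simp: unemb_emb op_in E_S E_one_op d op_zero_left op_zero_right\<close>)
  qed
  show "cvec.span (\<Union>c. weight_space U (seq_copy d) c) = mspace (seq_copy d)"
  proof
    show "cvec.span (\<Union>c. weight_space U (seq_copy d) c) \<subseteq> mspace (seq_copy d)"
      by (rule cvec.span_minimal)
        (use subspace_linear_image[OF emb_linear_E subspace_E] in \<open>auto simp: weight_space_def\<close>)
    have "emb v \<in> cvec.span (emb ` (\<Union>c. weight_space U (Md d) c))" if "v \<in> E d" for v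
      by (rule linear_on_span[OF emb_linear_E subspace_E])
        (use M.mgrading that in \<open>auto simp: weight_space_def\<close>)
    then show "mspace (seq_copy d) \<subseteq> cvec.span (\<Union>c. weight_space U (seq_copy d) c)"
      by (auto simp: weight_space_seq_copy image_UN)
  qed
  show "fin_dim (weight_space U (seq_copy d) c)" for c
    unfolding weight_space_seq_copy
    by (rule fin_dim_linear_image[OF emb_linear_E subspace_E _ M.mgrading_fin_dim])
      (auto simp: weight_space_def)
  show "\<exists>N::int. \<forall>n<N. weight_space U (seq_copy d) (c + of_int n) = {0}" for c
  proof -
    obtain N :: int where "\<forall>n<N. weight_space U (Md d) (c + of_int n) = {0}"
      using M.mgrading_bounded_below by blast
    then show ?thesis unfolding weight_space_seq_copy by (intro exI[of _ N]) (simp add: emb_zero)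
  qed
qed

lemma irreducible_seq_copy:
  assumes d: "d \<in> Ch" and nz: "E d \<noteq> {0}"
  shows "irreducible_module U (seq_copy d)"
  unfolding irreducible_module_def
proof (intro conjI allI impI)
  show "VOA_module U (seq_copy d)" by (rule VOA_module_seq_copy[OF d])
  show "mspace (seq_copy d) \<noteq> {0}"
  proof
    assume "mspace (seq_copy d) = {0}"
    then have emb0: "emb ` E d = {0}" by simp
    have "E d \<subseteq> {0}"
    proof
      fix v assume v: "v \<in> E d"
      then have "emb v = 0" using emb0 by blast
      then show "v \<in> {0}" using emb_eq_0D[OF E_S[OF v]] by simp
    qed
    with nz E_zero[of d] show False by blast
  qed
  fix N assume N: "submodule_of U (seq_copy d) N"
  then have sub: "cvec.subspace N" "N \<subseteq> emb ` E d"
    and op: "\<And>u n x. u \<in> E \<one>\<^sub>D \<Longrightarrow> x \<in> N \<Longrightarrow> mop (seq_copy d) u n x \<in> N"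
    by (auto simp: submodule_of_def)
  let ?N = "{v \<in> E d. emb v \<in> N}"
  have cases: "?N = {0} \<or> ?N = E d"
  proof (rule Md_submodule_trivial[OF d])
    show "cvec.subspace ?N"
      by (rule cvec.subspaceI)
        (auto simp: E_zero emb_zero cvec.subspace_0[OF sub(1)] E_add E_scale emb_add emb_scale E_S
          cvec.subspace_add[OF sub(1)] cvec.subspace_scale[OF sub(1)])
    show "vop V u n w \<in> ?N" if u: "u \<in> E \<one>\<^sub>D" and w: "w \<in> ?N" for u n w
    proof -
      have "w \<in> E d" "emb w \<in> N" using w by auto
      then show ?thesis using op[OF u, of "emb w" n] E_one_op[OF d u] by (simp add: E_S)
    qed
  qed auto
  have N_eq: "N = emb ` ?N" using sub(2) by auto
  show "N = {0} \<or> N = mspace (seq_copy d)"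
    using cases
  proof
    assume N0: "?N = {0}"
    show ?thesis by (rule disjI1, subst N_eq, subst N0) (simp add: emb_zero)
  next
    assume NE: "?N = E d"
    show ?thesis by (rule disjI2, subst N_eq, subst NE) simp
  qed
qed

end

section \<open>Intertwining operators with integral modes\<close>

context orbifold
begin

text \<open>
An intertwining operator among eigenmodules over \<open>U\<close> all of whose modes are integral.
\<close>

definition intertwiner where
  "intertwiner d1 d2 d3 K \<longleftrightarrow>
    (\<forall>n. bilinear_on (E d1) (E d2) (E d3) (\<lambda>w1. K w1 n)) \<and>
    (\<forall>w1\<in>E d1. \<forall>w2\<in>E d2. \<exists>N::int. \<forall>n\<ge>N. K w1 n w2 = 0) \<and>
    (\<forall>u\<in>E \<one>\<^sub>D. \<forall>w1\<in>E d1. \<forall>w2\<in>E d2. jacobi (vop V) (vop V) (vop V) K u w1 w2) \<and>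
    (\<forall>w1\<in>E d1. \<forall>w2\<in>E d2. \<forall>n. K (vop V (conf V) 0 w1) n w2 = - (of_int n *\<^sub>C K w1 (n - 1) w2))"

lemma
  assumes "intertwiner d1 d2 d3 K" and w: "w1 \<in> E d1" "w2 \<in> E d2"
  shows intertwiner_in: "K w1 n w2 \<in> E d3"
    and intertwiner_linear_left: "linear_on (E d1) (E d3) (\<lambda>x. K x n w2)"
    and intertwiner_linear_right: "linear_on (E d2) (E d3) (K w1 n)"
    and intertwiner_trunc: "\<exists>N::int. \<forall>n\<ge>N. K w1 n w2 = 0"
    and intertwiner_jacobi: "u \<in> E \<one>\<^sub>D \<Longrightarrow> jacobi (vop V) (vop V) (vop V) K u w1 w2"
    and intertwiner_deriv: "K (vop V (conf V) 0 w1) n w2 = - (of_int n *\<^sub>C K w1 (n - 1) w2)"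
proof -
  have bil: "bilinear_on (E d1) (E d2) (E d3) (\<lambda>w1. K w1 n)"
    and rest: "\<exists>N::int. \<forall>n\<ge>N. K w1 n w2 = 0"
      "u \<in> E \<one>\<^sub>D \<Longrightarrow> jacobi (vop V) (vop V) (vop V) K u w1 w2"
      "K (vop V (conf V) 0 w1) n w2 = - (of_int n *\<^sub>C K w1 (n - 1) w2)"
    using assms unfolding intertwiner_def by simp_all
  show r: "linear_on (E d2) (E d3) (K w1 n)" and "linear_on (E d1) (E d3) (\<lambda>x. K x n w2)"
    using bil w unfolding bilinear_on_def by simp_all
  show "K w1 n w2 \<in> E d3" by (rule linear_on_in[OF r w(2)])
qed (use assms in \<open>unfold intertwiner_def, simp_all\<close>)

text \<open>
The operator \<open>K\<close> with complex indices and values in the sequence copy of the target.  The floor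
is the integer that \<open>r\<close> equals; modes of non-integral index vanish.
\<close>

definition complex_modes where
  "complex_modes d1 d2 K = (\<lambda>w1 (r::complex) w2. if w1 \<in> E d1 \<and> w2 \<in> E d2 \<and> r \<in> \<int>
    then emb (K w1 \<lfloor>Re r\<rfloor> w2) else 0)"

lemma complex_modes_int: "w1 \<in> E d1 \<Longrightarrow> w2 \<in> E d2 \<Longrightarrow> complex_modes d1 d2 K w1 (of_int k) w2 = emb (K
    w1 k w2)"
  by (simp add: complex_modes_def)

lemma complex_modes_non_int: "r \<notin> \<int> \<Longrightarrow> complex_modes d1 d2 K w1 r w2 = 0"
  by (simp add: complex_modes_def)

lemma complex_modes_intertwining_operator:
  assumes d: "d1 \<in> Ch" "d2 \<in> Ch" "d3 \<in> Ch" and K: "intertwiner d1 d2 d3 K"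
  shows "complex_modes d1 d2 K \<in> intertwining_operators U (Md d1) (Md d2) (seq_copy d3)"
  unfolding intertwining_operators_def
proof (intro CollectI conjI allI ballI impI)
  let ?I = "complex_modes d1 d2 K"
  note KE = intertwiner_in[OF K]
  show "?I w1 r w2 = 0" if "w1 \<notin> mspace (Md d1) \<or> w2 \<notin> mspace (Md d2)" for w1 r w2
    using that by (auto simp: complex_modes_def)
  show "bilinear_on (mspace (Md d1)) (mspace (Md d2)) (mspace (seq_copy d3)) (\<lambda>w1. ?I w1 r)" for r
  proof (cases "r \<in> \<int>")
    case True
    then obtain k where r: "r = of_int k" by (auto elim: Ints_cases)
    show ?thesis
      unfolding bilinear_on_def Md_simps seq_copy_space r
    proof (intro conjI ballI)
      fix w1 assume w1: "w1 \<in> E d1"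
      show "linear_on (E d2) (emb ` E d3) (?I w1 (of_int k))"
      proof (rule linear_onI)
        fix x c assume x: "x \<in> E d2"
        note lin = intertwiner_linear_right[OF K w1 x, of k]
        show "?I w1 (of_int k) x \<in> emb ` E d3"
          using KE[OF w1 x] by (simp add: complex_modes_int w1 x)
        show "?I w1 (of_int k) (c *\<^sub>C x) = c *\<^sub>C ?I w1 (of_int k) x"
          using linear_on_scale[OF lin x] emb_scale[OF E_S[OF KE[OF w1 x]]]
          by (simp add: complex_modes_int w1 x E_scale)
        fix y assume y: "y \<in> E d2"
        show "?I w1 (of_int k) (x + y) = ?I w1 (of_int k) x + ?I w1 (of_int k) y"
          using linear_on_add[OF lin x y] emb_add[OF E_S[OF KE[OF w1 x]] E_S[OF KE[OF w1 y]]]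
          by (simp add: complex_modes_int w1 x y E_add)
      qed
    next
      fix w2 assume w2: "w2 \<in> E d2"
      show "linear_on (E d1) (emb ` E d3) (\<lambda>w1. ?I w1 (of_int k) w2)"
      proof (rule linear_onI)
        fix x c assume x: "x \<in> E d1"
        note lin = intertwiner_linear_left[OF K x w2, of k]
        show "?I x (of_int k) w2 \<in> emb ` E d3"
          using KE[OF x w2] by (simp add: complex_modes_int w2 x)
        show "?I (c *\<^sub>C x) (of_int k) w2 = c *\<^sub>C ?I x (of_int k) w2"
          using linear_on_scale[OF lin x] emb_scale[OF E_S[OF KE[OF x w2]]]
          by (simp add: complex_modes_int w2 x E_scale)
        fix y assume y: "y \<in> E d1"
        show "?I (x + y) (of_int k) w2 = ?I x (of_int k) w2 + ?I y (of_int k) w2"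
          using linear_on_add[OF lin x y] emb_add[OF E_S[OF KE[OF x w2]] E_S[OF KE[OF y w2]]]
          by (simp add: complex_modes_int w2 x y E_add)
      qed
    qed
  next
    case False
    have "0 \<in> emb ` E d3" using E_zero emb_zero by (metis imageI)
    then show ?thesis
      unfolding bilinear_on_def linear_on_def by (simp add: complex_modes_non_int[OF False])
  qed
  fix w1 w2 and r :: complex assume "w1 \<in> mspace (Md d1)" "w2 \<in> mspace (Md d2)"
  then have w: "w1 \<in> E d1" "w2 \<in> E d2" by simp_all
  show "\<exists>N::int. \<forall>n\<ge>N. ?I w1 (r + of_int n) w2 = 0"
  proof (cases "r \<in> \<int>")
    case True
    then obtain k where r: "r = of_int k" by (auto elim: Ints_cases)
    obtain N where N: "\<forall>n\<ge>N. K w1 n w2 = 0" using intertwiner_trunc[OF K w] by blast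
    show ?thesis
    proof (intro exI allI impI)
      fix n assume "n \<ge> N - k"
      then have "K w1 (k + n) w2 = 0" using N by simp
      then show "?I w1 (r + of_int n) w2 = 0"
        unfolding r of_int_add[symmetric] complex_modes_int[OF w] by (simp add: emb_zero)
    qed
  next
    case False
    have "r + of_int n \<notin> \<int>" for n
      using False Ints_diff[of "r + of_int n" "of_int n"] by auto
    then show ?thesis by (simp add: complex_modes_non_int)
  qed
  show "?I (mop (Md d1) (conf U) 0 w1) r w2 = - (r *\<^sub>C ?I w1 (r - 1) w2)"
  proof (cases "r \<in> \<int>")
    case True
    then obtain k where r: "r = of_int k" by (auto elim: Ints_cases)
    have r1: "r - 1 = of_int (k - 1)" by (simp add: r)
    have "emb (- (of_int k *\<^sub>C K w1 (k - 1) w2)) = - (of_int k *\<^sub>C emb (K w1 (k - 1) w2))"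
      using emb_scale[OF E_S[OF KE[OF w]], of "- of_int k" "k - 1"] by simp
    then show ?thesis
      unfolding r1 unfolding r Md_simps fixed_simps
        complex_modes_int[OF w] complex_modes_int[OF E_one_op[OF d(1) conf_E w(1)] w(2)]
            intertwiner_deriv[OF K w] .
  next
    case False
    then have "r - 1 \<notin> \<int>" using Ints_add[of "r - 1" 1] by auto
    then show ?thesis by (simp add: complex_modes_non_int False)
  qed
next
  let ?I = "complex_modes d1 d2 K"
  fix u w1 w2 assume "u \<in> vspace U" "w1 \<in> mspace (Md d1)" "w2 \<in> mspace (Md d2)"
  then have u: "u \<in> E \<one>\<^sub>D" and w: "w1 \<in> E d1" "w2 \<in> E d2" by simp_all
  note S = E_S[OF u] E_S[OF w(1)] E_S[OF w(2)]
  show "jacobi (mop (Md d1)) (mop (Md d2)) (mop (seq_copy d3)) ?I u w1 w2"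
    unfolding Md_simps
  proof (rule jacobi_transport[where K = K and ?X1.0 = "vop V" and ?X2.0 = "vop V" and ?X3.0 = "vop V"
        and u = u and ?g1.0 = "\<lambda>v. v" and ?g2.0 = "\<lambda>v. v" and A = "E d1" and B = "E d2" and F = emb
        and R = "E d3"])
    show "jacobi (vop V) (vop V) (vop V) K u w1 w2" by (rule intertwiner_jacobi[OF K w u])
    show "linear_on (E d3) (emb ` E d3) emb" by (rule emb_linear_E)
    show "\<exists>N. \<forall>n\<ge>N. K w1 n w2 = 0" by (rule intertwiner_trunc[OF K w])
    show "\<exists>N. \<forall>n\<ge>N. vop V u n w1 = 0" "\<exists>N. \<forall>n\<ge>N. vop V u n w2 = 0"
      by (rule truncation[OF S(1,2)], rule truncation[OF S(1,3)])
    show "vop V u n w1 \<in> E d1" "vop V u n w2 \<in> E d2" for n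
      using E_one_op u w d by blast+
    show "vop V u n y \<in> E d3" "mop (seq_copy d3) u n (emb y) = emb (vop V u n y)" if "y \<in> E d3" for n y
      using E_one_op[OF d(3) u that] that by (simp_all add: E_S)
    show "vop V u n 0 = 0" for n by (rule op_zero_right[OF S(1)])
    show "K w1 n 0 = 0" for n by (rule linear_on_zero[OF intertwiner_linear_right[OF K w] subspace_E])
    show "K 0 n w2 = 0" for n by (rule linear_on_zero[OF intertwiner_linear_left[OF K w] subspace_E])
    show "?I a r b = 0" if "r \<notin> range of_int" for a b and r :: complex
      using that by (intro complex_modes_non_int) (simp add: Ints_def)
  qed (rule subspace_E refl complex_modes_int intertwiner_in[OF K] w | assumption)+
qed

lemma op_intertwiner:
  assumes "d1 \<in> Ch" "d2 \<in> Ch"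
  shows "intertwiner d1 d2 (d1 \<cdot> d2) (vop V)"
  unfolding intertwiner_def
proof (intro conjI allI ballI)
  show "bilinear_on (E d1) (E d2) (E (d1 \<cdot> d2)) (\<lambda>w1. vop V w1 n)" for n
    by (rule bilinear_E[OF assms])
  fix w1 w2 assume "w1 \<in> E d1" "w2 \<in> E d2"
  note w = E_S[OF this(1)] E_S[OF this(2)]
  show "\<exists>N. \<forall>n\<ge>N. vop V w1 n w2 = 0" by (rule truncation[OF w])
  show "vop V (vop V (conf V) 0 w1) n w2 = - (of_int n *\<^sub>C vop V w1 (n - 1) w2)" for n
    using derivative[OF w] by simp
next
  fix u w1 w2 assume "u \<in> E \<one>\<^sub>D" "w1 \<in> E d1" "w2 \<in> E d2"
  then show "jacobi (vop V) (vop V) (vop V) (vop V) u w1 w2" by (intro jacobi E_S)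
qed

text \<open>
For \<open>h\<close> an automorphism of \<open>U\<close> these are the \<open>U\<close>-homomorphisms from \<open>V(d)\<close> to \<open>V(e)\<close> twisted by
\<open>h\<close>.
\<close>

definition semilinear where
  "semilinear h d e g \<longleftrightarrow> linear_on (E d) (E e) g \<and>
    (\<forall>u\<in>E \<one>\<^sub>D. \<forall>n. \<forall>w\<in>E d. g (vop V u n w) = vop V (h u) n (g w))"

lemma
  assumes "semilinear h d e g"
  shows semilinear_linear: "linear_on (E d) (E e) g"
    and semilinear_op: "u \<in> E \<one>\<^sub>D \<Longrightarrow> w \<in> E d \<Longrightarrow> g (vop V u n w) = vop V (h u) n (g w)"
    and semilinear_in: "w \<in> E d \<Longrightarrow> g w \<in> E e"
  using assms unfolding semilinear_def linear_on_def by simp_all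

text \<open>
The twists by \<open>h\<close> on both factors are undone by \<open>F\<close>, so the composite is an ordinary
intertwining operator.
\<close>

lemma twisted_intertwiner:
  assumes d: "d1 \<in> Ch" "d2 \<in> Ch" "e1 \<in> Ch" "e2 \<in> Ch"
    and h: "\<And>u. u \<in> E \<one>\<^sub>D \<Longrightarrow> h u \<in> E \<one>\<^sub>D" "h (conf V) = conf V"
    and g1: "semilinear h d1 e1 g1" and g2: "semilinear h d2 e2 g2"
    and F: "linear_on (E (e1 \<cdot> e2)) (E d3) F"
    and F_op: "\<And>u n y. u \<in> E \<one>\<^sub>D \<Longrightarrow> y \<in> E (e1 \<cdot> e2) \<Longrightarrow> F (vop V (h u) n y) = vop V u n (F y)"
  shows "intertwiner d1 d2 d3 (\<lambda>w1 n w2. F (vop V (g1 w1) n (g2 w2)))"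
  unfolding intertwiner_def
proof (intro conjI allI ballI)
  note in1 = semilinear_in[OF g1] and in2 = semilinear_in[OF g2]
  have e: "e1 \<cdot> e2 \<in> Ch" using d by simp
  have F0: "F 0 = 0" by (rule linear_on_zero[OF F subspace_E])
  note bil = bilinear_E[OF d(3,4), unfolded bilinear_on_def]
  show "bilinear_on (E d1) (E d2) (E d3) (\<lambda>w1 w2. F (vop V (g1 w1) n (g2 w2)))" for n
    unfolding bilinear_on_def
  proof (intro conjI ballI)
    fix w1 assume w1: "w1 \<in> E d1"
    have "linear_on (E e2) (E (e1 \<cdot> e2)) (vop V (g1 w1) n)" using bil in1[OF w1] by blast
    then show "linear_on (E d2) (E d3) (\<lambda>w2. F (vop V (g1 w1) n (g2 w2)))"
      by (rule linear_on_compose[OF linear_on_compose[OF semilinear_linear[OF g2]] F])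
  next
    fix w2 assume w2: "w2 \<in> E d2"
    have "linear_on (E e1) (E (e1 \<cdot> e2)) (\<lambda>x. vop V x n (g2 w2))" using bil in2[OF w2] by blast
    from linear_on_compose[OF linear_on_compose[OF semilinear_linear[OF g1] this] F]
    show "linear_on (E d1) (E d3) (\<lambda>w1. F (vop V (g1 w1) n (g2 w2)))" .
  qed
  fix w1 w2 assume w: "w1 \<in> E d1" "w2 \<in> E d2"
  note gS = E_S[OF in1[OF w(1)]] E_S[OF in2[OF w(2)]]
  obtain N where "\<forall>n\<ge>N. vop V (g1 w1) n (g2 w2) = 0" using truncation[OF gS] by blast
  then show "\<exists>N. \<forall>n\<ge>N. F (vop V (g1 w1) n (g2 w2)) = 0"
    by (intro exI[of _ N]) (simp add: F0)
  show "F (vop V (g1 (vop V (conf V) 0 w1)) n (g2 w2)) = - (of_int n *\<^sub>C F (vop V (g1 w1) (n - 1)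
      (g2 w2)))" for n
  proof -
    have "vop V (g1 (vop V (conf V) 0 w1)) n (g2 w2) = (- of_int n) *\<^sub>C vop V (g1 w1) (n - 1) (g2 w2)"
      unfolding semilinear_op[OF g1 conf_E w(1)] h(2) using derivative[OF gS, of n] by simp
    then show ?thesis
      using linear_on_scale[OF F E_op[OF in1[OF w(1)] in2[OF w(2)], of "n - 1"], of "- of_int n"]
      by simp
  qed
next
  note in1 = semilinear_in[OF g1] and in2 = semilinear_in[OF g2]
  have e: "e1 \<cdot> e2 \<in> Ch" using d by simp
  fix u w1 w2 assume u: "u \<in> E \<one>\<^sub>D" and w: "w1 \<in> E d1" "w2 \<in> E d2"
  note S = E_S[OF h(1)[OF u]] E_S[OF in1[OF w(1)]] E_S[OF in2[OF w(2)]]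
  show "jacobi (vop V) (vop V) (vop V) (\<lambda>w1 n w2. F (vop V (g1 w1) n (g2 w2))) u w1 w2"
  proof (rule jacobi_transport[where K = "vop V" and ?X1.0 = "vop V" and ?X2.0 = "vop V" and ?X3.0
      = "vop V"
        and u = "h u" and ?g1.0 = g1 and ?g2.0 = g2 and A = "E d1" and B = "E d2" and F = F
        and R = "E (e1 \<cdot> e2)"])
    show "jacobi (vop V) (vop V) (vop V) (vop V) (h u) (g1 w1) (g2 w2)" by (rule jacobi[OF S])
    show "linear_on (E (e1 \<cdot> e2)) (E d3) F" by (rule F)
    show "\<exists>N. \<forall>n\<ge>N. vop V (g1 w1) n (g2 w2) = 0" "\<exists>N. \<forall>n\<ge>N. vop V (h u) n (g1 w1) = 0"
      "\<exists>N. \<forall>n\<ge>N. vop V (h u) n (g2 w2) = 0"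
      by (rule truncation[OF S(2,3)], rule truncation[OF S(1,2)], rule truncation[OF S(1,3)])
    show "vop V u n w1 \<in> E d1" "vop V u n w2 \<in> E d2" for n
      using E_one_op u w d by blast+
    show "g1 (vop V u n w1) = vop V (h u) n (g1 w1)" "g2 (vop V u n w2) = vop V (h u) n (g2 w2)" for n
      by (rule semilinear_op[OF g1 u w(1)], rule semilinear_op[OF g2 u w(2)])
    show "vop V (g1 a) k (g2 b) \<in> E (e1 \<cdot> e2)" if "a \<in> E d1" "b \<in> E d2" for a b k
      by (rule E_op[OF in1[OF that(1)] in2[OF that(2)]])
    show "F (vop V (g1 a) (of_int k) (g2 b)) = F (vop V (g1 a) k (g2 b))" for a b k by simp
    show "F (vop V (g1 a) r (g2 b)) = 0" if "r \<notin> range of_int" for a b r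
      using that rangeI[of of_int r] by simp
    show "vop V (h u) n y \<in> E (e1 \<cdot> e2)" "vop V u n (F y) = F (vop V (h u) n y)"
      if "y \<in> E (e1 \<cdot> e2)" for y n
      using E_one_op[OF e h(1)[OF u] that] F_op[OF u that] by simp_all
    show "vop V (h u) n 0 = 0" "vop V (g1 w1) n 0 = 0" "vop V 0 n (g2 w2) = 0" for n
      by (rule op_zero_right[OF S(1)], rule op_zero_right[OF S(2)], rule op_zero_left[OF S(3)])
  qed (rule subspace_E w)+
qed

end

section \<open>Consequences of the fusion rules\<close>

locale simple_current_orbifold = orbifold +
  assumes fusion: "\<And>d1 d2. \<lbrakk>d1 \<in> Ch; d2 \<in> Ch\<rbrakk> \<Longrightarrow>
    fusion_product U (Md d1) (Md d2) = single_class U (Md (d1 \<cdot> d2))"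
begin

lemma fusion_rule_seq_copy:
  assumes "d1 \<in> Ch" "d2 \<in> Ch" "d3 \<in> Ch" "E d3 \<noteq> {0}"
  shows "fusion_rule U (Md d1) (Md d2) (seq_copy d3) =
    (if module_isomorphic U (Md (d1 \<cdot> d2)) (seq_copy d3) then 1 else 0)"
  using fun_cong[OF fusion[OF assms(1,2)], of "seq_copy d3"] irreducible_seq_copy[OF assms(3,4)]
  by (simp add: fusion_product_def single_class_def)

lemma E_one_nontrivial: "E \<one>\<^sub>D \<noteq> {0}"
  using vac_E vac_nonzero by blast

text \<open>
The fusion rule of \<open>V(d)\<close> and \<open>V(d\<inverse>)\<close> into \<open>V(1)\<close> is 1, but all operators on the zero space
vanish.
\<close>

lemma E_nontrivial:
  assumes d: "d \<in> Ch"
  shows "E d \<noteq> {0}"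
proof
  assume E0: "E d = {0}"
  let ?i = "inv\<^bsub>chars V D\<^esub> d"
  have "fusion_rule U (Md d) (Md ?i) (seq_copy \<one>\<^sub>D) = 1"
    using fusion_rule_seq_copy[OF d Ch.inv_closed[OF d] Ch.one_closed E_one_nontrivial]
        iso_seq_copy[of "\<one>\<^sub>D"] d
    by simp
  moreover have zero: "intertwining_operators U (Md d) (Md ?i) (seq_copy \<one>\<^sub>D) \<subseteq> {0}"
  proof
    fix I assume I: "I \<in> intertwining_operators U (Md d) (Md ?i) (seq_copy \<one>\<^sub>D)"
    have "I w1 r w2 = 0" for w1 r w2
    proof (cases "w1 \<in> E d \<and> w2 \<in> E ?i")
      case True
      then have "linear_on (E d) (mspace (seq_copy \<one>\<^sub>D)) (\<lambda>w1. I w1 r w2)"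
        using I unfolding intertwining_operators_def bilinear_on_def by simp
      from linear_on_zero[OF this subspace_E] show ?thesis using True E0 by simp
    next
      case False
      then show ?thesis using I unfolding intertwining_operators_def by simp
    qed
    then have "I = 0" by (simp add: fun_eq_iff)
    then show "I \<in> {0}" by simp
  qed
  ultimately show False
    using edim_eq_0I[OF zero] unfolding fusion_rule_def by simp
qed

lemma E_nonzero_vector:
  assumes "d \<in> Ch"
  obtains v where "v \<in> E d" "v \<noteq> 0"
  using E_nontrivial[OF assms] E_zero[of d] by blast

lemma intertwiner_iso:
  assumes d: "d1 \<in> Ch" "d2 \<in> Ch" "d3 \<in> Ch" and K: "intertwiner d1 d2 d3 K"
    and nz: "w1 \<in> E d1" "w2 \<in> E d2" "K w1 n w2 \<noteq> 0"
  shows "module_isomorphic U (Md (d1 \<cdot> d2)) (Md d3)"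
proof -
  let ?J = "intertwining_operators U (Md d1) (Md d2) (seq_copy d3)"
  have "complex_modes d1 d2 K w1 (of_int n) w2 \<noteq> 0"
    using emb_eq_0D[OF E_S[OF intertwiner_in[OF K nz(1,2)]]] nz by (auto simp: complex_modes_int)
  then have "complex_modes d1 d2 K \<noteq> 0" by auto
  then have "fusion_rule U (Md d1) (Md d2) (seq_copy d3) \<noteq> 0"
    using edim_eq_0D[of ?J] complex_modes_intertwining_operator[OF d K] unfolding fusion_rule_def
        by blast
  then have "module_isomorphic U (Md (d1 \<cdot> d2)) (seq_copy d3)"
    using fusion_rule_seq_copy[OF d E_nontrivial[OF d(3)]] by (simp split: if_splits)
  then show ?thesis
    by (rule module_isomorphic_trans[OF _ module_isomorphic_sym[OF VOA_module_Md[OF d(3)]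
        iso_seq_copy]])
qed

text \<open>
The fusion rule is 1, and the vertex operator of \<open>V\<close> is a nonzero element of the one-dimensional
space.
\<close>

lemma intertwiner_proportional:
  assumes d: "d1 \<in> Ch" "d2 \<in> Ch" and K: "intertwiner d1 d2 (d1 \<cdot> d2) K"
  shows "\<exists>c. \<forall>w1\<in>E d1. \<forall>n. \<forall>w2\<in>E d2. K w1 n w2 = c *\<^sub>C vop V w1 n w2"
proof -
  have d3: "d1 \<cdot> d2 \<in> Ch" using d by simp
  let ?J = "intertwining_operators U (Md d1) (Md d2) (seq_copy (d1 \<cdot> d2))"
  note Y = op_intertwiner[OF d]
  have one: "edim ?J = 1"
    using fusion_rule_seq_copy[OF d d3 E_nontrivial[OF d3]] iso_seq_copy unfolding fusion_rule_def
        by simp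
  obtain v1 where v1: "v1 \<in> E d1" "v1 \<noteq> 0" using E_nonzero_vector[OF d(1)] by blast
  obtain v2 where v2: "v2 \<in> E d2" "v2 \<noteq> 0" using E_nonzero_vector[OF d(2)] by blast
  obtain n where n: "vop V v1 n v2 \<noteq> 0"
    using op_nonvanishing[OF E_S[OF v1(1)] v1(2) E_S[OF v2(1)] v2(2)] by blast
  have "complex_modes d1 d2 (vop V) v1 (of_int n) v2 \<noteq> 0"
    using emb_eq_0D[OF E_S[OF intertwiner_in[OF Y v1(1) v2(1)]]] n v1 v2 by (auto simp:
        complex_modes_int)
  then have "complex_modes d1 d2 (vop V) \<noteq> 0" by auto
  then obtain c where c: "complex_modes d1 d2 K = c *\<^sub>C complex_modes d1 d2 (vop V)"
    using edim_eq_1D[OF one complex_modes_intertwining_operator[OF d d3 K]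
        complex_modes_intertwining_operator[OF d d3 Y]]
    by blast
  have "K w1 n w2 = c *\<^sub>C vop V w1 n w2" if w: "w1 \<in> E d1" "w2 \<in> E d2" for w1 n w2
  proof -
    have "complex_modes d1 d2 K w1 (of_int n) w2 = c *\<^sub>C complex_modes d1 d2 (vop V) w1 (of_int n) w2"
      unfolding c by (simp add: scaleC_fun_def)
    then have "emb (K w1 n w2) = emb (c *\<^sub>C vop V w1 n w2)"
      unfolding complex_modes_int[OF w] using emb_scale[OF E_S[OF intertwiner_in[OF Y w]]] by simp
    then show ?thesis
      by (rule inj_onD[OF emb_inj])
        (auto intro: E_S[OF intertwiner_in[OF K w]] E_S[OF E_scale[OF intertwiner_in[OF Y w]]])
  qed
  then show ?thesis by blast
qed

end

section \<open>The eigenspaces are pairwise non-isomorphic\<close>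

context orbifold
begin

lemma semilinear_id: "semilinear (\<lambda>u. u) d d (\<lambda>w. w)"
  by (simp add: semilinear_def linear_on_def)

lemma linear_eq_on_eigenspaces:
  assumes f: "linear_on S T f" and g: "linear_on S T' g"
    and eq: "\<And>d v. d \<in> Ch \<Longrightarrow> v \<in> E d \<Longrightarrow> f v = g v" and v: "v \<in> S"
  shows "f v = g v"
proof -
  have f_sum: "f (\<Sum>d\<in>Ch. proj d v) = (\<Sum>d\<in>Ch. f (proj d v))"
    by (rule linear_on_sum[OF f subspace proj_S[OF v]])
  have g_sum: "g (\<Sum>d\<in>Ch. proj d v) = (\<Sum>d\<in>Ch. g (proj d v))"
    by (rule linear_on_sum[OF g subspace proj_S[OF v]])
  have "(\<Sum>d\<in>Ch. f (proj d v)) = (\<Sum>d\<in>Ch. g (proj d v))"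
    by (rule sum.cong[OF refl]) (rule eq[OF _ proj_in_E[OF _ v]])
  then show ?thesis using f_sum g_sum by (simp add: sum_proj[OF v])
qed

text \<open>
If \<open>L(-1) u = 0\<close>, then \<open>u\<close> has no mode besides \<open>u\<^sub>-\<^sub>1\<close>, and by the commutator formula \<open>u\<^sub>-\<^sub>1\<close> is
an endomorphism of the irreducible module \<open>V\<close>.  It has an eigenvector in the finite-dimensional
space of weight 0, so it is a scalar \<open>c\<close>, and \<open>u = u\<^sub>-\<^sub>1 1 = c 1\<close>.
\<close>

lemma translation_invariant_vector:
  assumes u: "u \<in> S" and L: "vop V (conf V) 0 u = 0"
  shows "\<exists>c. u = c *\<^sub>C vac V"
proof -
  have mode_zero: "vop V u n v = 0" if v: "v \<in> S" and n: "n \<noteq> - 1" for n v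
  proof -
    have "vop V (vop V (conf V) 0 u) (n + 1) v = 0" unfolding L by (rule op_zero_left[OF v])
    then have "of_int (n + 1) *\<^sub>C vop V u n v = 0"
      using derivative[OF u v, of "n + 1"] by simp
    moreover have "(of_int (n + 1) :: complex) \<noteq> 0"
      using n by (metis add_eq_0_iff of_int_eq_0_iff add.commute)
    ultimately show ?thesis by simp
  qed
  have commute: "vop V v n (vop V u (- 1) w) = vop V u (- 1) (vop V v n w)"
    if v: "v \<in> S" and w: "w \<in> S" for v w n
  proof -
    let ?L = "\<lambda>i::nat. ((- 1) ^ i * (of_int 0 gchoose i)) *\<^sub>C
          (vop V u (- 1 + 0 - int i) (vop V v (n + of_nat i) w)
           - ((- 1) powi 0) *\<^sub>C vop V v (n + of_int 0 - of_nat i) (vop V u (- 1 + int i) w))"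
    have "Sum_any ?L = Sum_any (\<lambda>i::nat. (of_int (- 1) gchoose i) *\<^sub>C
          vop V (vop V u (0 + int i) v) (of_int (- 1) + n - of_nat i) w)"
      by (rule jacobi[OF u v w, unfolded jacobi_def, rule_format])
    also have "\<dots> = Sum_any (\<lambda>i::nat. 0)"
      by (rule Sum_any.cong) (simp add: mode_zero[OF v] op_zero_left[OF w])
    finally have "Sum_any ?L = 0" by simp
    moreover have "Sum_any ?L = ?L 0"
      by (rule Sum_any_only_0) (simp add: gbinomial_0_left)
    ultimately have "?L 0 = 0" by (rule trans[OF sym, rotated])
    then show ?thesis by simp
  qed
  \<comment> \<open>The commutator with \<open>L(0)\<close> shows that \<open>u\<^sub>-\<^sub>1\<close> preserves the space of weight 0, which
    contains the vacuum.\<close>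
  let ?Z = "weight_space V (adjoint V) 0"
  let ?T = "vop V u (- 1)"
  have Z: "w \<in> ?Z \<longleftrightarrow> w \<in> S \<and> vop V (conf V) 1 w = 0" for w
    by (simp add: weight_space_def adjoint_def)
  have fdZ: "fin_dim ?Z" using grading_fin_dim[of 0] by simp
  have subZ: "cvec.subspace ?Z"
    by (rule cvec.subspaceI)
      (simp_all add: Z cvec.subspace_0[OF subspace] cvec.subspace_add[OF subspace]
        cvec.subspace_scale[OF subspace] op_zero_right op_add_right op_scale_right conf_in)
  have "linear_on ?Z ?Z ?T"
  proof (rule linear_on_subset[OF linear_op_right[OF u]])
    show "?T w \<in> ?Z" if "w \<in> ?Z" for w
      using that commute[OF conf_in, of w 1] by (simp add: Z op_in u op_zero_right)
  qed (auto simp: Z)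
  moreover have "vac V \<in> ?Z" using creation(2)[OF conf_in, of 1] by (simp add: Z vac_in)
  ultimately obtain w c where w: "w \<in> ?Z" "w \<noteq> 0" "?T w = c *\<^sub>C w"
    using eigenvector_exists[OF subZ fdZ _ _ vac_nonzero] by blast
  let ?N = "{x \<in> S. ?T x = c *\<^sub>C x}"
  have "cvec.subspace ?N"
    by (rule cvec.subspaceI)
      (simp_all add: cvec.subspace_0[OF subspace] cvec.subspace_add[OF subspace]
        cvec.subspace_scale[OF subspace] op_zero_right op_add_right op_scale_right u
        cvec.scale_right_distrib cvec.scale_left_commute)
  moreover have "vop V v n x \<in> ?N" if v: "v \<in> S" and x: "x \<in> ?N" for v n x
    using x commute[OF v, of x n] by (simp add: op_in v op_scale_right)
  ultimately have "submodule_of V (adjoint V) ?N"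
    unfolding submodule_of_def adjoint_def by simp
  then have "?N = {0} \<or> ?N = S" by (rule submodule_trivial)
  moreover have "w \<in> ?N" using w by (simp add: Z)
  ultimately have "?N = S" using w(2) by blast
  then have "vac V \<in> ?N" using vac_in by simp
  then have "u = c *\<^sub>C vac V" using creation(1)[OF u] by simp
  then show ?thesis by blast
qed

lemma isomorphic_to_fixed_algebra:
  assumes d: "d \<in> Ch" and iso: "module_isomorphic U (Md \<one>\<^sub>D) (Md d)"
  shows "d = \<one>\<^sub>D"
proof (rule ccontr)
  assume ne: "d \<noteq> \<one>\<^sub>D"
  obtain f where f: "linear_on (E \<one>\<^sub>D) (E d) f" "bij_betw f (E \<one>\<^sub>D) (E d)"
    "\<And>v n w. v \<in> E \<one>\<^sub>D \<Longrightarrow> w \<in> E \<one>\<^sub>D \<Longrightarrow> f (vop V v n w) = vop V v n (f w)"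
    using iso unfolding module_isomorphic_def by auto
  let ?u = "f (vac V)"
  have u: "?u \<in> E d" by (rule linear_on_in[OF f(1) vac_E])
  have f0: "f 0 = 0" by (rule linear_on_zero[OF f(1) subspace_E])
  have "vop V (conf V) 0 ?u = f (vop V (conf V) 0 (vac V))"
    by (rule f(3)[OF conf_E vac_E, symmetric])
  also have "\<dots> = 0" using creation(2)[OF conf_in, of 0] f0 by simp
  finally obtain c where "?u = c *\<^sub>C vac V"
    using translation_invariant_vector[OF E_S[OF u]] by blast
  then have "?u \<in> E \<one>\<^sub>D" using E_scale[OF vac_E] by simp
  then have "f (vac V) = f 0" using E_disjoint[OF d Ch.one_closed ne u] f0 by simp
  then have "vac V = 0"
    using f(2) vac_E E_zero[of "\<one>\<^sub>D"] unfolding bij_betw_def by (blast dest: inj_onD)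
  then show False using vac_nonzero by contradiction
qed

lemma module_isomorphic_iff_semilinear:
  "module_isomorphic U (Md d) (Md e) \<longleftrightarrow>
    (\<exists>f. semilinear (\<lambda>u. u) d e f \<and> bij_betw f (E d) (E e))"
  unfolding module_isomorphic_def semilinear_def by auto

end

context simple_current_orbifold
begin

text \<open>
Composing the vertex operator on \<open>V(d\<inverse>)\<close> and \<open>V(d)\<close> with an isomorphism \<open>f\<close> from \<open>V(d)\<close> to
\<open>V(e)\<close> gives a nonzero operator into \<open>V(d\<inverse>e)\<close>, which is therefore isomorphic to \<open>V(1)\<close>.
\<close>

lemma eigenmodules_distinct:
  assumes d: "d \<in> Ch" and e: "e \<in> Ch" and iso: "module_isomorphic U (Md d) (Md e)"
  shows "d = e"
proof -
  obtain f where f: "semilinear (\<lambda>u. u) d e f" "bij_betw f (E d) (E e)"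
    using iso unfolding module_isomorphic_iff_semilinear by blast
  let ?i = "inv\<^bsub>chars V D\<^esub> d"
  have i: "?i \<in> Ch" using d by simp
  have ie: "?i \<cdot> e \<in> Ch" using i e by simp
  have K: "intertwiner ?i d (?i \<cdot> e) (\<lambda>w1 n w2. vop V w1 n (f w2))"
    by (rule twisted_intertwiner[where F = "\<lambda>x. x", OF i d i e _ _ semilinear_id f(1)])
      (simp_all add: linear_on_def)
  obtain v where v: "v \<in> E ?i" "v \<noteq> 0" using E_nonzero_vector[OF i] by blast
  obtain w where w: "w \<in> E d" "w \<noteq> 0" using E_nonzero_vector[OF d] by blast
  have fw: "f w \<in> E e" by (rule semilinear_in[OF f(1) w(1)])
  have "f w \<noteq> 0"
  proof
    assume "f w = 0"
    then have "f w = f 0" using linear_on_zero[OF semilinear_linear[OF f(1)] subspace_E] by simp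
    then have "w = 0"
      using f(2) w(1) E_zero[of d] unfolding bij_betw_def by (blast dest: inj_onD)
    with w(2) show False by contradiction
  qed
  then obtain n where "vop V v n (f w) \<noteq> 0"
    using op_nonvanishing[OF E_S[OF v(1)] v(2) E_S[OF fw]] by blast
  then have "module_isomorphic U (Md (?i \<cdot> d)) (Md (?i \<cdot> e))"
    by (rule intertwiner_iso[OF i d ie K v(1) w(1)])
  then have "?i \<cdot> e = \<one>\<^sub>D"
    using isomorphic_to_fixed_algebra[OF ie] d by simp
  moreover have "d \<cdot> (?i \<cdot> e) = e" using Ch.m_assoc[OF d i e] d e by simp
  ultimately show ?thesis using d by simp
qed

lemma intertwiner_target:
  assumes "d1 \<in> Ch" "d2 \<in> Ch" "d3 \<in> Ch" "intertwiner d1 d2 d3 K"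
    and "w1 \<in> E d1" "w2 \<in> E d2" "K w1 n w2 \<noteq> 0"
  shows "d3 = d1 \<cdot> d2"
  using eigenmodules_distinct[OF _ assms(3) intertwiner_iso[OF assms]] assms(1,2) by simp

end

section \<open>The normalizer acts on the eigenspaces\<close>

context orbifold
begin

sublocale A: group "Aut V"
  by (rule group_Aut)

lemma Aut_eqI:
  assumes "f \<in> carrier (Aut V)" "g \<in> carrier (Aut V)" "\<And>v. v \<in> S \<Longrightarrow> f v = g v"
  shows "f = g"
  by (rule extensionalityI[OF Aut_ext[OF assms(1)] Aut_ext[OF assms(2)] assms(3)])

lemma Aut_mult_apply:
  assumes "f \<in> carrier (Aut V)" "g \<in> carrier (Aut V)" "v \<in> S"
  shows "(f \<otimes>\<^bsub>Aut V\<^esub> g) v = f (g v)"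
  using assms by (simp add: Aut_mult compose_eq)

lemma Aut_inv_apply:
  assumes "g \<in> carrier (Aut V)" "v \<in> S"
  shows "(inv\<^bsub>Aut V\<^esub> g) (g v) = v" "g ((inv\<^bsub>Aut V\<^esub> g) v) = v"
  using Aut_mult_apply[of "inv\<^bsub>Aut V\<^esub> g" g v] Aut_mult_apply[of g "inv\<^bsub>Aut V\<^esub> g" v] assms
  by (simp_all add: Aut_one)

lemma normalizer_eq:
  "normalizer (Aut V) D =
    {g \<in> carrier (Aut V). (\<lambda>b. g \<otimes>\<^bsub>Aut V\<^esub> b \<otimes>\<^bsub>Aut V\<^esub> inv\<^bsub>Aut V\<^esub> g) ` D = D}"
proof -
  have "g <#\<^bsub>Aut V\<^esub> D #>\<^bsub>Aut V\<^esub> x = (\<lambda>b. g \<otimes>\<^bsub>Aut V\<^esub> b \<otimes>\<^bsub>Aut V\<^esub> x) ` D" for g x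
    unfolding l_coset_def r_coset_def by blast
  then show ?thesis
    using subgroup.subset[OF D_subgroup] by (simp add: normalizer_def stabilizer_def)
qed

text \<open>
As \<open>D\<close> is finite, conjugation by \<open>g\<close> maps \<open>D\<close> onto itself as soon as it maps \<open>D\<close> into itself.
\<close>

lemma normalizer_iff:
  "g \<in> normalizer (Aut V) D \<longleftrightarrow>
    g \<in> carrier (Aut V) \<and> (\<forall>b\<in>D. \<exists>b'\<in>D. \<forall>v\<in>S. g (b v) = b' (g v))"
  (is "_ \<longleftrightarrow> ?R")
proof -
  let ?c = "\<lambda>g b. g \<otimes>\<^bsub>Aut V\<^esub> b \<otimes>\<^bsub>Aut V\<^esub> inv\<^bsub>Aut V\<^esub> g"
  have conj: "?c g b = b' \<longleftrightarrow> (\<forall>v\<in>S. g (b v) = b' (g v))"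
    if g: "g \<in> carrier (Aut V)" and b: "b \<in> D" and b': "b' \<in> carrier (Aut V)" for b b'
  proof -
    note bA = D_Aut[OF b]
    have "?c g b = b' \<longleftrightarrow> g \<otimes>\<^bsub>Aut V\<^esub> b = b' \<otimes>\<^bsub>Aut V\<^esub> g"
      using A.inv_solve_right[of b' "g \<otimes>\<^bsub>Aut V\<^esub> b" g] g bA b' by auto
    also have "\<dots> \<longleftrightarrow> (\<forall>v\<in>S. g (b v) = b' (g v))"
      using Aut_eqI[of "g \<otimes>\<^bsub>Aut V\<^esub> b" "b' \<otimes>\<^bsub>Aut V\<^esub> g"] Aut_mult_apply[OF g bA]
        Aut_mult_apply[OF b' g] g bA b' by auto
    finally show ?thesis .
  qed
  show ?thesis
  proof
    assume g: "g \<in> normalizer (Aut V) D"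
    then have gA: "g \<in> carrier (Aut V)" and im: "?c g ` D = D" by (auto simp: normalizer_eq)
    have "\<exists>b'\<in>D. \<forall>v\<in>S. g (b v) = b' (g v)" if b: "b \<in> D" for b
    proof -
      have "?c g b \<in> D" using im b by blast
      then show ?thesis using conj[OF gA b, of "?c g b"] D_Aut by blast
    qed
    then show ?R using gA by blast
  next
    assume R: ?R
    then have gA: "g \<in> carrier (Aut V)" by blast
    have "?c g ` D \<subseteq> D"
    proof
      fix x assume "x \<in> ?c g ` D"
      then obtain b where b: "b \<in> D" "x = ?c g b" by blast
      then obtain b' where b': "b' \<in> D" "\<forall>v\<in>S. g (b v) = b' (g v)" using R by blast
      then have "?c g b = b'" using conj[OF gA b(1) D_Aut[OF b'(1)]] by simp
      then show "x \<in> D" using b b' by simp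
    qed
    moreover have "inj_on (?c g) D"
      using gA D_Aut by (auto intro!: inj_onI)
    ultimately have "?c g ` D = D" by (rule endo_inj_surj[OF D_finite])
    then show "g \<in> normalizer (Aut V) D" using gA by (simp add: normalizer_eq)
  qed
qed

lemma normalizer_subgroup: "subgroup (normalizer (Aut V) D) (Aut V)"
  by (rule A.normalizer_imp_subgroup[OF subgroup.subset[OF D_subgroup]])

lemma normalizer_Aut: "g \<in> normalizer (Aut V) D \<Longrightarrow> g \<in> carrier (Aut V)"
  by (simp add: normalizer_iff)

lemma normalizer_inv: "g \<in> normalizer (Aut V) D \<Longrightarrow> inv\<^bsub>Aut V\<^esub> g \<in> normalizer (Aut V) D"
  by (rule subgroup.m_inv_closed[OF normalizer_subgroup])

end

context simple_current_orbifold
begin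

text \<open>
The image of a simultaneous eigenvector of \<open>D\<close> is one again, and its character depends only on
\<open>d\<close> and on the action of \<open>g\<close> on \<open>D\<close>.
\<close>

lemma normalizer_maps_eigenspace:
  assumes g: "g \<in> normalizer (Aut V) D" and d: "d \<in> Ch"
  shows "\<exists>e\<in>Ch. g ` E d \<subseteq> E e"
proof -
  note gA = normalizer_Aut[OF g]
  note lin = Aut_linear[OF gA]
  have "\<forall>b'\<in>D. \<exists>b\<in>D. \<forall>v\<in>S. g (b v) = b' (g v)"
  proof
    fix b' assume "b' \<in> D"
    then obtain b where b: "b \<in> D" "\<And>v. v \<in> S \<Longrightarrow> (inv\<^bsub>Aut V\<^esub> g) (b' v) = b ((inv\<^bsub>Aut V\<^esub> g) v)"
      using normalizer_inv[OF g] unfolding normalizer_iff by blast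
    have "g (b v) = b' (g v)" if v: "v \<in> S" for v
      using b(2)[OF Aut_in[OF gA v]] Aut_inv_apply[OF gA] v D_in[OF \<open>b' \<in> D\<close> Aut_in[OF gA v]] by metis
    then show "\<exists>b\<in>D. \<forall>v\<in>S. g (b v) = b' (g v)" using b(1) by blast
  qed
  then obtain p where p: "\<And>b'. b' \<in> D \<Longrightarrow> p b' \<in> D" "\<And>b' v. b' \<in> D \<Longrightarrow> v \<in> S \<Longrightarrow> g (p b' v) = b' (g v)"
    by metis
  have act: "b' (g w) = d (p b') *\<^sub>C g w" if "b' \<in> D" "w \<in> E d" for b' w
  proof -
    have "b' (g w) = g (p b' w)" using p(2)[OF that(1) E_S[OF that(2)]] by simp
    also have "\<dots> = g (d (p b') *\<^sub>C w)" using E_eigen[OF that(2) p(1)[OF that(1)]] by simp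
    also have "\<dots> = d (p b') *\<^sub>C g w" by (rule linear_on_scale[OF lin E_S[OF that(2)]])
    finally show ?thesis .
  qed
  obtain v where v: "v \<in> E d" "v \<noteq> 0" using E_nonzero_vector[OF d] by blast
  have gv: "g v \<in> S" by (rule Aut_in[OF gA E_S[OF v(1)]])
  have gv0: "g v \<noteq> 0"
  proof
    assume "g v = 0"
    then have "g v = g 0" using linear_on_zero[OF lin subspace] by simp
    then show False
      using inj_onD[OF bij_betw_imp_inj_on[OF Aut_bij[OF gA]] _ E_S[OF v(1)] cvec.subspace_0[OF
          subspace]] v(2)
      by simp
  qed
  obtain e where e: "e \<in> Ch" "g v \<in> E e"
    using simultaneous_eigenvector_character[OF gv gv0] act[OF _ v(1)] by blast
  have "e b' = d (p b')" if "b' \<in> D" for b'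
    using E_eigen[OF e(2) that] act[OF that v(1)] gv0 by simp
  then have "g w \<in> E e" if "w \<in> E d" for w
    using act[OF _ that] Aut_in[OF gA E_S[OF that]] by (simp add: E_iff)
  then show ?thesis using e(1) by blast
qed

lemma normalizer_eigenspace_image:
  assumes g: "g \<in> normalizer (Aut V) D" and d: "d \<in> Ch"
  shows "\<exists>e\<in>Ch. g ` E d = E e"
proof -
  note gA = normalizer_Aut[OF g]
  let ?i = "inv\<^bsub>Aut V\<^esub> g"
  obtain e where e: "e \<in> Ch" "g ` E d \<subseteq> E e" using normalizer_maps_eigenspace[OF g d] by blast
  obtain d' where d': "d' \<in> Ch" "?i ` E e \<subseteq> E d'"
    using normalizer_maps_eigenspace[OF normalizer_inv[OF g] e(1)] by blast
  obtain v where v: "v \<in> E d" "v \<noteq> 0" using E_nonzero_vector[OF d] by blast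
  have "?i (g v) \<in> E d'" using v(1) e(2) d'(2) by blast
  then have "v \<in> E d'" using Aut_inv_apply(1)[OF gA E_S[OF v(1)]] by simp
  then have dd: "d' = d" using E_disjoint[OF d d'(1) _ v(1)] v(2) by blast
  have "E e \<subseteq> g ` E d"
  proof
    fix w assume w: "w \<in> E e"
    have "?i w \<in> E d" using w d'(2) dd by blast
    moreover have "w = g (?i w)" using Aut_inv_apply(2)[OF gA E_S[OF w]] by simp
    ultimately show "w \<in> g ` E d" by blast
  qed
  then show ?thesis using e by blast
qed

lemma normalizer_eigenspace_preimage:
  assumes g: "g \<in> normalizer (Aut V) D" and e: "e \<in> Ch"
  shows "\<exists>d\<in>Ch. g ` E d = E e"
proof -
  note gA = normalizer_Aut[OF g]
  let ?i = "inv\<^bsub>Aut V\<^esub> g"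
  obtain d where d: "d \<in> Ch" "?i ` E e = E d"
    using normalizer_eigenspace_image[OF normalizer_inv[OF g] e] by blast
  have "g ` E d = (\<lambda>w. g (?i w)) ` E e" unfolding d(2)[symmetric] by (rule image_image)
  also have "\<dots> = E e" using Aut_inv_apply(2)[OF gA E_S] by simp
  finally show ?thesis using d(1) by blast
qed

lemma normalizer_fixed_algebra:
  assumes g: "g \<in> normalizer (Aut V) D"
  shows "g ` E \<one>\<^sub>D = E \<one>\<^sub>D"
proof -
  obtain e where e: "e \<in> Ch" "g ` E \<one>\<^sub>D = E e"
    using normalizer_eigenspace_image[OF g Ch.one_closed] by blast
  have "g (vac V) \<in> E e" using e(2) vac_E by blast
  then have "vac V \<in> E e" using Aut_vac[OF normalizer_Aut[OF g]] by simp
  then have "e = \<one>\<^sub>D" using E_disjoint[OF e(1) Ch.one_closed _ _ vac_E] vac_nonzero by blast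
  then show ?thesis using e(2) by simp
qed

section \<open>The restriction homomorphism\<close>

lemma restriction_in_Aut:
  assumes g: "g \<in> normalizer (Aut V) D"
  shows "restriction_map V D g \<in> carrier (Aut U)"
proof -
  note gA = normalizer_Aut[OF g]
  note im = normalizer_fixed_algebra[OF g]
  have gE: "g u \<in> E \<one>\<^sub>D" if "u \<in> E \<one>\<^sub>D" for u using im that by blast
  have "inj_on g (E \<one>\<^sub>D)"
    by (rule inj_on_subset[OF bij_betw_imp_inj_on[OF Aut_bij[OF gA]] E_sub])
  then have bij: "bij_betw (restrict g (E \<one>\<^sub>D)) (E \<one>\<^sub>D) (E \<one>\<^sub>D)"
    using im by (simp add: bij_betw_def inj_on_restrict_eq)
  have lin: "linear_on (E \<one>\<^sub>D) (E \<one>\<^sub>D) (restrict g (E \<one>\<^sub>D))"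
    by (rule linear_onI)
      (simp_all add: gE E_add E_scale linear_on_add[OF Aut_linear[OF gA]]
        linear_on_scale[OF Aut_linear[OF gA]] E_S)
  show ?thesis
    unfolding Aut_carrier restriction_map_def fixed_simps
    using bij lin E_one_op[OF Ch.one_closed]
    by (simp add: Aut_op[OF gA] E_S conf_E Aut_conf[OF gA])
qed

lemma iso_class_eqI:
  assumes M: "VOA_module U M" and iso: "module_isomorphic U M N"
  shows "iso_class U M = iso_class U N"
  unfolding iso_class_def
  using module_isomorphic_trans[OF iso] module_isomorphic_trans[OF module_isomorphic_sym[OF M iso]]
  by blast

text \<open>
The map \<open>g\<close> itself is the isomorphism from \<open>V(d)\<close> to the twist of \<open>V(e)\<close>.
\<close>

lemma restriction_twists:
  assumes g: "g \<in> normalizer (Aut V) D" and d: "d \<in> Ch" and e: "g ` E d = E e"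
  shows "iso_class U (twist (Md e) (restriction_map V D g)) = iso_class U (Md d)"
proof -
  note gA = normalizer_Aut[OF g]
  have "module_isomorphic U (Md d) (twist (Md e) (restriction_map V D g))"
    unfolding module_isomorphic_def
  proof (intro exI[of _ g] conjI ballI allI)
    show "linear_on (mspace (Md d)) (mspace (twist (Md e) (restriction_map V D g))) g"
      using e by (auto simp: twist_def intro: linear_on_subset[OF Aut_linear[OF gA] E_sub])
    show "bij_betw g (mspace (Md d)) (mspace (twist (Md e) (restriction_map V D g)))"
      using e inj_on_subset[OF bij_betw_imp_inj_on[OF Aut_bij[OF gA]] E_sub]
      by (simp add: twist_def bij_betw_def)
  qed (simp add: twist_def restriction_map_def Aut_op[OF gA] E_S)
  from iso_class_eqI[OF VOA_module_Md[OF d] this] show ?thesis by simp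
qed

lemma restriction_in_H:
  assumes g: "g \<in> normalizer (Aut V) D"
  shows "restriction_map V D g \<in> carrier (H_group V D)"
proof -
  let ?h = "restriction_map V D g"
  have "iso_class U (twist (Md e) ?h) \<in> (\<lambda>d. iso_class U (Md d)) ` Ch" if "e \<in> Ch" for e
  proof -
    obtain d where "d \<in> Ch" "g ` E d = E e" using normalizer_eigenspace_preimage[OF g \<open>e \<in> Ch\<close>] by blast
    then show ?thesis using restriction_twists[OF g] by blast
  qed
  moreover have "iso_class U (Md d) \<in> (\<lambda>d. iso_class U (twist (Md d) ?h)) ` Ch" if d: "d \<in> Ch" for d
  proof -
    obtain e where e: "e \<in> Ch" "g ` E d = E e" using normalizer_eigenspace_image[OF g d] by blast
    show ?thesis using restriction_twists[OF g d e(2)] e(1) by blast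
  qed
  ultimately show ?thesis
    unfolding H_group_def using restriction_in_Aut[OF g] by auto
qed

lemma H_group_mult:
  assumes "h \<in> carrier (H_group V D)" "k \<in> carrier (H_group V D)"
  shows "h \<otimes>\<^bsub>H_group V D\<^esub> k = compose (E \<one>\<^sub>D) h k"
  using assms Aut_mult[of h U k] by (simp add: H_group_def)

lemma restriction_hom: "restriction_map V D \<in> hom (normalizer_group V D) (H_group V D)"
proof (rule homI)
  fix g k assume "g \<in> carrier (normalizer_group V D)" "k \<in> carrier (normalizer_group V D)"
  then have g: "g \<in> normalizer (Aut V) D" and k: "k \<in> normalizer (Aut V) D"
    by (simp_all add: normalizer_group_def)
  show "restriction_map V D g \<in> carrier (H_group V D)" by (rule restriction_in_H[OF g])
  have "restriction_map V D (g \<otimes>\<^bsub>Aut V\<^esub> k) = compose (E \<one>\<^sub>D) (restriction_map V D g)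
      (restriction_map V D k)"
  proof (rule extensionalityI[of _ "E \<one>\<^sub>D"])
    fix u assume u: "u \<in> E \<one>\<^sub>D"
    have "k u \<in> E \<one>\<^sub>D" using normalizer_fixed_algebra[OF k] u by blast
    then show "restriction_map V D (g \<otimes>\<^bsub>Aut V\<^esub> k) u = compose (E \<one>\<^sub>D) (restriction_map V D g)
        (restriction_map V D k) u"
      using u Aut_mult_apply[OF normalizer_Aut[OF g] normalizer_Aut[OF k] E_S[OF u]]
      by (simp add: restriction_map_def compose_eq)
  qed (simp_all add: restriction_map_def)
  then show "restriction_map V D (g \<otimes>\<^bsub>normalizer_group V D\<^esub> k) =
      restriction_map V D g \<otimes>\<^bsub>H_group V D\<^esub> restriction_map V D k"
    using H_group_mult[OF restriction_in_H[OF g] restriction_in_H[OF k]]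
    by (simp add: normalizer_group_def)
qed

lemma D_in_normalizer: "b \<in> D \<Longrightarrow> b \<in> normalizer (Aut V) D"
  unfolding normalizer_iff using D_Aut D_commute by blast

text \<open>
On every \<open>V(d)\<close>, \<open>g\<close> is a \<open>U\<close>-homomorphism and hence a scalar; products show that the scalars
form a character of the dual group of \<open>D\<close>, which is evaluation at an element of \<open>D\<close>.
\<close>

lemma trivial_restriction_in_D:
  assumes g: "g \<in> normalizer (Aut V) D" and fixes_U: "\<And>u. u \<in> E \<one>\<^sub>D \<Longrightarrow> g u = u"
  shows "g \<in> D"
proof -
  note gA = normalizer_Aut[OF g]
  have "\<exists>c. \<forall>w\<in>E d. g w = c *\<^sub>C w" if d: "d \<in> Ch" for d
  proof -
    obtain e where e: "e \<in> Ch" "g ` E d = E e" using normalizer_eigenspace_image[OF g d] by blast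
    have sl: "semilinear (\<lambda>u. u) d e g"
      unfolding semilinear_def
    proof (intro conjI ballI allI)
      show "linear_on (E d) (E e) g"
        using e(2) by (auto intro: linear_on_subset[OF Aut_linear[OF gA] E_sub])
    qed (simp add: Aut_op[OF gA] E_S fixes_U)
    have "bij_betw g (E d) (E e)"
      using e(2) inj_on_subset[OF bij_betw_imp_inj_on[OF Aut_bij[OF gA]] E_sub] by (simp add:
          bij_betw_def)
    then have de: "e = d"
      using eigenmodules_distinct[OF d e(1)] sl unfolding module_isomorphic_iff_semilinear by blast
    have "intertwiner \<one>\<^sub>D d (\<one>\<^sub>D \<cdot> d) (\<lambda>w1 n w2. g (vop V w1 n w2))"
    proof (rule twisted_intertwiner[OF Ch.one_closed d Ch.one_closed d _ _ semilinear_id semilinear_id])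
      show "linear_on (E (\<one>\<^sub>D \<cdot> d)) (E (\<one>\<^sub>D \<cdot> d)) g" using semilinear_linear[OF sl] de d by simp
      show "g (vop V u n y) = vop V u n (g y)" if "u \<in> E \<one>\<^sub>D" "y \<in> E (\<one>\<^sub>D \<cdot> d)" for u n y
        using semilinear_op[OF sl that(1)] that(2) d by simp
    qed simp_all
    then obtain c where c: "\<forall>w1\<in>E \<one>\<^sub>D. \<forall>n. \<forall>w2\<in>E d. g (vop V w1 n w2) = c *\<^sub>C vop V w1 n w2"
      using intertwiner_proportional[OF Ch.one_closed d] by blast
    have "g w = c *\<^sub>C w" if "w \<in> E d" for w
      using c[rule_format, OF vac_E that, of "- 1"] vacuum[OF E_S[OF that], of "- 1"] by simp
    then show ?thesis by blast
  qed
  then obtain l where l: "\<And>d w. d \<in> Ch \<Longrightarrow> w \<in> E d \<Longrightarrow> g w = l d *\<^sub>C w" by metis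
  have "\<exists>b\<in>D. \<forall>d\<in>Ch. l d = d b"
  proof (rule double_dual_evaluation[OF D_group D_finite])
    show "l \<one>\<^sub>D \<noteq> 0"
      using l[OF Ch.one_closed vac_E] fixes_U[OF vac_E] vac_nonzero by auto
    fix d e assume d: "d \<in> Ch" and e: "e \<in> Ch"
    obtain v where v: "v \<in> E d" "v \<noteq> 0" using E_nonzero_vector[OF d] by blast
    obtain w where w: "w \<in> E e" "w \<noteq> 0" using E_nonzero_vector[OF e] by blast
    note S = E_S[OF v(1)] E_S[OF w(1)]
    obtain n where n: "vop V v n w \<noteq> 0" using op_nonvanishing[OF S(1) v(2) S(2) w(2)] by blast
    have "l (d \<cdot> e) *\<^sub>C vop V v n w = g (vop V v n w)"
      using l[OF Ch.m_closed[OF d e] E_op[OF v(1) w(1)]] by simp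
    also have "\<dots> = (l d * l e) *\<^sub>C vop V v n w"
      using Aut_op[OF gA S] l[OF d v(1)] l[OF e w(1)]
      by (simp add: op_scale_left op_scale_right S cvec.subspace_scale[OF subspace] scaleC_scaleC)
    finally show "l (d \<cdot> e) = l d * l e" using n by simp
  qed
  then obtain b where b: "b \<in> D" "\<And>d. d \<in> Ch \<Longrightarrow> l d = d b" by blast
  have "g v = b v" if "v \<in> S" for v
    using Aut_linear[OF gA] Aut_linear[OF D_Aut[OF b(1)]] _ that
    by (rule linear_eq_on_eigenspaces) (simp add: l b E_eigen)
  then have "g = b" by (rule Aut_eqI[OF gA D_Aut[OF b(1)]])
  then show ?thesis using b(1) by simp
qed

lemma restriction_kernel:
  "kernel (normalizer_group V D) (H_group V D) (restriction_map V D) = D"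
proof -
  have one: "\<one>\<^bsub>H_group V D\<^esub> = (\<lambda>u\<in>E \<one>\<^sub>D. u)" by (simp add: H_group_def Aut_one)
  have triv: "restriction_map V D g = (\<lambda>u\<in>E \<one>\<^sub>D. u) \<longleftrightarrow> (\<forall>u\<in>E \<one>\<^sub>D. g u = u)" for g
    by (auto simp: restriction_map_def fun_eq_iff)
  have "b \<in> D \<Longrightarrow> u \<in> E \<one>\<^sub>D \<Longrightarrow> b u = u" for b u
    using E_eigen[of u "\<one>\<^sub>D" b] by (simp add: char_group_one scaleC_one)
  then show ?thesis
    unfolding kernel_def one triv
    using trivial_restriction_in_D D_in_normalizer by (auto simp: normalizer_group_def)
qed

end

section \<open>Lifting automorphisms of the fixed-point algebra\<close>

context VOA
begin

text \<open>
Commutativity on the vacuum: the Jacobi identity for \<open>v\<close>, \<open>w\<close> and the vacuum at \<open>r = -1\<close>, where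
only \<open>w\<^sub>-\<^sub>1 1 = w\<close> survives in the first sum and \<open>l\<close> makes the right-hand side vanish.
\<close>

lemma swapped_product:
  assumes v: "v \<in> vspace V" and w: "w \<in> vspace V" and l: "\<And>n. n \<ge> l \<Longrightarrow> vop V v n w = 0"
  shows "vop V v (m + l) w = Sum_any (\<lambda>i::nat. ((- 1) ^ i * (of_int l gchoose i) * (- 1) powi l) *\<^sub>C
    vop V w (l - 1 - int i) (vop V v (m + int i) (vac V)))"
proof -
  let ?a = "\<lambda>i::nat. ((- 1) ^ i * (of_int l gchoose i) :: complex)"
  let ?s = "((- 1) powi l :: complex)"
  let ?g = "\<lambda>i::nat. ?a i *\<^sub>C (?s *\<^sub>C vop V w (- 1 + of_int l - of_nat i) (vop V v (m + int i)
      (vac V)))"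
  let ?h = "\<lambda>i::nat. ?a i *\<^sub>C vop V v (m + l - int i) (vop V w (- 1 + of_nat i) (vac V))"
  let ?L = "\<lambda>i::nat. ?a i *\<^sub>C (vop V v (m + l - int i) (vop V w (- 1 + of_nat i) (vac V))
     - ?s *\<^sub>C vop V w (- 1 + of_int l - of_nat i) (vop V v (m + int i) (vac V)))"
  have "Sum_any ?L = Sum_any (\<lambda>i::nat. (of_int m gchoose i) *\<^sub>C
      vop V (vop V v (l + int i) w) (of_int m + - 1 - of_nat i) (vac V))"
    by (rule jacobi[OF v w vac_in, unfolded jacobi_def, rule_format])
  also have "\<dots> = Sum_any (\<lambda>i::nat. 0)"
    by (rule Sum_any.cong) (simp add: l op_zero_left vac_in)
  finally have L0: "Sum_any ?L = 0" by simp
  have h0: "?h i = 0" if "i > 0" for i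
    using that creation(2)[OF w, of "- 1 + int i"] by (simp add: op_zero_right v)
  obtain N where N: "\<And>i. i \<ge> N \<Longrightarrow> vop V v (m + int i) (vac V) = 0"
    using truncation_nat[OF v vac_in] by blast
  have fg: "finite {i. ?g i \<noteq> 0}"
    by (rule finite_support_nat[of N]) (simp add: N op_zero_right w)
  have fL: "finite {i. ?L i \<noteq> 0}"
  proof (rule finite_support_nat[of "Suc N"])
    fix i assume "i \<ge> Suc N"
    then have "i > 0" "vop V v (m + int i) (vac V) = 0" using N by auto
    then show "?L i = 0"
      using creation(2)[OF w, of "- 1 + int i"] by (simp add: op_zero_right v w)
  qed
  have "Sum_any ?h = Sum_any (\<lambda>i. ?L i + ?g i)"
    by (rule Sum_any.cong) (simp add: cvec.scale_right_diff_distrib)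
  also have "\<dots> = Sum_any ?g"
    using Sum_any.distrib[OF fL fg] L0 by simp
  finally have "Sum_any ?h = Sum_any ?g" .
  moreover have "Sum_any ?h = ?h 0" by (rule Sum_any_only_0[OF h0])
  moreover have "?h 0 = vop V v (m + l) w" using creation(1)[OF w] by simp
  moreover have "Sum_any ?g = Sum_any (\<lambda>i::nat. ((- 1) ^ i * (of_int l gchoose i) * (- 1) powi l) *\<^sub>C
      vop V w (l - 1 - int i) (vop V v (m + int i) (vac V)))"
    by (rule Sum_any.cong) (simp add: scaleC_scaleC algebra_simps)
  ultimately show ?thesis by (simp only:)
qed

text \<open>
Associativity with a single term on the left: \<open>q\<close> is the last index at which \<open>v\<^sub>q w\<close> may be
nonzero, and \<open>m\<close> makes the second half of the left-hand side vanish.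
\<close>

lemma iterated_product:
  assumes u: "u \<in> vspace V" and v: "v \<in> vspace V" and w: "w \<in> vspace V"
    and m: "\<And>n. n \<ge> m \<Longrightarrow> vop V u n w = 0" and q: "\<And>n. n > q \<Longrightarrow> vop V v n w = 0"
  shows "vop V u p (vop V v q w) = Sum_any (\<lambda>i::nat. (of_int m gchoose i) *\<^sub>C
    vop V (vop V u (p - m + int i) v) (m + q - int i) w)"
proof -
  let ?L = "\<lambda>i::nat. ((- 1) ^ i * (of_int (p - m) gchoose i)) *\<^sub>C
          (vop V u (m + (p - m) - int i) (vop V v (q + of_nat i) w)
           - ((- 1) powi (p - m)) *\<^sub>C vop V v (q + of_int (p - m) - of_nat i) (vop V u (m + int i) w))"
  have "Sum_any ?L = Sum_any (\<lambda>i::nat. (of_int m gchoose i) *\<^sub>C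
          vop V (vop V u (p - m + int i) v) (of_int m + q - of_nat i) w)"
    by (rule jacobi[OF u v w, unfolded jacobi_def, rule_format])
  moreover have "Sum_any ?L = ?L 0"
    by (rule Sum_any_only_0) (simp add: m q op_zero_right u v)
  moreover have "?L 0 = vop V u p (vop V v q w)" by (simp add: m op_zero_right v)
  ultimately show ?thesis by simp
qed

lemma last_nonzero_mode:
  assumes v: "v \<in> vspace V" and w: "w \<in> vspace V" and nz: "vop V v n w \<noteq> 0"
  obtains q where "vop V v q w \<noteq> 0" "\<And>n. n > q \<Longrightarrow> vop V v n w = 0"
proof -
  obtain N where N: "\<forall>n\<ge>N. vop V v n w = 0" using truncation[OF v w] by blast
  have "\<exists>q. vop V v q w \<noteq> 0 \<and> (\<forall>n>q. vop V v n w = 0)"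
  proof (rule ccontr)
    assume neg: "\<not> ?thesis"
    have "vop V v k w = 0" for k
    proof (rule int_downward_induct[of N])
      show "vop V v m w = 0" if "m \<ge> N" for m using N that by blast
      show "vop V v m w = 0" if "\<And>k. k > m \<Longrightarrow> vop V v k w = 0" for m using neg that by blast
    qed
    then show False using nz by blast
  qed
  then show thesis using that by blast
qed

end

text \<open>
The data to be glued: the characters are permuted by \<open>\<tau>\<close>, and \<open>G d\<close> is an isomorphism from
\<open>V(d)\<close> to the twist of \<open>V(\<tau> d)\<close> by \<open>h\<close>.
\<close>

locale automorphism_lift = simple_current_orbifold +
  fixes h \<tau> G
  assumes h: "h \<in> carrier (Aut U)"
    and \<tau>: "\<And>d. d \<in> Ch \<Longrightarrow> \<tau> d \<in> Ch"
    and G: "\<And>d. d \<in> Ch \<Longrightarrow> semilinear h d (\<tau> d) (G d)"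
    and G_bij: "\<And>d. d \<in> Ch \<Longrightarrow> bij_betw (G d) (E d) (E (\<tau> d))"
    and \<tau>_one: "\<tau> \<one>\<^sub>D = \<one>\<^sub>D"
    and G_one: "\<And>u. u \<in> E \<one>\<^sub>D \<Longrightarrow> G \<one>\<^sub>D u = h u"
begin

lemma h_in: "u \<in> E \<one>\<^sub>D \<Longrightarrow> h u \<in> E \<one>\<^sub>D" and h_conf: "h (conf V) = conf V"
  using Aut_in[OF h] Aut_conf[OF h] by simp_all

lemma h_vac: "h (vac V) = vac V"
  using VOA.Aut_vac[OF VOA_U h] by simp

lemma G_in: "d \<in> Ch \<Longrightarrow> v \<in> E d \<Longrightarrow> G d v \<in> E (\<tau> d)"
  by (rule semilinear_in[OF G])

lemma G_linear: "d \<in> Ch \<Longrightarrow> linear_on (E d) (E (\<tau> d)) (G d)"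
  by (rule semilinear_linear[OF G])

lemma G_zero: "d \<in> Ch \<Longrightarrow> G d 0 = 0"
  by (rule linear_on_zero[OF G_linear subspace_E])

lemma G_nonzero:
  assumes d: "d \<in> Ch" and v: "v \<in> E d" "v \<noteq> 0"
  shows "G d v \<noteq> 0"
  using inj_onD[OF bij_betw_imp_inj_on[OF G_bij[OF d]] _ v(1) E_zero] v(2) G_zero[OF d] by auto

definition G_inv where "G_inv d = inv_into (E d) (G d)"

lemma G_inv_linear: "d \<in> Ch \<Longrightarrow> linear_on (E (\<tau> d)) (E d) (G_inv d)"
  unfolding G_inv_def by (rule linear_on_inv_into[OF G_linear G_bij subspace_E])

lemma G_inv_G: "d \<in> Ch \<Longrightarrow> v \<in> E d \<Longrightarrow> G_inv d (G d v) = v"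
  unfolding G_inv_def by (rule inv_into_f_f[OF bij_betw_imp_inj_on[OF G_bij]])

lemma G_G_inv: "d \<in> Ch \<Longrightarrow> w \<in> E (\<tau> d) \<Longrightarrow> G d (G_inv d w) = w"
  unfolding G_inv_def by (rule bij_betw_inv_into_right[OF G_bij])

lemma G_inv_op:
  assumes d: "d \<in> Ch" and u: "u \<in> E \<one>\<^sub>D" and y: "y \<in> E (\<tau> d)"
  shows "G_inv d (vop V (h u) n y) = vop V u n (G_inv d y)"
proof -
  have x: "G_inv d y \<in> E d" by (rule linear_on_in[OF G_inv_linear[OF d] y])
  have "vop V (h u) n y = G d (vop V u n (G_inv d y))"
    using semilinear_op[OF G[OF d] u x, of n] G_G_inv[OF d y] by simp
  then show ?thesis using G_inv_G[OF d E_one_op[OF d u x]] by simp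
qed

lemma \<tau>_inj: "inj_on \<tau> Ch"
proof (rule inj_onI)
  fix d e assume d: "d \<in> Ch" and e: "e \<in> Ch" and eq: "\<tau> d = \<tau> e"
  have "semilinear (\<lambda>u. u) d e (\<lambda>w. G_inv e (G d w))"
    unfolding semilinear_def
  proof (intro conjI ballI allI)
    show "linear_on (E d) (E e) (\<lambda>w. G_inv e (G d w))"
      by (rule linear_on_compose[OF G_linear[OF d, unfolded eq] G_inv_linear[OF e]])
    show "G_inv e (G d (vop V u n w)) = vop V u n (G_inv e (G d w))" if "u \<in> E \<one>\<^sub>D" "w \<in> E d" for u n w
      using semilinear_op[OF G[OF d] that] G_inv_op[OF e that(1)] G_in[OF d that(2)] eq by simp
  qed
  moreover have "bij_betw (\<lambda>w. G_inv e (G d w)) (E d) (E e)"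
    using bij_betw_trans[OF G_bij[OF d, unfolded eq] bij_betw_inv_into[OF G_bij[OF e]]]
    by (simp add: comp_def G_inv_def)
  ultimately show "d = e"
    using eigenmodules_distinct[OF d e] unfolding module_isomorphic_iff_semilinear by blast
qed

lemma \<tau>_surj: "\<tau> ` Ch = Ch"
  by (rule endo_inj_surj[OF finite_Ch _ \<tau>_inj]) (use \<tau> in blast)

text \<open>
Transporting the vertex operator of \<open>V(\<tau> d\<^sub>1)\<close> and \<open>V(\<tau> d\<^sub>2)\<close> back along \<open>G\<close> gives a nonzero
intertwining operator on \<open>V(d\<^sub>1)\<close> and \<open>V(d\<^sub>2)\<close>.  The fusion rules determine its target and, up
to a scalar, the operator.
\<close>

lemma comparison:
  assumes d: "d1 \<in> Ch" "d2 \<in> Ch"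
  shows "\<tau> (d1 \<cdot> d2) = \<tau> d1 \<cdot> \<tau> d2"
    and "\<exists>c. c \<noteq> 0 \<and> (\<forall>v\<in>E d1. \<forall>n. \<forall>w\<in>E d2.
      vop V (G d1 v) n (G d2 w) = c *\<^sub>C G (d1 \<cdot> d2) (vop V v n w))"
proof -
  have "\<tau> d1 \<cdot> \<tau> d2 \<in> \<tau> ` Ch" using \<tau> d \<tau>_surj by simp
  then obtain d3 where d3: "d3 \<in> Ch" "\<tau> d3 = \<tau> d1 \<cdot> \<tau> d2" by auto
  let ?K = "\<lambda>v n w. G_inv d3 (vop V (G d1 v) n (G d2 w))"
  have K: "intertwiner d1 d2 d3 ?K"
  proof (rule twisted_intertwiner[OF d \<tau>[OF d(1)] \<tau>[OF d(2)] h_in h_conf G[OF d(1)] G[OF d(2)]])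
    show "linear_on (E (\<tau> d1 \<cdot> \<tau> d2)) (E d3) (G_inv d3)"
      using G_inv_linear[OF d3(1)] d3(2) by simp
    show "G_inv d3 (vop V (h u) n y) = vop V u n (G_inv d3 y)"
      if "u \<in> E \<one>\<^sub>D" "y \<in> E (\<tau> d1 \<cdot> \<tau> d2)" for u n y
      using G_inv_op[OF d3(1) that(1)] that(2) d3(2) by simp
  qed
  obtain v where v: "v \<in> E d1" "v \<noteq> 0" using E_nonzero_vector[OF d(1)] by blast
  obtain w where w: "w \<in> E d2" "w \<noteq> 0" using E_nonzero_vector[OF d(2)] by blast
  obtain n where n: "vop V (G d1 v) n (G d2 w) \<noteq> 0"
    using op_nonvanishing[OF E_S[OF G_in[OF d(1) v(1)]] G_nonzero[OF d(1) v]
        E_S[OF G_in[OF d(2) w(1)]] G_nonzero[OF d(2) w]] by blast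
  have op_in3: "vop V (G d1 v) n (G d2 w) \<in> E (\<tau> d3)" if "v \<in> E d1" "w \<in> E d2" for v n w
    using E_op[OF G_in[OF d(1) that(1)] G_in[OF d(2) that(2)]] d3(2) by simp
  have K_nz: "?K v n w \<noteq> 0"
    using G_G_inv[OF d3(1) op_in3[OF v(1) w(1), of n]] n G_zero[OF d3(1)] by auto
  then have d12: "d3 = d1 \<cdot> d2" by (rule intertwiner_target[OF d d3(1) K v(1) w(1)])
  then show "\<tau> (d1 \<cdot> d2) = \<tau> d1 \<cdot> \<tau> d2" using d3(2) by simp
  obtain c where c: "\<forall>v\<in>E d1. \<forall>n. \<forall>w\<in>E d2. ?K v n w = c *\<^sub>C vop V v n w"
    using intertwiner_proportional[OF d K[unfolded d12]] unfolding d12 by blast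
  have "c \<noteq> 0" using c K_nz v(1) w(1) by auto
  moreover have "vop V (G d1 v) n (G d2 w) = c *\<^sub>C G (d1 \<cdot> d2) (vop V v n w)"
    if "v \<in> E d1" "w \<in> E d2" for v n w
  proof -
    have "vop V (G d1 v) n (G d2 w) = G d3 (?K v n w)"
      using G_G_inv[OF d3(1) op_in3[OF that]] by simp
    also have "\<dots> = G d3 (c *\<^sub>C vop V v n w)" using c that by simp
    also have "\<dots> = c *\<^sub>C G d3 (vop V v n w)"
      by (rule linear_on_scale[OF G_linear[OF d3(1)]]) (use E_op[OF that] d12 in simp)
    finally show ?thesis unfolding d12 .
  qed
  ultimately show "\<exists>c. c \<noteq> 0 \<and> (\<forall>v\<in>E d1. \<forall>n. \<forall>w\<in>E d2.
      vop V (G d1 v) n (G d2 w) = c *\<^sub>C G (d1 \<cdot> d2) (vop V v n w))" by blast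
qed

section \<open>The comparison cocycle\<close>

definition cocycle where
  "cocycle d1 d2 = (SOME c. c \<noteq> 0 \<and> (\<forall>v\<in>E d1. \<forall>n. \<forall>w\<in>E d2.
      vop V (G d1 v) n (G d2 w) = c *\<^sub>C G (d1 \<cdot> d2) (vop V v n w)))"

lemma
  assumes "d1 \<in> Ch" "d2 \<in> Ch"
  shows cocycle_nonzero: "cocycle d1 d2 \<noteq> 0"
    and G_op: "v \<in> E d1 \<Longrightarrow> w \<in> E d2 \<Longrightarrow>
      vop V (G d1 v) n (G d2 w) = cocycle d1 d2 *\<^sub>C G (d1 \<cdot> d2) (vop V v n w)"
  using someI_ex[OF comparison(2)[OF assms]] unfolding cocycle_def by blast+

lemma G_vac: "G \<one>\<^sub>D (vac V) = vac V"
  using G_one[OF vac_E] h_vac by simp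

lemma G_op_vac:
  assumes d: "d \<in> Ch" and v: "v \<in> E d"
  shows "vop V (G d v) n (vac V) = G d (vop V v n (vac V))"
proof -
  have c: "vop V (G d v) n (vac V) = cocycle d \<one>\<^sub>D *\<^sub>C G d (vop V v n (vac V))"
    if "v \<in> E d" for v n
    using G_op[OF d Ch.one_closed that vac_E, of n] d by (simp add: G_vac)
  obtain x where x: "x \<in> E d" "x \<noteq> 0" using E_nonzero_vector[OF d] by blast
  have "G d x = cocycle d \<one>\<^sub>D *\<^sub>C G d x"
    using c[OF x(1), of "- 1"] creation(1)[OF E_S[OF x(1)]] creation(1)[OF E_S[OF G_in[OF d x(1)]]]
    by simp
  then have "(cocycle d \<one>\<^sub>D - 1) *\<^sub>C G d x = 0"
    by (simp add: cvec.scale_left_diff_distrib scaleC_one)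
  then have "cocycle d \<one>\<^sub>D = 1" using G_nonzero[OF d x] by simp
  then show ?thesis using c[OF v] by (simp add: scaleC_one)
qed

text \<open>
Both sides of \<open>swapped_product\<close> are compared with their images under \<open>G\<close>: one scales by
\<open>cocycle d1 d2\<close>, the other by \<open>cocycle d2 d1\<close>, since products with the vacuum are not rescaled.
\<close>

lemma cocycle_symmetric:
  assumes d: "d1 \<in> Ch" "d2 \<in> Ch"
  shows "cocycle d1 d2 = cocycle d2 d1"
proof -
  obtain v where v: "v \<in> E d1" "v \<noteq> 0" using E_nonzero_vector[OF d(1)] by blast
  obtain w where w: "w \<in> E d2" "w \<noteq> 0" using E_nonzero_vector[OF d(2)] by blast
  note S = E_S[OF v(1)] E_S[OF w(1)]
  note GS = E_S[OF G_in[OF d(1) v(1)]] E_S[OF G_in[OF d(2) w(1)]]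
  have d12: "d1 \<cdot> d2 \<in> Ch" using d by simp
  obtain p where p: "vop V v p w \<noteq> 0" using op_nonvanishing[OF S(1) v(2) S(2) w(2)] by blast
  obtain l where l: "\<forall>n\<ge>l. vop V v n w = 0" using truncation[OF S] by blast
  \<comment> \<open>The left-hand side of \<open>swapped_product\<close> becomes \<open>v\<^sub>p w\<close>, which is nonzero.\<close>
  define m where "m = p - l"
  have ml: "m + l = p" by (simp add: m_def)
  let ?a = "\<lambda>i::nat. ((- 1) ^ i * (of_int l gchoose i) * (- 1) powi l :: complex)"
  let ?t = "\<lambda>i::nat. ?a i *\<^sub>C vop V w (l - 1 - int i) (vop V v (m + int i) (vac V))"
  have vE: "vop V v n (vac V) \<in> E d1" for n
    using E_op[OF v(1) vac_E, of n] d by simp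
  have tE: "?t i \<in> E (d1 \<cdot> d2)" for i
    using E_scale[OF E_op[OF w(1) vE]] Ch.m_comm[OF d] by simp
  have "vop V v p w = Sum_any ?t"
    using swapped_product[OF S, of l m] l ml by simp
  moreover have "vop V (G d1 v) p (G d2 w) = Sum_any (\<lambda>i. cocycle d2 d1 *\<^sub>C G (d1 \<cdot> d2) (?t i))"
  proof -
    have "vop V (G d1 v) n (G d2 w) = 0" if "n \<ge> l" for n
      using G_op[OF d v(1) w(1), of n] l that G_zero[OF d12] by simp
    then have "vop V (G d1 v) p (G d2 w) = Sum_any (\<lambda>i. ?a i *\<^sub>C
        vop V (G d2 w) (l - 1 - int i) (vop V (G d1 v) (m + int i) (vac V)))"
      using swapped_product[OF GS, of l m] ml by simp
    also have "\<dots> = Sum_any (\<lambda>i. cocycle d2 d1 *\<^sub>C G (d1 \<cdot> d2) (?t i))"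
    proof (rule Sum_any.cong)
      fix i
      have "vop V (G d2 w) (l - 1 - int i) (vop V (G d1 v) (m + int i) (vac V))
          = cocycle d2 d1 *\<^sub>C G (d1 \<cdot> d2) (vop V w (l - 1 - int i) (vop V v (m + int i) (vac V)))"
        unfolding G_op_vac[OF d(1) v(1)] G_op[OF d(2,1) w(1) vE] Ch.m_comm[OF d] ..
      moreover have "vop V w (l - 1 - int i) (vop V v (m + int i) (vac V)) \<in> E (d1 \<cdot> d2)"
        using E_op[OF w(1) vE] Ch.m_comm[OF d] by simp
      ultimately show "?a i *\<^sub>C vop V (G d2 w) (l - 1 - int i) (vop V (G d1 v) (m + int i) (vac V))
          = cocycle d2 d1 *\<^sub>C G (d1 \<cdot> d2) (?t i)"
        using linear_on_scale[OF G_linear[OF d12]] by (simp add: cvec.scale_left_commute)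
    qed
    finally show ?thesis .
  qed
  moreover have "Sum_any (\<lambda>i. cocycle d2 d1 *\<^sub>C G (d1 \<cdot> d2) (?t i)) = cocycle d2 d1 *\<^sub>C G (d1 \<cdot>
      d2) (Sum_any ?t)"
  proof (rule Sum_any_linear[where R = "E (d1 \<cdot> d2)" and T = UNIV and F = "\<lambda>x. cocycle d2 d1 *\<^sub>C G
      (d1 \<cdot> d2) x"])
    show "linear_on (E (d1 \<cdot> d2)) UNIV (\<lambda>x. cocycle d2 d1 *\<^sub>C G (d1 \<cdot> d2) x)"
      using G_linear[OF d12]
      by (auto simp: linear_on_def cvec.scale_right_distrib cvec.scale_left_commute)
    obtain N where "\<And>i. i \<ge> N \<Longrightarrow> vop V v (m + int i) (vac V) = 0"
      using truncation_nat[OF S(1) vac_in] by blast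
    then show "finite {i. ?t i \<noteq> 0}"
      by (intro finite_support_nat[of N]) (simp add: op_zero_right S)
  qed (rule subspace_E tE)+
  ultimately have "vop V (G d1 v) p (G d2 w) = cocycle d2 d1 *\<^sub>C G (d1 \<cdot> d2) (vop V v p w)" by simp
  then have "cocycle d1 d2 *\<^sub>C G (d1 \<cdot> d2) (vop V v p w) = cocycle d2 d1 *\<^sub>C G (d1 \<cdot> d2) (vop V v p w)"
    using G_op[OF d v(1) w(1)] by simp
  then show ?thesis using G_nonzero[OF d12 E_op[OF v(1) w(1)] p] by simp
qed

text \<open>
The two sides of \<open>iterated_product\<close> are the two bracketings of a triple product.
\<close>

lemma cocycle_identity:
  assumes d: "d1 \<in> Ch" "d2 \<in> Ch" "d3 \<in> Ch"
  shows "cocycle d1 d2 * cocycle (d1 \<cdot> d2) d3 = cocycle d2 d3 * cocycle d1 (d2 \<cdot> d3)"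
proof -
  obtain u where u: "u \<in> E d1" "u \<noteq> 0" using E_nonzero_vector[OF d(1)] by blast
  obtain v where v: "v \<in> E d2" "v \<noteq> 0" using E_nonzero_vector[OF d(2)] by blast
  obtain w where w: "w \<in> E d3" "w \<noteq> 0" using E_nonzero_vector[OF d(3)] by blast
  note S = E_S[OF u(1)] E_S[OF v(1)] E_S[OF w(1)]
  note GS = E_S[OF G_in[OF d(1) u(1)]] E_S[OF G_in[OF d(2) v(1)]] E_S[OF G_in[OF d(3) w(1)]]
  let ?d = "d1 \<cdot> d2 \<cdot> d3"
  have d12: "d1 \<cdot> d2 \<in> Ch" and d23: "d2 \<cdot> d3 \<in> Ch" and d123: "?d \<in> Ch" using d by simp_all
  have assoc: "d1 \<cdot> (d2 \<cdot> d3) = ?d" using Ch.m_assoc[OF d] by simp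
  obtain n where "vop V v n w \<noteq> 0" using op_nonvanishing[OF S(2) v(2) S(3) w(2)] by blast
  then obtain q where q: "vop V v q w \<noteq> 0" "\<And>n. n > q \<Longrightarrow> vop V v n w = 0"
    using last_nonzero_mode[OF S(2,3)] by blast
  obtain m where m: "\<forall>n\<ge>m. vop V u n w = 0" using truncation[OF S(1,3)] by blast
  note vw = E_op[OF v(1) w(1), of q]
  obtain p where p: "vop V u p (vop V v q w) \<noteq> 0"
    using op_nonvanishing[OF S(1) u(2) E_S[OF vw] q(1)] by blast
  let ?t = "\<lambda>i::nat. (of_int m gchoose i) *\<^sub>C vop V (vop V u (p - m + int i) v) (m + q - int i) w"
  \<comment> \<open>The factor of the bracketing \<open>(u v) w\<close>.\<close>
  let ?k = "cocycle d1 d2 * cocycle (d1 \<cdot> d2) d3"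
  have tE: "?t i \<in> E ?d" for i
    by (rule E_scale[OF E_op[OF E_op[OF u(1) v(1)] w(1)]])
  have lhs: "vop V u p (vop V v q w) = Sum_any ?t"
    by (rule iterated_product[OF S _ q(2)]) (use m in blast)
  have "vop V (G d1 u) p (vop V (G d2 v) q (G d3 w)) = Sum_any (\<lambda>i::nat. (of_int m gchoose i) *\<^sub>C
      vop V (vop V (G d1 u) (p - m + int i) (G d2 v)) (m + q - int i) (G d3 w))"
  proof (rule iterated_product[OF GS])
    show "vop V (G d1 u) n (G d3 w) = 0" if "n \<ge> m" for n
      using G_op[OF d(1,3) u(1) w(1), of n] m that G_zero[of "d1 \<cdot> d3"] d by simp
    show "vop V (G d2 v) n (G d3 w) = 0" if "n > q" for n
      using G_op[OF d(2,3) v(1) w(1), of n] q(2)[OF that] G_zero[OF d23] by simp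
  qed
  also have "\<dots> = Sum_any (\<lambda>i. ?k *\<^sub>C G ?d (?t i))"
  proof (rule Sum_any.cong)
    fix i
    let ?x = "vop V u (p - m + int i) v"
    have x: "?x \<in> E (d1 \<cdot> d2)" by (rule E_op[OF u(1) v(1)])
    have "vop V (vop V (G d1 u) (p - m + int i) (G d2 v)) (m + q - int i) (G d3 w)
        = cocycle d1 d2 *\<^sub>C vop V (G (d1 \<cdot> d2) ?x) (m + q - int i) (G d3 w)"
      unfolding G_op[OF d(1,2) u(1) v(1)] by (rule op_scale_left[OF E_S[OF G_in[OF d12 x]] GS(3)])
    also have "\<dots> = ?k *\<^sub>C G ?d (vop V ?x (m + q - int i) w)"
      unfolding G_op[OF d12 d(3) x w(1)] by (rule scaleC_scaleC)
    finally show "(of_int m gchoose i) *\<^sub>C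
        vop V (vop V (G d1 u) (p - m + int i) (G d2 v)) (m + q - int i) (G d3 w) = ?k *\<^sub>C G ?d (?t i)"
      using linear_on_scale[OF G_linear[OF d123] E_op[OF x w(1)]] by (simp add: cvec.scale_left_commute)
  qed
  also have "\<dots> = ?k *\<^sub>C G ?d (Sum_any ?t)"
  proof (rule Sum_any_linear[where R = "E ?d" and T = UNIV and F = "\<lambda>x. ?k *\<^sub>C G ?d x"])
    show "linear_on (E ?d) UNIV (\<lambda>x. ?k *\<^sub>C G ?d x)"
      using G_linear[OF d123]
      by (auto simp: linear_on_def cvec.scale_right_distrib cvec.scale_left_commute)
    obtain N where "\<And>i. i \<ge> N \<Longrightarrow> vop V u (p - m + int i) v = 0"
      using truncation_nat[OF S(1,2)] by blast
    then show "finite {i. ?t i \<noteq> 0}"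
      by (intro finite_support_nat[of N]) (simp add: op_zero_left S)
  qed (rule subspace_E tE)+
  finally have "vop V (G d1 u) p (vop V (G d2 v) q (G d3 w)) = ?k *\<^sub>C G ?d (vop V u p (vop V v q w))"
    using lhs by simp
  moreover have "vop V (G d1 u) p (vop V (G d2 v) q (G d3 w))
      = (cocycle d2 d3 * cocycle d1 (d2 \<cdot> d3)) *\<^sub>C G ?d (vop V u p (vop V v q w))"
    unfolding G_op[OF d(2,3) v(1) w(1)] op_scale_right[OF GS(1) E_S[OF G_in[OF d23 vw]]]
      G_op[OF d(1) d23 u(1) vw] assoc by (rule scaleC_scaleC)
  moreover have "G ?d (vop V u p (vop V v q w)) \<noteq> 0"
    using G_nonzero[OF d123 _ p] E_op[OF u(1) vw, of p] assoc by simp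
  ultimately show ?thesis by simp
qed

section \<open>Gluing the isomorphisms of eigenspaces\<close>

definition cobounding where
  "cobounding = (SOME t. \<forall>d\<in>Ch. t d \<noteq> 0 \<and> (\<forall>e\<in>Ch. t d * t e = cocycle d e * t (d \<cdot> e)))"

lemma
  assumes d: "d \<in> Ch"
  shows cobounding_nonzero: "cobounding d \<noteq> 0"
    and cobounding_mult: "e \<in> Ch \<Longrightarrow> cobounding d * cobounding e = cocycle d e * cobounding (d \<cdot> e)"
proof -
  have "\<exists>t. \<forall>d\<in>Ch. t d \<noteq> 0 \<and> (\<forall>e\<in>Ch. t d * t e = cocycle d e * t (d \<cdot> e))"
    by (rule Ch.symmetric_cocycle_is_coboundary[OF finite_Ch])
      (assumption | rule cocycle_nonzero cocycle_symmetric cocycle_identity)+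
  from someI_ex[OF this, folded cobounding_def] d
  show "cobounding d \<noteq> 0" "e \<in> Ch \<Longrightarrow> cobounding d * cobounding e = cocycle d e * cobounding (d \<cdot>
      e)" by blast+
qed

lemma cobounding_one: "cobounding \<one>\<^sub>D = 1"
proof -
  have "vac V = cocycle \<one>\<^sub>D \<one>\<^sub>D *\<^sub>C vac V"
    using G_op[OF Ch.one_closed Ch.one_closed vac_E vac_E, of "- 1"] vacuum[OF vac_in, of "- 1"]
    by (simp add: G_vac)
  then have "(cocycle \<one>\<^sub>D \<one>\<^sub>D - 1) *\<^sub>C vac V = 0"
    by (simp add: cvec.scale_left_diff_distrib scaleC_one)
  then have "cocycle \<one>\<^sub>D \<one>\<^sub>D = 1" using vac_nonzero by simp
  then show ?thesis
    using cobounding_mult[OF Ch.one_closed Ch.one_closed] cobounding_nonzero[OF Ch.one_closed] by simp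
qed

definition glue where
  "glue = (\<lambda>v\<in>S. \<Sum>d\<in>Ch. inverse (cobounding d) *\<^sub>C G d (proj d v))"

lemma glue_eigenspace:
  assumes d: "d \<in> Ch" and v: "v \<in> E d"
  shows "glue v = inverse (cobounding d) *\<^sub>C G d v"
proof -
  have "glue v = (\<Sum>e\<in>Ch. inverse (cobounding e) *\<^sub>C G e (proj e v))"
    by (simp add: glue_def E_S[OF v])
  also have "\<dots> = (\<Sum>e\<in>Ch. if e = d then inverse (cobounding d) *\<^sub>C G d v else 0)"
    by (rule sum.cong[OF refl]) (simp add: proj_E[OF _ d v] G_zero)
  also have "\<dots> = inverse (cobounding d) *\<^sub>C G d v"
    using finite_Ch d by simp
  finally show ?thesis .
qed

lemma glue_fixed: "u \<in> E \<one>\<^sub>D \<Longrightarrow> glue u = h u"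
  by (simp add: glue_eigenspace[OF Ch.one_closed] cobounding_one G_one scaleC_one)

lemma glue_linear: "linear_on S S glue"
proof (rule linear_onI)
  have GpS: "G d (proj d v) \<in> S" if "d \<in> Ch" "v \<in> S" for d v
    by (rule E_S[OF G_in[OF that(1) proj_in_E[OF that]]])
  show "glue x \<in> S" if "x \<in> S" for x
  proof -
    have "(\<Sum>d\<in>Ch. inverse (cobounding d) *\<^sub>C G d (proj d x)) \<in> S"
      by (rule cvec.subspace_sum[OF subspace]) (rule cvec.subspace_scale[OF subspace GpS[OF _ that]])
    then show ?thesis using that by (simp add: glue_def)
  qed
  show "glue (x + y) = glue x + glue y" if x: "x \<in> S" and y: "y \<in> S" for x y
  proof -
    have "G d (proj d (x + y)) = G d (proj d x) + G d (proj d y)" if d: "d \<in> Ch" for d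
      using linear_on_add[OF proj_linear[OF d] x y]
        linear_on_add[OF G_linear[OF d] proj_in_E[OF d x] proj_in_E[OF d y]] by simp
    then have "(\<Sum>d\<in>Ch. inverse (cobounding d) *\<^sub>C G d (proj d (x + y))) =
        (\<Sum>d\<in>Ch. inverse (cobounding d) *\<^sub>C G d (proj d x) + inverse (cobounding d) *\<^sub>C G d (proj d y))"
      by (intro sum.cong refl) (simp add: cvec.scale_right_distrib)
    then show ?thesis
      using x y cvec.subspace_add[OF subspace x y] by (simp add: glue_def sum.distrib)
  qed
  show "glue (c *\<^sub>C x) = c *\<^sub>C glue x" if x: "x \<in> S" for c x
  proof -
    have "G d (proj d (c *\<^sub>C x)) = c *\<^sub>C G d (proj d x)" if d: "d \<in> Ch" for d
      using linear_on_scale[OF proj_linear[OF d] x, of c]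
        linear_on_scale[OF G_linear[OF d] proj_in_E[OF d x], of c] by simp
    then have "(\<Sum>d\<in>Ch. inverse (cobounding d) *\<^sub>C G d (proj d (c *\<^sub>C x))) =
        (\<Sum>d\<in>Ch. c *\<^sub>C (inverse (cobounding d) *\<^sub>C G d (proj d x)))"
      by (intro sum.cong refl) (simp add: cvec.scale_left_commute)
    also have "\<dots> = c *\<^sub>C (\<Sum>d\<in>Ch. inverse (cobounding d) *\<^sub>C G d (proj d x))"
      by (rule cvec.scale_sum_right[symmetric])
    finally show ?thesis
      using x cvec.subspace_scale[OF subspace x, of c] by (simp add: glue_def)
  qed
qed

lemma glue_in: "v \<in> S \<Longrightarrow> glue v \<in> S"
  by (rule linear_on_in[OF glue_linear])

lemma glue_op_eigenspaces:
  assumes d: "d \<in> Ch" and e: "e \<in> Ch" and v: "v \<in> E d" and w: "w \<in> E e"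
  shows "glue (vop V v n w) = vop V (glue v) n (glue w)"
proof -
  have de: "d \<cdot> e \<in> Ch" using d e by simp
  note S = E_S[OF G_in[OF d v]] E_S[OF G_in[OF e w]]
  have "vop V (glue v) n (glue w) = (inverse (cobounding d) * inverse (cobounding e)) *\<^sub>C vop V (G
      d v) n (G e w)"
    unfolding glue_eigenspace[OF d v] glue_eigenspace[OF e w]
    by (simp add: op_scale_left op_scale_right S cvec.subspace_scale[OF subspace] scaleC_scaleC)
  also have "\<dots> = (inverse (cobounding d * cobounding e) * cocycle d e) *\<^sub>C G (d \<cdot> e) (vop V v n w)"
    unfolding G_op[OF d e v w] by (simp add: scaleC_scaleC)
  also have "inverse (cobounding d * cobounding e) * cocycle d e = inverse (cobounding (d \<cdot> e))"
    unfolding cobounding_mult[OF d e] using cocycle_nonzero[OF d e] by (simp add: inverse_mult_distrib)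
  finally show ?thesis
    unfolding glue_eigenspace[OF de E_op[OF v w]] by simp
qed

lemma glue_op:
  assumes v: "v \<in> S" and w: "w \<in> S"
  shows "glue (vop V v n w) = vop V (glue v) n (glue w)"
proof -
  have step: "glue (vop V v n w) = vop V (glue v) n (glue w)" if e: "e \<in> Ch" and w: "w \<in> E e" for e w
  proof (rule linear_eq_on_eigenspaces[where f = "\<lambda>v. glue (vop V v n w)" and g = "\<lambda>v. vop V (glue
      v) n (glue w)"])
    show "linear_on S S (\<lambda>v. glue (vop V v n w))"
      by (rule linear_on_compose[OF linear_op_left[OF E_S[OF w]] glue_linear])
    show "linear_on S S (\<lambda>v. vop V (glue v) n (glue w))"
      by (rule linear_on_compose[OF glue_linear linear_op_left[OF glue_in[OF E_S[OF w]]]])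
    show "glue (vop V v n w) = vop V (glue v) n (glue w)" if "d \<in> Ch" "v \<in> E d" for d v
      by (rule glue_op_eigenspaces[OF that(1) e that(2) w])
  qed (rule v)
  show ?thesis
  proof (rule linear_eq_on_eigenspaces[where f = "\<lambda>w. glue (vop V v n w)" and g = "\<lambda>w. vop V (glue
      v) n (glue w)"])
    show "linear_on S S (\<lambda>w. glue (vop V v n w))"
      by (rule linear_on_compose[OF linear_op_right[OF v] glue_linear])
    show "linear_on S S (\<lambda>w. vop V (glue v) n (glue w))"
      by (rule linear_on_compose[OF glue_linear linear_op_right[OF glue_in[OF v]]])
  qed (rule step, assumption+, rule w)
qed

text \<open>
The kernel is a submodule of \<open>V\<close> that misses the vacuum.
\<close>

lemma glue_inj: "inj_on glue S"
proof -
  let ?N = "{v \<in> S. glue v = 0}"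
  have g0: "glue 0 = 0" by (rule linear_on_zero[OF glue_linear subspace])
  have "cvec.subspace ?N"
    by (rule cvec.subspaceI)
      (simp_all add: cvec.subspace_0[OF subspace] cvec.subspace_add[OF subspace]
        cvec.subspace_scale[OF subspace] g0 linear_on_add[OF glue_linear] linear_on_scale[OF
            glue_linear])
  moreover have "vop V v n x \<in> ?N" if "v \<in> S" "x \<in> ?N" for v n x
    using that glue_op[of v x n] by (simp add: op_in op_zero_right glue_in)
  ultimately have "submodule_of V (adjoint V) ?N"
    unfolding submodule_of_def adjoint_def by simp
  then have "?N = {0} \<or> ?N = S" by (rule submodule_trivial)
  moreover have "vac V \<notin> ?N" using glue_fixed[OF vac_E] h_vac vac_nonzero by simp
  ultimately have N0: "?N = {0}" using vac_in by blast
  show ?thesis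
  proof (rule inj_onI)
    fix x y assume xy: "x \<in> S" "y \<in> S" "glue x = glue y"
    then have "x - y \<in> ?N"
      using linear_on_diff[OF glue_linear subspace xy(1,2)] cvec.subspace_diff[OF subspace
          xy(1,2)] by simp
    then show "x = y" using N0 by simp
  qed
qed

lemma glue_image: "glue ` S = S"
proof
  show "glue ` S \<subseteq> S" using glue_in by blast
  have "E e \<subseteq> glue ` S" if e: "e \<in> Ch" for e
  proof
    fix w assume w: "w \<in> E e"
    obtain d where d: "d \<in> Ch" "e = \<tau> d" using e \<tau>_surj by blast
    have x: "G_inv d w \<in> E d" using linear_on_in[OF G_inv_linear[OF d(1)]] w d(2) by simp
    let ?x = "cobounding d *\<^sub>C G_inv d w"
    have "glue ?x = inverse (cobounding d) *\<^sub>C G d ?x" by (rule glue_eigenspace[OF d(1) E_scale[OF x]])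
    also have "\<dots> = w"
      using linear_on_scale[OF G_linear[OF d(1)] x] G_G_inv[OF d(1)] w d(2) cobounding_nonzero[OF d(1)]
      by (simp add: scaleC_scaleC scaleC_one)
    finally show "w \<in> glue ` S"
      using image_eqI[of w glue ?x S] E_S[OF E_scale[OF x, of "cobounding d"]] by simp
  qed
  then have "cvec.span (\<Union>d\<in>Ch. E d) \<subseteq> glue ` S"
    by (intro cvec.span_minimal subspace_linear_image[OF glue_linear subspace]) blast
  then show "S \<subseteq> glue ` S" using span_E by simp
qed

lemma glue_Aut: "glue \<in> carrier (Aut V)"
proof -
  have "glue \<in> extensional S" unfolding glue_def by (rule restrict_extensional)
  then show ?thesis
    unfolding Aut_carrier
    using glue_inj glue_image glue_linear glue_op glue_fixed[OF conf_E] h_conf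
    by (simp add: bij_betw_def)
qed

text \<open>
Conjugation by the glued map turns \<open>b\<close> into the operator with eigenvalue \<open>d(b)\<close> on \<open>V(\<tau> d)\<close>.  As
\<open>\<tau>\<close> is multiplicative, these eigenvalues form a character of the dual group, so the operator
lies in \<open>D\<close>.
\<close>

lemma glue_normalizer: "glue \<in> normalizer (Aut V) D"
  unfolding normalizer_iff
proof (intro conjI ballI)
  show "glue \<in> carrier (Aut V)" by (rule glue_Aut)
  fix b assume b: "b \<in> D"
  \<comment> \<open>The eigenvalue on \<open>V(e)\<close> of the conjugate of \<open>b\<close>.\<close>
  let ?l = "\<lambda>e. (inv_into Ch \<tau> e) b"
  have inv\<tau>: "inv_into Ch \<tau> (\<tau> d) = d" if "d \<in> Ch" for d
    by (rule inv_into_f_f[OF \<tau>_inj that])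
  have "\<exists>b'\<in>D. \<forall>e\<in>Ch. ?l e = e b'"
  proof (rule double_dual_evaluation[OF D_group D_finite])
    show "?l \<one>\<^sub>D \<noteq> 0"
    proof -
      have "inv_into Ch \<tau> \<one>\<^sub>D = \<one>\<^sub>D" using inv\<tau>[OF Ch.one_closed] unfolding \<tau>_one .
      moreover have "\<one>\<^sub>D b = 1" using b by (simp add: char_group_one)
      ultimately show ?thesis by simp
    qed
    fix x y assume xy: "x \<in> Ch" "y \<in> Ch"
    have "x \<in> \<tau> ` Ch" "y \<in> \<tau> ` Ch" unfolding \<tau>_surj by (rule xy)+
    then obtain d e where d: "d \<in> Ch" "x = \<tau> d" and e: "e \<in> Ch" "y = \<tau> e" by (elim imageE)
    have "inv_into Ch \<tau> (x \<cdot> y) = d \<cdot> e"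
      unfolding d(2) e(2) comparison(1)[OF d(1) e(1), symmetric]
      by (rule inv\<tau>[OF Ch.m_closed[OF d(1) e(1)]])
    moreover have "(d \<cdot> e) b = d b * e b" using b by (simp add: char_group_mult)
    ultimately show "?l (x \<cdot> y) = ?l x * ?l y"
      unfolding d(2) e(2) inv\<tau>[OF d(1)] inv\<tau>[OF e(1)] by (rule trans[OF arg_cong[of _ _ "\<lambda>f. f b"]])
  qed
  then obtain b' where b'D: "b' \<in> D" and l: "\<forall>e\<in>Ch. ?l e = e b'" ..
  have b'_eq: "d b = (\<tau> d) b'" if "d \<in> Ch" for d
  proof -
    have "(inv_into Ch \<tau> (\<tau> d)) b = (\<tau> d) b'" by (rule l[rule_format, OF \<tau>[OF that]])
    then show ?thesis by (simp only: inv\<tau>[OF that])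
  qed
  have "glue (b v) = b' (glue v)" if v: "v \<in> S" for v
  proof (rule linear_eq_on_eigenspaces[where f = "\<lambda>v. glue (b v)" and g = "\<lambda>v. b' (glue v)"])
    show "linear_on S S (\<lambda>v. glue (b v))"
      by (rule linear_on_compose[OF Aut_linear[OF D_Aut[OF b]] glue_linear])
    show "linear_on S S (\<lambda>v. b' (glue v))"
      by (rule linear_on_compose[OF glue_linear Aut_linear[OF D_Aut[OF b'D]]])
    fix d v assume d: "d \<in> Ch" and v: "v \<in> E d"
    have gE: "glue v \<in> E (\<tau> d)"
      unfolding glue_eigenspace[OF d v] by (rule E_scale[OF G_in[OF d v]])
    have "glue (b v) = d b *\<^sub>C glue v"
      unfolding E_eigen[OF v b] by (rule linear_on_scale[OF glue_linear E_S[OF v]])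
    then show "glue (b v) = b' (glue v)"
      unfolding E_eigen[OF gE b'D] b'_eq[OF d] .
  qed (rule v)
  then have "\<forall>v\<in>S. glue (b v) = b' (glue v)" by (rule ballI)
  then show "\<exists>b'\<in>D. \<forall>v\<in>S. glue (b v) = b' (glue v)" by (rule bexI[OF _ b'D])
qed

lemma glue_restriction: "restriction_map V D glue = h"
proof (rule extensionalityI[of _ "E \<one>\<^sub>D"])
  show "h \<in> extensional (E \<one>\<^sub>D)" using Aut_ext[OF h] by simp
qed (simp_all add: restriction_map_def glue_fixed)

end

context simple_current_orbifold
begin

lemma semilinear_from_twist_iso:
  assumes iso: "module_isomorphic U (twist (Md e) k) (Md d)" and d: "d \<in> Ch" and e: "e \<in> Ch"
    and k: "\<And>u. u \<in> E \<one>\<^sub>D \<Longrightarrow> k u \<in> E \<one>\<^sub>D"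
  shows "\<exists>g. semilinear k d e g \<and> bij_betw g (E d) (E e)"
proof -
  obtain f where f: "linear_on (E e) (E d) f" "bij_betw f (E e) (E d)"
    "\<And>u n y. u \<in> E \<one>\<^sub>D \<Longrightarrow> y \<in> E e \<Longrightarrow> f (vop V (k u) n y) = vop V u n (f y)"
    using iso unfolding module_isomorphic_def by (auto simp: twist_def)
  let ?g = "inv_into (E e) f"
  note inj = bij_betw_imp_inj_on[OF f(2)]
  have "semilinear k d e ?g"
    unfolding semilinear_def
  proof (intro conjI ballI allI)
    show lin: "linear_on (E d) (E e) ?g"
      by (rule linear_on_inv_into[OF f(1,2) subspace_E])
    fix u n w assume u: "u \<in> E \<one>\<^sub>D" and w: "w \<in> E d"
    have gw: "?g w \<in> E e" by (rule linear_on_in[OF lin w])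
    have "vop V u n w = f (vop V (k u) n (?g w))"
      using f(3)[OF u gw] bij_betw_inv_into_right[OF f(2) w] by simp
    then show "?g (vop V u n w) = vop V (k u) n (?g w)"
      using inv_into_f_f[OF inj E_one_op[OF e k[OF u] gw]] by simp
  qed
  then show ?thesis using bij_betw_inv_into[OF f(2)] by blast
qed

text \<open>
Membership of \<open>h\<close> in \<open>H\<close> provides the isomorphisms to be glued.  For the trivial character the
isomorphism has to be \<open>h\<close> itself, so that the glued map extends \<open>h\<close>.
\<close>

lemma restriction_surjective:
  assumes h: "h \<in> carrier (H_group V D)"
  shows "h \<in> restriction_map V D ` carrier (normalizer_group V D)"
proof -
  have hA: "h \<in> carrier (Aut U)"
    and classes: "(\<lambda>d. iso_class U (twist (Md d) h)) ` Ch = (\<lambda>d. iso_class U (Md d)) ` Ch"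
    using h by (simp_all add: H_group_def)
  have h_in: "h u \<in> E \<one>\<^sub>D" if "u \<in> E \<one>\<^sub>D" for u using Aut_in[OF hA] that by simp
  have "\<forall>d\<in>Ch. \<exists>e g. e \<in> Ch \<and> semilinear h d e g \<and> bij_betw g (E d) (E e) \<and>
      (d = \<one>\<^sub>D \<longrightarrow> e = \<one>\<^sub>D \<and> g = h)"
  proof
    fix d assume d: "d \<in> Ch"
    show "\<exists>e g. e \<in> Ch \<and> semilinear h d e g \<and> bij_betw g (E d) (E e) \<and>
      (d = \<one>\<^sub>D \<longrightarrow> e = \<one>\<^sub>D \<and> g = h)"
    proof (cases "d = \<one>\<^sub>D")
      case True
      have "semilinear h \<one>\<^sub>D \<one>\<^sub>D h"
        unfolding semilinear_def using Aut_linear[OF hA] Aut_op[OF hA] by simp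
      moreover have "bij_betw h (E \<one>\<^sub>D) (E \<one>\<^sub>D)" using Aut_bij[OF hA] by simp
      ultimately show ?thesis using True by blast
    next
      case False
      have "Md d \<in> iso_class U (Md d)"
        unfolding iso_class_def using VOA_module_Md[OF d] module_isomorphic_refl by blast
      moreover obtain e where e: "e \<in> Ch" "iso_class U (Md d) = iso_class U (twist (Md e) h)"
        using classes d by blast
      ultimately have "module_isomorphic U (twist (Md e) h) (Md d)"
        unfolding iso_class_def by blast
      from semilinear_from_twist_iso[OF this d e(1) h_in] show ?thesis using e(1) False by blast
    qed
  qed
  from bchoice[OF this] obtain \<tau> where "\<forall>d\<in>Ch. \<exists>g. \<tau> d \<in> Ch \<and> semilinear h d (\<tau> d) g \<and>
      bij_betw g (E d) (E (\<tau> d)) \<and> (d = \<one>\<^sub>D \<longrightarrow> \<tau> d = \<one>\<^sub>D \<and> g = h)" ..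
  from bchoice[OF this] obtain G where \<tau>: "\<forall>d\<in>Ch. \<tau> d \<in> Ch \<and> semilinear h d (\<tau> d) (G d) \<and>
      bij_betw (G d) (E d) (E (\<tau> d)) \<and> (d = \<one>\<^sub>D \<longrightarrow> \<tau> d = \<one>\<^sub>D \<and> G d = h)" ..
  have one: "\<tau> \<one>\<^sub>D = \<one>\<^sub>D" "G \<one>\<^sub>D = h" using \<tau>[rule_format, OF Ch.one_closed] by simp_all
  interpret automorphism_lift V D h \<tau> G
    by unfold_locales (use \<tau> hA in \<open>simp_all add: one\<close>)
  show ?thesis
  proof (rule image_eqI[where f = "restriction_map V D" and x = glue])
    show "h = restriction_map V D glue" by (rule glue_restriction[symmetric])
    show "glue \<in> carrier (normalizer_group V D)"
      using glue_normalizer by (simp add: normalizer_group_def)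
  qed
qed

end

theorem theorem3p3:
  fixes V :: "'a::complex_vector voa" and D :: "('a \<Rightarrow> 'a) set"
  assumes "simple_VOA V"
    and "subgroup D (Aut V)" and "comm_group (Aut V \<lparr>carrier := D\<rparr>)" and "finite D"
    and "\<And>d1 d2. \<lbrakk>d1 \<in> carrier (chars V D); d2 \<in> carrier (chars V D)\<rbrakk> \<Longrightarrow>
      fusion_product (fixed_VOA V D) (eigenmodule V D d1) (eigenmodule V D d2) =
      single_class (fixed_VOA V D) (eigenmodule V D (d1 \<otimes>\<^bsub>chars V D\<^esub> d2))"
  shows "restriction_map V D \<in> hom (normalizer_group V D) (H_group V D) \<and>
    restriction_map V D ` carrier (normalizer_group V D) = carrier (H_group V D) \<and>
    kernel (normalizer_group V D) (H_group V D) (restriction_map V D) = D"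
proof -
  have "VOA V" using assms(1) by (simp add: simple_VOA_def)
  from simple_vertex_algebra.intro[OF this simple_vertex_algebra_axioms.intro[OF assms(1)]]
  have "orbifold V D" by (rule orbifold.intro[OF _ orbifold_axioms.intro[OF assms(2-4)]])
  then interpret simple_current_orbifold V D
    by (rule simple_current_orbifold.intro[OF _ simple_current_orbifold_axioms.intro[OF assms(5)]])
  show ?thesis
  proof (intro conjI)
    show "restriction_map V D \<in> hom (normalizer_group V D) (H_group V D)"
      by (rule restriction_hom)
    show "restriction_map V D ` carrier (normalizer_group V D) = carrier (H_group V D)"
    proof
      show "restriction_map V D ` carrier (normalizer_group V D) \<subseteq> carrier (H_group V D)"
        by (rule image_subsetI) (rule hom_in_carrier[OF restriction_hom])
      show "carrier (H_group V D) \<subseteq> restriction_map V D ` carrier (normalizer_group V D)"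
        by (rule subsetI) (rule restriction_surjective)
    qed
    show "kernel (normalizer_group V D) (H_group V D) (restriction_map V D) = D"
      by (rule restriction_kernel)
  qed
qed

end
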